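(* Let $M$ be a complete Riemannian manifold satisfying the doubling property $(D)$, let $\beta\in(1,\infty)$, and assume that the Poincaré inequality $(P_\beta)$ holds on $M$. For each ball $Q$ let $\phi_Q$ be a function supported in $Q$ with $\|\phi_Q\|_{L^\infty}\le C$, $\||\nabla\phi_Q|\|_{L^\infty}\le Cr_Q^{-1}$ and $\int\phi_Q\,d\mu=\mu(Q)$, with $C$ independent of $Q$, and set $$B_Q(f)=f-\left(\frac1{\mu(Q)}\int_Q f\,d\mu\right)\phi_Q.$$ Then the concept of $(1,\beta)$-atoms exactly corresponds to the concept of atoms defined with the operators $B_Q$. Thus the different atomic Hardy–Sobolev spaces are equal: $$HS^1_{F,(\beta),ato}=HW^1_{F,(\beta),ato},\qquad HS^1_{(\beta),ato}=HW^1_{(\beta),ato}.$$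
   Context: $\mu$ is the Riemannian measure on $M$, $\nabla$ the Riemannian gradient, $L^p=L^p(M,\mu)$; balls are open balls, $Q(x,r)$ is the ball of center $x$ and radius $r$, and $r_Q$ is the radius of $Q$. $\beta'$ is the conjugate exponent of $\beta$. $(D)$: there is $C>0$ with $\mu(Q(x,2r))\le C\mu(Q(x,r))$ for all $x\in M$, $r>0$. $(P_\beta)$: there is $C>0$ such that for every compactly supported Lipschitz function $f$ on $M$ and every ball $Q$ of radius $r>0$, $\left(\frac1{\mu(Q)}\int_Q|f-f_Q|^\beta d\mu\right)^{1/\beta}\le Cr\left(\frac1{\mu(Q)}\int_Q|\nabla f|^\beta d\mu\right)^{1/\beta}$, where $f_Q=\frac1{\mu(Q)}\int_Q f\,d\mu$. $W^{1,\beta}$ is the closure of $C_0^\infty(M)$ for the norm $\|f\|_{W^{1,\beta}}=\||f|+|\nabla f|\|_{L^\beta}$. A (non-homogeneous) $(1,\beta)$-atom associated to a ball $Q$ is a function $m$ supported in $Q$ with $\|m\|_{W^{1,\beta}}\le\mu(Q)^{-1/\beta'}$ and $\int m\,d\mu=0$. $HS^1_{(\beta),ato}$ is the space of $f=\sum_{i}\lambda_i b_i$ with $b_i$ $(1,\beta)$-atoms and $\sum_i|\lambda_i|<\infty$, normed by the infimum of $\sum_i|\lambda_i|$ over such decompositions; $HS^1_{F,(\beta),ato}$ is the set of functions admitting a finite such decomposition. An atom (defined with the operators $B_Q$) associated to a ball $Q$ is a function $m\in L^1_{loc}$ for which there is a real function $g_Q$ compactly supported in the ball $Q$ such that $m=B_Q(g_Q)$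 and $\|g_Q\|_{W^{1,\beta}}\le\mu(Q)^{-1/\beta'}$. $HW^1_{(\beta),ato}$ is the space of measurable functions $h=\sum_{i\in\mathbb N}\lambda_i m_i$ ($\mu$-a.e.) with $m_i$ such atoms, $\lambda_i$ real and $\sum_i|\lambda_i|<\infty$, normed by the infimum of $\sum_i|\lambda_i|$ over such decompositions; $HW^1_{F,(\beta),ato}$ is the set of functions admitting a finite such decomposition. *)

theory Defs
  imports "HOL-Analysis.Analysis"
begin

section \<open>Smooth maps between Euclidean spaces\<close>

text \<open>\<open>S\<close> is meant to be open. A map is \<open>C\<^sup>k\<^sup>+\<^sup>1\<close> if it is differentiable and all its directional
  derivatives are \<open>C\<^sup>k\<close>.\<close>

primrec ck_on :: "nat \<Rightarrow> 'v::real_normed_vector set \<Rightarrow> ('v \<Rightarrow> 'w::real_normed_vector) \<Rightarrow> bool" where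
  "ck_on 0 S f \<longleftrightarrow> continuous_on S f"
| "ck_on (Suc k) S f \<longleftrightarrow> (\<forall>x\<in>S. f differentiable at x) \<and>
     (\<forall>v. ck_on k S (\<lambda>x. frechet_derivative f (at x) v))"

definition smooth_map_on :: "'v::real_normed_vector set \<Rightarrow> ('v \<Rightarrow> 'w::real_normed_vector) \<Rightarrow> bool" where
  "smooth_map_on S f \<longleftrightarrow> (\<forall>k. ck_on k S f)"

section \<open>Riemannian manifolds\<close>

text \<open>A Riemannian structure on the type \<open>'a\<close> is a set of charts, each of which carries the
  matrix of the metric tensor in its coordinates: \<open>gram c p $ i $ j\<close> is
  \<open>g\<^sub>p(\<partial>\<^sub>i, \<partial>\<^sub>j)\<close>. A tangent vector at \<open>p\<close> is given by its components in a chart around \<open>p\<close>.\<close>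

record ('a, 'n) riem_chart =
  dom :: "'a set"
  coord :: "'a \<Rightarrow> real ^ 'n"
  gram :: "'a \<Rightarrow> real ^ 'n ^ 'n"

definition coord_inv :: "('a, 'n::finite) riem_chart \<Rightarrow> real ^ 'n \<Rightarrow> 'a" where
  "coord_inv c = inv_into (dom c) (coord c)"

definition transition :: "('a, 'n::finite) riem_chart \<Rightarrow> ('a, 'n) riem_chart \<Rightarrow> real ^ 'n \<Rightarrow> real ^ 'n" where
  "transition c d = coord d \<circ> coord_inv c"

definition smooth_atlas :: "('a::topological_space, 'n::finite) riem_chart set \<Rightarrow> bool" where
  "smooth_atlas A \<longleftrightarrow>
     (\<Union>c\<in>A. dom c) = UNIV \<and>
     (\<forall>c\<in>A. open (dom c) \<and> open (coord c ` dom c) \<and>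
        homeomorphism (dom c) (coord c ` dom c) (coord c) (coord_inv c)) \<and>
     (\<forall>c\<in>A. \<forall>d\<in>A. smooth_map_on (coord c ` (dom c \<inter> dom d)) (transition c d))"

definition riemannian_metric :: "('a::topological_space, 'n::finite) riem_chart set \<Rightarrow> bool" where
  "riemannian_metric A \<longleftrightarrow>
     (\<forall>c\<in>A. smooth_map_on (coord c ` dom c) (gram c \<circ> coord_inv c)) \<and>
     (\<forall>c\<in>A. \<forall>p\<in>dom c. transpose (gram c p) = gram c p \<and>
        (\<forall>v. v \<noteq> 0 \<longrightarrow> v \<bullet> (gram c p *v v) > 0)) \<and>
     (\<forall>c\<in>A. \<forall>d\<in>A. \<forall>p\<in>dom c \<inter> dom d.
        let J = jacobian (transition c d) (at (coord c p))
        in gram c p = transpose J ** gram d p ** J)"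

definition chart_at :: "('a, 'n::finite) riem_chart set \<Rightarrow> 'a \<Rightarrow> ('a, 'n) riem_chart" where
  "chart_at A p = (SOME c. c \<in> A \<and> p \<in> dom c)"

text \<open>Speed, length and gradient below are computed in an arbitrary chart around the point; they do
  not depend on its choice.\<close>

definition pw_C1_curve :: "('a::topological_space, 'n::finite) riem_chart set \<Rightarrow> (real \<Rightarrow> 'a) \<Rightarrow> bool" where
  "pw_C1_curve A \<gamma> \<longleftrightarrow> path \<gamma> \<and>
     (\<exists>S. finite S \<and>
        (\<forall>c\<in>A. (coord c \<circ> \<gamma>) C1_differentiable_on ({0..1} \<inter> \<gamma> -` dom c - S)))"

definition curve_speed :: "('a, 'n::finite) riem_chart set \<Rightarrow> (real \<Rightarrow> 'a) \<Rightarrow> real \<Rightarrow> real" where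
  "curve_speed A \<gamma> t =
     (let c = chart_at A (\<gamma> t); v = vector_derivative (coord c \<circ> \<gamma>) (at t)
      in sqrt (v \<bullet> (gram c (\<gamma> t) *v v)))"

definition curve_length :: "('a, 'n::finite) riem_chart set \<Rightarrow> (real \<Rightarrow> 'a) \<Rightarrow> ennreal" where
  "curve_length A \<gamma> = (\<integral>\<^sup>+ t. indicator {0..1} t * ennreal (curve_speed A \<gamma> t) \<partial>lborel)"

definition riemannian_distance ::
    "('a::topological_space, 'n::finite) riem_chart set \<Rightarrow> 'a \<Rightarrow> 'a \<Rightarrow> ennreal" where
  "riemannian_distance A p q =
     (INF \<gamma> \<in> {\<gamma>. pw_C1_curve A \<gamma> \<and> pathstart \<gamma> = p \<and> pathfinish \<gamma> = q}. curve_length A \<gamma>)"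

text \<open>The ambient distance of \<open>'a\<close> is required to be the Riemannian distance. As the former is
  finite, the manifold is connected.\<close>

definition riemannian_manifold ::
    "('a::{metric_space, second_countable_topology}, 'n::finite) riem_chart set \<Rightarrow> bool" where
  "riemannian_manifold A \<longleftrightarrow> smooth_atlas A \<and> riemannian_metric A \<and>
     (\<forall>p q. ennreal (dist p q) = riemannian_distance A p q)"

text \<open>\<open>d\<mu> = sqrt (det g) dx\<close> in each chart; by second countability this determines \<open>\<mu>\<close> uniquely.\<close>

definition riemannian_measure ::
    "('a::topological_space, 'n::finite) riem_chart set \<Rightarrow> 'a measure \<Rightarrow> bool" where
  "riemannian_measure A \<mu> \<longleftrightarrow> sets \<mu> = sets borel \<and>
     (\<forall>c\<in>A. \<forall>B\<in>sets borel. B \<subseteq> dom c \<longrightarrow>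
        emeasure \<mu> B =
          (\<integral>\<^sup>+ x. indicator (coord c ` B) x * ennreal (sqrt (det (gram c (coord_inv c x)))) \<partial>lborel))"

text \<open>Components of the gradient \<open>g\<^sup>-\<^sup>1 df\<close> in the chart \<open>c\<close>, where \<open>f\<close> is differentiable at \<open>p\<close>. For a
  Lipschitz \<open>f\<close> this is almost everywhere (Rademacher); the value \<open>0\<close> elsewhere is immaterial.\<close>

definition gradient ::
    "('a, 'n::finite) riem_chart \<Rightarrow> ('a \<Rightarrow> real) \<Rightarrow> 'a \<Rightarrow> real ^ 'n" where
  "gradient c f p =
     (if (f \<circ> coord_inv c) differentiable at (coord c p)
      then matrix_inv (gram c p) *v
             (\<chi> i. frechet_derivative (f \<circ> coord_inv c) (at (coord c p)) (axis i 1))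
      else 0)"

definition grad_norm ::
    "('a, 'n::finite) riem_chart set \<Rightarrow> ('a \<Rightarrow> real) \<Rightarrow> 'a \<Rightarrow> real" where
  "grad_norm A f p =
     (let c = chart_at A p; v = gradient c f p in sqrt (v \<bullet> (gram c p *v v)))"

section \<open>The doubling property and the Poincare inequality\<close>

definition doubling :: "'a::metric_space measure \<Rightarrow> bool" where
  "doubling \<mu> \<longleftrightarrow>
     (\<exists>C>0. \<forall>x r. r > 0 \<longrightarrow> emeasure \<mu> (ball x (2 * r)) \<le> ennreal C * emeasure \<mu> (ball x r))"

definition average :: "'a measure \<Rightarrow> 'a set \<Rightarrow> ('a \<Rightarrow> real) \<Rightarrow> real" where
  "average \<mu> Q f = (LINT y:Q|\<mu>. f y) / measure \<mu> Q"

definition compactly_supported :: "('a::topological_space \<Rightarrow> real) \<Rightarrow> bool" where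
  "compactly_supported f \<longleftrightarrow> compact (closure {x. f x \<noteq> 0})"

definition lipschitz :: "('a::metric_space \<Rightarrow> real) \<Rightarrow> bool" where
  "lipschitz f \<longleftrightarrow> (\<exists>L. L-lipschitz_on UNIV f)"

definition poincare ::
    "('a::metric_space, 'n::finite) riem_chart set \<Rightarrow> 'a measure \<Rightarrow> real \<Rightarrow> bool" where
  "poincare A \<mu> \<beta> \<longleftrightarrow>
     (\<exists>C>0. \<forall>f. compactly_supported f \<and> lipschitz f \<longrightarrow>
        (\<forall>x r. r > 0 \<longrightarrow>
           (let Q = ball x r in
              average \<mu> Q (\<lambda>y. \<bar>f y - average \<mu> Q f\<bar> powr \<beta>) powr (1 / \<beta>)
              \<le> C * r * average \<mu> Q (\<lambda>y. grad_norm A f y powr \<beta>) powr (1 / \<beta>))))"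

section \<open>The Sobolev space\<close>

definition Lp_space :: "'a measure \<Rightarrow> real \<Rightarrow> ('a \<Rightarrow> real) set" where
  "Lp_space \<mu> \<beta> = {f \<in> borel_measurable \<mu>. integrable \<mu> (\<lambda>x. \<bar>f x\<bar> powr \<beta>)}"

definition Lp_norm :: "'a measure \<Rightarrow> real \<Rightarrow> ('a \<Rightarrow> real) \<Rightarrow> real" where
  "Lp_norm \<mu> \<beta> f = (LINT x|\<mu>. \<bar>f x\<bar> powr \<beta>) powr (1 / \<beta>)"

definition test_functions :: "('a::topological_space, 'n::finite) riem_chart set \<Rightarrow> ('a \<Rightarrow> real) set" where
  "test_functions A =
     {f. compactly_supported f \<and> (\<forall>c\<in>A. smooth_map_on (coord c ` dom c) (f \<circ> coord_inv c))}"

text \<open>The Sobolev norm on test functions.\<close>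

definition test_norm ::
    "('a, 'n::finite) riem_chart set \<Rightarrow> 'a measure \<Rightarrow> real \<Rightarrow> ('a \<Rightarrow> real) \<Rightarrow> real" where
  "test_norm A \<mu> \<beta> f = Lp_norm \<mu> \<beta> (\<lambda>x. \<bar>f x\<bar> + grad_norm A f x)"

definition sobolev_approx ::
    "('a::topological_space, 'n::finite) riem_chart set \<Rightarrow> 'a measure \<Rightarrow> real \<Rightarrow>
      ('a \<Rightarrow> real) \<Rightarrow> (nat \<Rightarrow> 'a \<Rightarrow> real) \<Rightarrow> bool" where
  "sobolev_approx A \<mu> \<beta> f u \<longleftrightarrow>
     (\<forall>n. u n \<in> test_functions A) \<and>
     (\<forall>\<epsilon>>0. \<exists>N. \<forall>m\<ge>N. \<forall>n\<ge>N. test_norm A \<mu> \<beta> (\<lambda>x. u m x - u n x) < \<epsilon>) \<and>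
     (\<lambda>n. Lp_norm \<mu> \<beta> (\<lambda>x. u n x - f x)) \<longlonglongrightarrow> 0"

text \<open>The closure of the test functions, realised inside \<open>L\<^sup>\<beta>\<close>, with the norm extended by
  continuity. The limit in \<open>sobolev_norm\<close> is the same for all approximating sequences, because the
  gradient is closable; so the infimum is over a singleton.\<close>

definition sobolev_space ::
    "('a::topological_space, 'n::finite) riem_chart set \<Rightarrow> 'a measure \<Rightarrow> real \<Rightarrow> ('a \<Rightarrow> real) set" where
  "sobolev_space A \<mu> \<beta> = {f \<in> Lp_space \<mu> \<beta>. \<exists>u. sobolev_approx A \<mu> \<beta> f u}"

definition sobolev_norm ::
    "('a::topological_space, 'n::finite) riem_chart set \<Rightarrow> 'a measure \<Rightarrow> real \<Rightarrow> ('a \<Rightarrow> real) \<Rightarrow> real" where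
  "sobolev_norm A \<mu> \<beta> f =
     Inf {lim (\<lambda>n. test_norm A \<mu> \<beta> (u n)) | u. sobolev_approx A \<mu> \<beta> f u}"

section \<open>Atoms and atomic spaces\<close>

text \<open>Support of a function that is only determined almost everywhere.\<close>

definition ess_support :: "'a::topological_space measure \<Rightarrow> ('a \<Rightarrow> real) \<Rightarrow> 'a set" where
  "ess_support \<mu> f = - \<Union>{U. open U \<and> (AE x in \<mu>. x \<in> U \<longrightarrow> f x = 0)}"

definition L1_loc :: "'a::topological_space measure \<Rightarrow> ('a \<Rightarrow> real) set" where
  "L1_loc \<mu> = {f \<in> borel_measurable \<mu>. \<forall>K. compact K \<longrightarrow> set_integrable \<mu> K f}"

text \<open>A ball \<open>Q\<close> is given by its center \<open>x\<close> and radius \<open>r\<close>. The exponent is \<open>-1/\<beta>'\<close> with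
  \<open>\<beta>' = \<beta>/(\<beta>-1)\<close>.\<close>

definition sobolev_atom ::
    "('a::metric_space, 'n::finite) riem_chart set \<Rightarrow> 'a measure \<Rightarrow> real \<Rightarrow>
      'a \<Rightarrow> real \<Rightarrow> ('a \<Rightarrow> real) \<Rightarrow> bool" where
  "sobolev_atom A \<mu> \<beta> x r m \<longleftrightarrow>
     m \<in> sobolev_space A \<mu> \<beta> \<and> ess_support \<mu> m \<subseteq> ball x r \<and>
     sobolev_norm A \<mu> \<beta> m \<le> measure \<mu> (ball x r) powr (- 1 / (\<beta> / (\<beta> - 1))) \<and>
     (LINT y|\<mu>. m y) = 0"

definition B_op ::
    "'a::metric_space measure \<Rightarrow> ('a \<Rightarrow> real \<Rightarrow> 'a \<Rightarrow> real) \<Rightarrow> 'a \<Rightarrow> real \<Rightarrow>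
      ('a \<Rightarrow> real) \<Rightarrow> 'a \<Rightarrow> real" where
  "B_op \<mu> \<phi> x r f = (\<lambda>y. f y - average \<mu> (ball x r) f * \<phi> x r y)"

definition B_atom ::
    "('a::metric_space, 'n::finite) riem_chart set \<Rightarrow> 'a measure \<Rightarrow> real \<Rightarrow>
      ('a \<Rightarrow> real \<Rightarrow> 'a \<Rightarrow> real) \<Rightarrow> 'a \<Rightarrow> real \<Rightarrow> ('a \<Rightarrow> real) \<Rightarrow> bool" where
  "B_atom A \<mu> \<beta> \<phi> x r m \<longleftrightarrow>
     m \<in> L1_loc \<mu> \<and>
     (\<exists>g \<in> sobolev_space A \<mu> \<beta>.
        compact (ess_support \<mu> g) \<and> ess_support \<mu> g \<subseteq> ball x r \<and>
        (AE y in \<mu>. m y = B_op \<mu> \<phi> x r g y) \<and>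
        sobolev_norm A \<mu> \<beta> g \<le> measure \<mu> (ball x r) powr (- 1 / (\<beta> / (\<beta> - 1))))"

text \<open>Below, \<open>T\<close> is the set of atoms. Functions are identified when they agree almost everywhere.\<close>

definition atomic_decomp ::
    "'a measure \<Rightarrow> ('a \<Rightarrow> real) set \<Rightarrow> ('a \<Rightarrow> real) \<Rightarrow> (nat \<Rightarrow> real) \<Rightarrow> (nat \<Rightarrow> 'a \<Rightarrow> real) \<Rightarrow> bool" where
  "atomic_decomp \<mu> T f a b \<longleftrightarrow>
     (\<forall>i. b i \<in> T) \<and> summable (\<lambda>i. \<bar>a i\<bar>) \<and> (AE x in \<mu>. (\<lambda>i. a i * b i x) sums f x)"

definition atomic_space :: "'a measure \<Rightarrow> ('a \<Rightarrow> real) set \<Rightarrow> ('a \<Rightarrow> real) set" where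
  "atomic_space \<mu> T = {f \<in> borel_measurable \<mu>. \<exists>a b. atomic_decomp \<mu> T f a b}"

definition atomic_norm :: "'a measure \<Rightarrow> ('a \<Rightarrow> real) set \<Rightarrow> ('a \<Rightarrow> real) \<Rightarrow> real" where
  "atomic_norm \<mu> T f = Inf {(\<Sum>i. \<bar>a i\<bar>) | a. \<exists>b. atomic_decomp \<mu> T f a b}"

definition finite_atomic_space :: "'a measure \<Rightarrow> ('a \<Rightarrow> real) set \<Rightarrow> ('a \<Rightarrow> real) set" where
  "finite_atomic_space \<mu> T =
     {f \<in> borel_measurable \<mu>. \<exists>N a b. (\<forall>i<N. b i \<in> T) \<and> (AE x in \<mu>. f x = (\<Sum>i<(N::nat). a i * b i x))}"

definition sobolev_atoms ::
    "('a::metric_space, 'n::finite) riem_chart set \<Rightarrow> 'a measure \<Rightarrow> real \<Rightarrow> ('a \<Rightarrow> real) set" where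
  "sobolev_atoms A \<mu> \<beta> = {m. \<exists>x r. r > 0 \<and> sobolev_atom A \<mu> \<beta> x r m}"

definition B_atoms ::
    "('a::metric_space, 'n::finite) riem_chart set \<Rightarrow> 'a measure \<Rightarrow> real \<Rightarrow>
      ('a \<Rightarrow> real \<Rightarrow> 'a \<Rightarrow> real) \<Rightarrow> ('a \<Rightarrow> real) set" where
  "B_atoms A \<mu> \<beta> \<phi> = {m. \<exists>x r. r > 0 \<and> B_atom A \<mu> \<beta> \<phi> x r m}"

definition HS where "HS A \<mu> \<beta> = atomic_space \<mu> (sobolev_atoms A \<mu> \<beta>)"
definition HS_norm where "HS_norm A \<mu> \<beta> = atomic_norm \<mu> (sobolev_atoms A \<mu> \<beta>)"
definition HS_fin where "HS_fin A \<mu> \<beta> = finite_atomic_space \<mu> (sobolev_atoms A \<mu> \<beta>)"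

definition HW where "HW A \<mu> \<beta> \<phi> = atomic_space \<mu> (B_atoms A \<mu> \<beta> \<phi>)"
definition HW_norm where "HW_norm A \<mu> \<beta> \<phi> = atomic_norm \<mu> (B_atoms A \<mu> \<beta> \<phi>)"
definition HW_fin where "HW_fin A \<mu> \<beta> \<phi> = finite_atomic_space \<mu> (B_atoms A \<mu> \<beta> \<phi>)"

text \<open>The functions \<open>\<phi>\<^sub>Q\<close>, \<open>Q\<close> the ball of center \<open>x\<close> and radius \<open>r\<close>. A function with bounded
  gradient is understood as a Lipschitz function.\<close>

definition adapted_family ::
    "('a::metric_space, 'n::finite) riem_chart set \<Rightarrow> 'a measure \<Rightarrow> ('a \<Rightarrow> real \<Rightarrow> 'a \<Rightarrow> real) \<Rightarrow> bool" where
  "adapted_family A \<mu> \<phi> \<longleftrightarrow>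
     (\<exists>C. \<forall>x r. r > 0 \<longrightarrow>
        lipschitz (\<phi> x r) \<and> closure {y. \<phi> x r y \<noteq> 0} \<subseteq> ball x r \<and>
        (AE y in \<mu>. \<bar>\<phi> x r y\<bar> \<le> C) \<and>
        (AE y in \<mu>. grad_norm A (\<phi> x r) y \<le> C / r) \<and>
        (LINT y|\<mu>. \<phi> x r y) = measure \<mu> (ball x r))"

end

theory Submission
  imports Defs "HOL-Computational_Algebra.Polynomial"
begin

text \<open>A \<open>(1,\<beta>)\<close>-atom \<open>m\<close> has mean zero, so \<open>m = B\<^sub>Q(m)\<close>. Conversely, \<open>B\<^sub>Q(g)\<close> has mean zero and its
  support is covered by those of \<open>g\<close> and \<open>\<phi>\<^sub>Q\<close>; only its norm needs an argument, as \<open>|\<nabla>\<phi>\<^sub>Q|\<close> is of size \<open>1/r\<^sub>Q\<close>. Unless the radius is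
  comparable to the diameter of the space, \<open>2Q\<close> contains a ball outside \<open>Q\<close> of comparable measure. There
  \<open>g = 0\<close>, so the Poincare inequality on \<open>2Q\<close> gains the missing factor \<open>r\<^sub>Q\<close> in the bound on the average
  of \<open>g\<close>.

  That \<open>\<phi>\<^sub>Q\<close>, which is only Lipschitz, belongs to the closure of the test functions, with a norm controlled by
  its pointwise gradient, rests on Rademacher's theorem: the gradients of mollifications in charts
  converge at every point of differentiability, hence in \<open>L\<^sup>\<beta>\<close> by dominated convergence. The Sobolev
  norm being an infimum over approximating sequences, the closability of the gradient is not needed.\<close>

section \<open>Rademacher's theorem\<close>

text \<open>The obstacle is one factor \<open>1 / r\<close>. With
  \<open>s = measure \<mu> Q powr (1 / \<beta>)\<close>, the norm of \<open>\<phi> x r\<close> is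
  only bounded by \<open>(C + C / r) * s\<close>, while Holder's inequality gives no more than
  \<open>\<bar>average\<bar> * s \<le> norm of g\<close>; for small \<open>r\<close> a bound with an
  extra factor \<open>r\<close> is needed. If no point has distance at least \<open>2 * r\<close>
  from the center, any two points are closer than \<open>4 * r\<close>, so a fixed pair of distinct
  points keeps \<open>r\<close> away from 0 and the Holder bound is enough. The Poincare inequality
  is about Lipschitz functions, so test functions must be shown Lipschitz for the Riemannian
  distance: along a curve they change by at most the length times the supremum of the gradient. In
  the other direction, inverse charts are locally Lipschitz, so a Lipschitz function on the manifold
  stays Lipschitz in coordinates, where Rademacher's theorem applies. Atoms correspond up to a
  factor \<open>K\<close>, which moves into the coefficients of a decomposition: the spaces agree as
  sets and their norms are equivalent.\<close>

lemma lipschitz_real_increasing_density: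
  fixes G :: "real \<Rightarrow> real"
  assumes lip: "L-lipschitz_on UNIV G" and inc: "\<And>x y. x \<le> y \<Longrightarrow> y - x \<le> G y - G x"
  obtains h where "\<And>a b. h integrable_on cbox a b"
    "\<And>a b. a \<le> b \<Longrightarrow> integral {a..b} h = G b - G a"
proof -
  have cont: "continuous_on UNIV G"
    using lip by (rule lipschitz_on_continuous_on)
  have mono: "G x < G y" if "x < y" for x y
    using inc[of x y] that by auto
  have inj: "inj G"
    by (metis injI linorder_neqE_linordered_idom mono order_less_irrefl)
  have mono_iff: "G x \<le> G y \<longleftrightarrow> x \<le> y" for x y
    using mono by (metis linorder_not_le order_less_imp_le order.refl antisym_conv3)
  have surj: "\<exists>x. G x = y" for y
  proof -
    define d where "d = \<bar>y - G 0\<bar>"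
    have "G (-d) \<le> y" "y \<le> G d"
      using inc[of "-d" 0] inc[of 0 d] unfolding d_def by auto
    then show ?thesis
      using IVT'[of G "-d" y d] cont continuous_on_subset unfolding d_def by fastforce
  qed
  define H where "H = inv G"
  have GH: "G (H y) = y" for y
    unfolding H_def using surj by (metis f_inv_into_f rangeI)
  have HG: "H (G x) = x" for x
    unfolding H_def using inj by simp
  have H_lip: "1-lipschitz_on UNIV H"
  proof (rule lipschitz_onI)
    fix x y :: real
    show "dist (H x) (H y) \<le> 1 * dist x y"
    proof (cases "H x \<le> H y")
      case True
      then show ?thesis
        using inc[OF True] by (simp add: GH dist_real_def)
    next
      case False
      then have "H y \<le> H x" by simp
      from inc[OF this] False show ?thesis
        by (simp add: GH dist_real_def)
    qed
  qed simp
  then have [measurable]: "H \<in> borel_measurable borel"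
    using lipschitz_on_continuous_on borel_measurable_continuous_onI by blast
  define N where "N = distr lborel borel H"
  have vimage: "H -` B = G ` B" for B
  proof (intro equalityI subsetI)
    fix y assume "y \<in> H -` B"
    then show "y \<in> G ` B"
      by (metis GH image_eqI vimageD)
  qed (auto simp: HG)
  have emN: "emeasure N B = emeasure lborel (G ` B)" if "B \<in> sets borel" for B
    using that unfolding N_def by (subst emeasure_distr) (auto simp: vimage)
  have "absolutely_continuous lborel N"
    unfolding absolutely_continuous_def
  proof
    fix B :: "real set" assume B: "B \<in> null_sets lborel"
    then have "negligible B"
      by (simp add: negligible_iff_null_sets null_sets_completionI)
    then have "negligible (G ` B)"
    proof (rule negligible_locally_Lipschitz_image[rotated])
      show "\<exists>T B'. open T \<and> x \<in> T \<and> (\<forall>y\<in>B \<inter> T. norm (G y - G x) \<le> B' * norm (y - x))" for x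
        using lipschitz_onD[OF lip] by (intro exI[of _ UNIV] exI[of _ L]) (simp add: dist_norm)
    qed simp
    moreover have "G ` B \<in> sets borel"
      using measurable_sets[of H borel borel B] B unfolding vimage by auto
    ultimately have "emeasure lborel (G ` B) = 0"
      by (simp add: negligible_iff_null_sets null_sets_completion_iff null_setsD1)
    then show "B \<in> null_sets N"
      using B emN[of B] by (intro null_setsI) (auto simp: N_def)
  qed
  moreover have "sets N = sets lborel"
    by (simp add: N_def)
  ultimately obtain f where f[measurable]: "f \<in> borel_measurable borel" and fN: "density lborel f = N"
    using sigma_finite_measure.Radon_Nikodym[OF sigma_finite_lborel] by auto
  define h where "h = (\<lambda>x. enn2real (f x))"
  have [measurable]: "h \<in> borel_measurable borel"
    unfolding h_def by measurable
  have G_im: "G ` {a..b} = {G a..G b}" for a b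
  proof (intro equalityI subsetI)
    fix y assume "y \<in> {G a..G b}"
    then have "H y \<in> {a..b}"
      using mono_iff[of a "H y"] mono_iff[of "H y" b] by (simp add: GH)
    then show "y \<in> G ` {a..b}"
      by (metis GH image_eqI)
  qed (auto simp: mono_iff)
  have I: "(\<integral>\<^sup>+x. f x * indicator {a..b} x \<partial>lborel) = ennreal (G b - G a)" if "a \<le> b" for a b
  proof -
    have "(\<integral>\<^sup>+x. f x * indicator {a..b} x \<partial>lborel) = emeasure N {a..b}"
      by (simp add: fN[symmetric] emeasure_density)
    then show ?thesis
      using that by (simp add: emN G_im mono_iff)
  qed
  \<comment> \<open>\<open>enn2real\<close> sends \<infinity> to 0, so \<open>h\<close> represents
    the density only where \<open>f\<close> is finite.\<close>
  have fin: "AE x in lborel. x \<in> {a..b} \<longrightarrow> f x < \<infinity>" if "a \<le> b" for a b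
  proof -
    have "AE x in lborel. f x * indicator {a..b} x \<noteq> \<infinity>"
      using I[OF that] by (intro nn_integral_PInf_AE) auto
    then show ?thesis
      by eventually_elim (auto simp: indicator_def less_top)
  qed
  have hb: "set_integrable lborel {a..b} h \<and> (LINT x:{a..b}|lborel. h x) = G b - G a" if "a \<le> b" for a b
  proof -
    have "(\<integral>\<^sup>+x. ennreal (indicator {a..b} x * h x) \<partial>lborel) = ennreal (G b - G a)"
      unfolding I[OF that, symmetric]
      by (rule nn_integral_cong_AE, use fin[OF that] in eventually_elim)
        (auto simp: h_def indicator_def)
    moreover have "G a \<le> G b"
      using that mono_iff by blast
    ultimately have "has_bochner_integral lborel (\<lambda>x. indicator {a..b} x * h x) (G b - G a)"
      by (intro has_bochner_integral_nn_integral) (auto simp: h_def)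
    then show ?thesis
      unfolding set_integrable_def set_lebesgue_integral_def
      by (simp add: has_bochner_integral_iff)
  qed
  have hi: "(h has_integral (G b - G a)) {a..b}" if "a \<le> b" for a b
    using has_integral_set_lebesgue[of "{a..b}" h] hb[OF that]
      set_borel_integral_eq_integral(1)[of "{a..b}" h] set_borel_integral_eq_integral(2)[of "{a..b}" h]
    by (simp add: has_integral_integrable_integral)
  show thesis
  proof
    show "h integrable_on cbox a b" for a b
      using hi[of a b] by (cases "a \<le> b") (auto simp: integrable_on_def)
    show "integral {a..b} h = G b - G a" if "a \<le> b" for a b
      using hi[OF that] by (rule integral_unique)
  qed
qed

text \<open>Adding \<open>(L + 1) * x\<close> makes all slopes at least 1, so \<open>G\<close> is
  the integral of a density \<open>h\<close>; by Lebesgue's differentiation theorem its derivative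
  is \<open>h\<close> almost everywhere.\<close>

lemma lipschitz_real_differentiable_AE:
  fixes f :: "real \<Rightarrow> real"
  assumes lip: "L-lipschitz_on UNIV f"
  obtains N where "negligible N" "\<And>x. x \<notin> N \<Longrightarrow> \<exists>d. (f has_real_derivative d) (at x)"
proof -
  define G where "G = (\<lambda>x. f x + (L + 1) * x)"
  have L0: "L \<ge> 0"
    using lip by (rule lipschitz_on_nonneg)
  have fl: "\<bar>f x - f y\<bar> \<le> L * \<bar>x - y\<bar>" for x y
    using lip by (auto simp: lipschitz_on_def dist_real_def)
  have "(L + (L + 1))-lipschitz_on UNIV G"
    unfolding G_def
  proof (intro lipschitz_on_add lip)
    show "(L + 1)-lipschitz_on UNIV (\<lambda>x. (L + 1) * x)"
    proof (rule lipschitz_onI)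
      fix x y :: real
      have "\<bar>(L + 1) * (x - y)\<bar> = (L + 1) * \<bar>x - y\<bar>"
        using L0 by (simp add: abs_mult)
      then show "dist ((L + 1) * x) ((L + 1) * y) \<le> (L + 1) * dist x y"
        by (simp add: dist_real_def right_diff_distrib)
    qed (use L0 in simp)
  qed
  moreover have "y - x \<le> G y - G x" if "x \<le> y" for x y
    using fl[of x y] that unfolding G_def by (simp add: algebra_simps)
  ultimately obtain h where hint: "\<And>a b. h integrable_on cbox a b"
    and hG: "\<And>a b. a \<le> b \<Longrightarrow> integral {a..b} h = G b - G a"
    using lipschitz_real_increasing_density by blast
  obtain N1 where N1: "negligible N1" "\<And>x e. \<lbrakk>x \<notin> N1; 0 < e\<rbrakk> \<Longrightarrow> \<exists>d>0. \<forall>t. 0 < t \<and> t < d \<longrightarrow>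
     norm (integral (cbox x (x + t *\<^sub>R One)) h /\<^sub>R t ^ DIM(real) - h x) < e"
    using integrable_ccontinuous_explicit[of h] hint by blast
  \<comment> \<open>The differentiation theorem is stated for cubes with lower corner
    \<open>x\<close>, which yields right derivatives only; the reflected density supplies the left
    ones.\<close>
  have hint': "(\<lambda>x. h (- x)) integrable_on cbox a b" for a b
    using hint[of "-b" "-a"] integrable_reflect[of h "-a" "-b"] by simp
  obtain N2 where N2: "negligible N2" "\<And>x e. \<lbrakk>x \<notin> N2; 0 < e\<rbrakk> \<Longrightarrow> \<exists>d>0. \<forall>t. 0 < t \<and> t < d \<longrightarrow>
     norm (integral (cbox x (x + t *\<^sub>R One)) (\<lambda>x. h (- x)) /\<^sub>R t ^ DIM(real) - h (- x)) < e"
    using integrable_ccontinuous_explicit[of "\<lambda>x. h (- x)"] hint' by blast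
  show thesis
  proof
    have "negligible (uminus ` N2)"
    proof (rule negligible_locally_Lipschitz_image[OF _ N2(1)])
      show "\<exists>T B. open T \<and> x \<in> T \<and> (\<forall>y\<in>N2 \<inter> T. norm (- y - - x) \<le> B * norm (y - x))" for x :: real
        by (intro exI[of _ UNIV] exI[of _ 1]) (simp add: abs_minus_commute)
    qed simp
    then show "negligible (N1 \<union> uminus ` N2)"
      using N1(1) by simp
    fix x assume x: "x \<notin> N1 \<union> uminus ` N2"
    then have x2: "-x \<notin> N2"
      by (metis UnI2 image_eqI minus_minus)
    have "((\<lambda>t. (G (x + t) - G x) / t) \<longlongrightarrow> h x) (at 0)"
    proof (rule LIM_I)
      fix e :: real assume e: "e > 0"
      obtain d1 where d1: "d1 > 0" "\<And>t. 0 < t \<and> t < d1 \<Longrightarrow>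
         norm (integral (cbox x (x + t *\<^sub>R One)) h /\<^sub>R t ^ DIM(real) - h x) < e"
        using N1(2)[of x e] x e by auto
      obtain d2 where d2: "d2 > 0" "\<And>t. 0 < t \<and> t < d2 \<Longrightarrow>
         norm (integral (cbox (-x) (-x + t *\<^sub>R One)) (\<lambda>x. h (- x)) /\<^sub>R t ^ DIM(real) - h x) < e"
        using N2(2)[of "-x" e] x2 e by auto
      have "norm ((G (x + t) - G x) / t - h x) < e" if "t \<noteq> 0" "norm (t - 0) < min d1 d2" for t
      proof (cases "t > 0")
        case True
        then show ?thesis
          using d1(2)[of t] that hG[of x "x + t"] by (simp add: divide_inverse mult.commute)
      next
        case False
        define s where "s = -t"
        have s: "s > 0" "s < d2"
          using False that by (auto simp: s_def)
        have "integral {-x..-x + s} (\<lambda>x. h (- x)) = integral {x - s..x} h"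
          using Henstock_Kurzweil_Integration.integral_reflect_real[of "x" "x - s" h] by simp
        also have "\<dots> = G x - G (x - s)"
          using s by (intro hG) auto
        finally have "norm ((G x - G (x - s)) / s - h x) < e"
          using d2(2)[of s] s by (simp add: divide_inverse mult.commute)
        moreover have "(G x - G (x - s)) / s = (G (x + t) - G x) / t"
          using that(1) unfolding s_def by (simp add: field_simps)
        ultimately show ?thesis by simp
      qed
      then show "\<exists>s>0. \<forall>t. t \<noteq> 0 \<and> norm (t - 0) < s \<longrightarrow> norm ((G (x + t) - G x) / t - h x) < e"
        using d1(1) d2(1) by (intro exI[of _ "min d1 d2"]) auto
    qed
    then have "(G has_real_derivative h x) (at x)"
      by (simp add: DERIV_def)
    then have "((\<lambda>x. G x - (L + 1) * x) has_real_derivative (h x - (L + 1))) (at x)"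
      by (auto intro!: derivative_eq_intros)
    then show "\<exists>d. (f has_real_derivative d) (at x)"
      unfolding G_def by auto
  qed
qed

text \<open>Averaging over the translations by \<open>t v\<close>, \<open>0 \<le> t \<le> 1\<close>, replaces a rotation of the
  coordinates in Fubini's theorem.\<close>

lemma emeasure_lborel_eq_0_by_lines:
  fixes N :: "'a::euclidean_space set" and v :: 'a
  assumes N[measurable]: "N \<in> sets borel"
    and line: "\<And>x. emeasure lborel {t::real. x + t *\<^sub>R v \<in> N} = 0"
  shows "emeasure lborel N = 0"
proof -
  have 1: "(\<integral>\<^sup>+x. indicator N (x + t *\<^sub>R v) \<partial>lborel) = emeasure lborel N" for t :: real
  proof -
    have "emeasure lborel N = emeasure (distr lborel borel ((+) (t *\<^sub>R v))) N"
      by (simp add: lborel_distr_plus)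
    also have "\<dots> = (\<integral>\<^sup>+x. indicator N x \<partial>(distr lborel borel ((+) (t *\<^sub>R v))))"
      by simp
    also have "\<dots> = (\<integral>\<^sup>+x. indicator N (t *\<^sub>R v + x) \<partial>lborel)"
      by (subst nn_integral_distr) auto
    finally show ?thesis by (simp add: add.commute)
  qed
  have "emeasure lborel N = (\<integral>\<^sup>+t. emeasure lborel N * indicator {0..1::real} t \<partial>lborel)"
    by (subst nn_integral_cmult_indicator) auto
  also have "\<dots> = (\<integral>\<^sup>+t. (\<integral>\<^sup>+x. indicator N (x + t *\<^sub>R v) * indicator {0..1::real} t \<partial>lborel) \<partial>lborel)"
    by (subst nn_integral_multc) (auto simp: 1)
  also have "\<dots> = (\<integral>\<^sup>+x. (\<integral>\<^sup>+t. indicator N (x + t *\<^sub>R v) * indicator {0..1::real} t \<partial>lborel) \<partial>lborel)"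
    by (rule lborel_pair.Fubini') measurable
  also have "\<dots> = (\<integral>\<^sup>+x. 0 \<partial>(lborel :: 'a measure))"
  proof (rule nn_integral_cong)
    fix x :: 'a
    have "(\<integral>\<^sup>+t. indicator N (x + t *\<^sub>R v) * indicator {0..1::real} t \<partial>lborel)
        \<le> (\<integral>\<^sup>+t. indicator {t::real. x + t *\<^sub>R v \<in> N} t \<partial>lborel)"
      by (intro nn_integral_mono) (auto simp: indicator_def)
    also have "\<dots> = emeasure lborel {t::real. x + t *\<^sub>R v \<in> N}"
      by (subst nn_integral_indicator) auto
    finally show "(\<integral>\<^sup>+t. indicator N (x + t *\<^sub>R v) * indicator {0..1::real} t \<partial>lborel) = 0"
      using line[of x] by simp
  qed
  finally show ?thesis by simp
qed

section \<open>Directional derivatives almost everywhere\<close>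

text \<open>The Cauchy criterion over rational increments involves countably many conditions, so the
  set where a difference quotient converges becomes Borel. Continuity away from 0 carries the
  criterion over to real increments.\<close>

lemma rational_Cauchy_imp_limit:
  fixes q :: "real \<Rightarrow> real"
  assumes cont: "\<And>t. t \<noteq> 0 \<Longrightarrow> isCont q t"
    and C: "\<forall>n::nat. \<exists>m::nat. \<forall>r s::rat. r \<noteq> 0 \<and> \<bar>real_of_rat r\<bar> < 1 / Suc m \<and> s \<noteq> 0 \<and> \<bar>real_of_rat s\<bar> < 1 / Suc m
        \<longrightarrow> \<bar>q (real_of_rat r) - q (real_of_rat s)\<bar> \<le> 1 / Suc n"
  shows "\<exists>d. (q \<longlongrightarrow> d) (at 0)"
proof -
  have real_C: "\<exists>m::nat. \<forall>s t. s \<noteq> 0 \<and> \<bar>s\<bar> < 1 / Suc m \<and> t \<noteq> 0 \<and> \<bar>t\<bar> < 1 / Suc m \<longrightarrow> \<bar>q s - q t\<bar> \<le> 1 / Suc n" for n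
  proof -
    obtain m :: nat where m: "\<And>r s::rat. r \<noteq> 0 \<and> \<bar>real_of_rat r\<bar> < 1 / Suc m \<and> s \<noteq> 0 \<and> \<bar>real_of_rat s\<bar> < 1 / Suc m
        \<Longrightarrow> \<bar>q (real_of_rat r) - q (real_of_rat s)\<bar> \<le> 1 / Suc n"
      using C by blast
    have approx: "\<exists>r::rat. r \<noteq> 0 \<and> \<bar>real_of_rat r\<bar> < 1 / Suc m \<and> \<bar>q (real_of_rat r) - q t\<bar> < e"
      if t: "t \<noteq> 0" "\<bar>t\<bar> < 1 / Suc m" and e: "e > 0" for t e
    proof -
      obtain d where d: "d > 0" "\<And>u. \<bar>u - t\<bar> < d \<Longrightarrow> \<bar>q u - q t\<bar> < e"
        using cont[OF t(1)] e unfolding continuous_at_eps_delta dist_real_def by blast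
      \<comment> \<open>The bound by \<open>\<bar>t\<bar>\<close> keeps the rational point away from
        0, the bound by \<open>1 / Suc m - \<bar>t\<bar>\<close> keeps it in the range of the
        criterion.\<close>
      define d' where "d' = min d (min \<bar>t\<bar> (1 / Suc m - \<bar>t\<bar>))"
      have d': "d' > 0" "d' \<le> d" "d' \<le> \<bar>t\<bar>" "d' \<le> 1 / Suc m - \<bar>t\<bar>"
        using d t unfolding d'_def by auto
      obtain r where r: "t < real_of_rat r" "real_of_rat r < t + d'"
        using of_rat_dense[of t "t + d'"] d'(1) by auto
      have "real_of_rat r \<noteq> 0"
        using r d' by auto
      then have "r \<noteq> 0" by auto
      moreover have "\<bar>real_of_rat r\<bar> < 1 / Suc m"
        using r d' by linarith
      ultimately show ?thesis
        using d(2)[of "real_of_rat r"] r d' by auto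
    qed
    have "\<bar>q s - q t\<bar> \<le> 1 / Suc n"
      if s: "s \<noteq> 0" "\<bar>s\<bar> < 1 / Suc m" and t: "t \<noteq> 0" "\<bar>t\<bar> < 1 / Suc m" for s t
    proof (rule field_le_epsilon)
      fix e :: real assume "e > 0"
      then obtain r1 r2 where "r1 \<noteq> 0 \<and> \<bar>real_of_rat r1\<bar> < 1 / Suc m \<and> \<bar>q (real_of_rat r1) - q s\<bar> < e/2"
        "r2 \<noteq> 0 \<and> \<bar>real_of_rat r2\<bar> < 1 / Suc m \<and> \<bar>q (real_of_rat r2) - q t\<bar> < e/2"
        using approx[OF s, of "e/2"] approx[OF t, of "e/2"] by auto
      with m[of r1 r2] show "\<bar>q s - q t\<bar> \<le> 1 / Suc n + e"
        by linarith
    qed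
    then show ?thesis by blast
  qed
  have "Cauchy (\<lambda>k. q (1 / Suc k))"
  proof (rule metric_CauchyI)
    fix e :: real assume "e > 0"
    then obtain n where n: "1 / Suc n < e"
      using nat_approx_posE by blast
    obtain m :: nat where m: "\<And>s t. s \<noteq> 0 \<and> \<bar>s\<bar> < 1 / Suc m \<and> t \<noteq> 0 \<and> \<bar>t\<bar> < 1 / Suc m \<Longrightarrow> \<bar>q s - q t\<bar> \<le> 1 / Suc n"
      using real_C by metis
    have "1 / real (Suc k) < 1 / Suc m" if "k \<ge> Suc m" for k
      using that by (intro divide_strict_left_mono) auto
    then have "dist (q (1 / Suc i)) (q (1 / Suc j)) < e" if "i \<ge> Suc m" "j \<ge> Suc m" for i j
      using m[of "1 / Suc i" "1 / Suc j"] that n by (fastforce simp: dist_real_def)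
    then show "\<exists>M. \<forall>i\<ge>M. \<forall>j\<ge>M. dist (q (1 / Suc i)) (q (1 / Suc j)) < e"
      by blast
  qed
  then obtain d where d: "(\<lambda>k. q (1 / Suc k)) \<longlonglongrightarrow> d"
    using Cauchy_convergent_iff convergent_def by blast
  have "(q \<longlongrightarrow> d) (at 0)"
  proof (rule LIM_I)
    fix e :: real assume "e > 0"
    then obtain n where n: "1 / Suc n < e"
      using nat_approx_posE by blast
    obtain m :: nat where m: "\<And>s t. s \<noteq> 0 \<and> \<bar>s\<bar> < 1 / Suc m \<and> t \<noteq> 0 \<and> \<bar>t\<bar> < 1 / Suc m \<Longrightarrow> \<bar>q s - q t\<bar> \<le> 1 / Suc n"
      using real_C by metis
    have "\<bar>q t - d\<bar> \<le> 1 / Suc n" if t: "t \<noteq> 0" "\<bar>t\<bar> < 1 / Suc m" for t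
    proof (rule LIMSEQ_le_const2)
      show "(\<lambda>k. \<bar>q t - q (1 / Suc k)\<bar>) \<longlonglongrightarrow> \<bar>q t - d\<bar>"
        by (intro tendsto_intros d)
      have "\<bar>q t - q (1 / Suc k)\<bar> \<le> 1 / Suc n" if "k \<ge> Suc m" for k
      proof (rule m)
        have "1 / real (Suc k) < 1 / Suc m"
          using that by (intro divide_strict_left_mono) auto
        then show "t \<noteq> 0 \<and> \<bar>t\<bar> < 1 / Suc m \<and> 1 / real (Suc k) \<noteq> 0 \<and> \<bar>1 / real (Suc k)\<bar> < 1 / Suc m"
          using t by simp
      qed
      then show "\<exists>N. \<forall>k\<ge>N. \<bar>q t - q (1 / Suc k)\<bar> \<le> 1 / Suc n"
        by blast
    qed
    then show "\<exists>s>0. \<forall>t. t \<noteq> 0 \<and> norm (t - 0) < s \<longrightarrow> norm (q t - d) < e"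
      using n by (intro exI[of _ "1 / Suc m"]) force
  qed
  then show ?thesis by blast
qed

lemma limit_imp_rational_Cauchy:
  fixes q :: "real \<Rightarrow> real"
  assumes "(q \<longlongrightarrow> d) (at 0)"
  shows "\<exists>m::nat. \<forall>r s::rat. r \<noteq> 0 \<and> \<bar>real_of_rat r\<bar> < 1 / Suc m \<and> s \<noteq> 0 \<and> \<bar>real_of_rat s\<bar> < 1 / Suc m
        \<longrightarrow> \<bar>q (real_of_rat r) - q (real_of_rat s)\<bar> \<le> 1 / Suc n"
proof -
  define c where "c = 1 / real (Suc n)"
  have "c > 0" by (simp add: c_def)
  then obtain e where e: "e > 0" "\<And>t. t \<noteq> 0 \<Longrightarrow> \<bar>t\<bar> < e \<Longrightarrow> \<bar>q t - d\<bar> < c / 2"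
    using LIM_D[OF assms, of "c / 2"] by auto
  obtain m where m: "1 / Suc m < e"
    using e(1) nat_approx_posE by blast
  have "\<bar>q (real_of_rat r) - q (real_of_rat s)\<bar> \<le> c"
    if "r \<noteq> 0" "\<bar>real_of_rat r\<bar> < 1 / Suc m" "s \<noteq> 0" "\<bar>real_of_rat s\<bar> < 1 / Suc m" for r s
  proof -
    have "\<bar>q (real_of_rat r) - d\<bar> < c / 2" "\<bar>q (real_of_rat s) - d\<bar> < c / 2"
      using that m by (intro e(2); simp)+
    then show ?thesis by linarith
  qed
  then show ?thesis
    unfolding c_def by blast
qed

text \<open>On each line in direction \<open>v\<close> the one-dimensional theorem leaves only a
  null set of bad parameters. The bad set \<open>S\<close> is Borel by the rational criterion
  \<open>W\<close>, hence null by Fubini.\<close>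

lemma lipschitz_directional_derivative_AE:
  fixes f :: "'a::euclidean_space \<Rightarrow> real"
  assumes lip: "L-lipschitz_on UNIV f"
  shows "AE x in lborel. \<exists>d. ((\<lambda>t. (f (x + t *\<^sub>R v) - f x) / t) \<longlongrightarrow> d) (at 0)"
proof -
  have cont: "continuous_on UNIV f"
    using lip by (rule lipschitz_on_continuous_on)
  then have [measurable]: "f \<in> borel_measurable borel"
    by (rule borel_measurable_continuous_onI)
  have isC: "isCont f x" for x
    using cont continuous_on_eq_continuous_at by blast
  define q where "q = (\<lambda>x t. (f (x + t *\<^sub>R v) - f x) / t)"
  define W where "W = (\<lambda>x. \<forall>n::nat. \<exists>m::nat. \<forall>r s::rat. r \<noteq> 0 \<and> \<bar>real_of_rat r\<bar> < 1 / Suc m \<and> s \<noteq> 0 \<and> \<bar>real_of_rat s\<bar> < 1 / Suc m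
        \<longrightarrow> \<bar>q x (real_of_rat r) - q x (real_of_rat s)\<bar> \<le> 1 / Suc n)"
  have [measurable]: "(\<lambda>x. q x t) \<in> borel_measurable borel" for t
    unfolding q_def by measurable
  have [measurable]: "Measurable.pred borel W"
    unfolding W_def by measurable
  define S where "S = {x. \<not> W x}"
  have S[measurable]: "S \<in> sets borel"
    unfolding S_def by measurable
  have "emeasure lborel S = 0"
  proof (rule emeasure_lborel_eq_0_by_lines[OF S, of v])
    fix x
    have "(L * norm v)-lipschitz_on UNIV (\<lambda>t. f (x + t *\<^sub>R v))"
    proof (rule lipschitz_onI)
      fix s t :: real
      have "dist (f (x + s *\<^sub>R v)) (f (x + t *\<^sub>R v)) \<le> L * dist (x + s *\<^sub>R v) (x + t *\<^sub>R v)"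
        by (rule lipschitz_onD[OF lip]) auto
      also have "dist (x + s *\<^sub>R v) (x + t *\<^sub>R v) = dist s t * norm v"
        by (simp add: dist_norm flip: scaleR_diff_left)
      finally show "dist (f (x + s *\<^sub>R v)) (f (x + t *\<^sub>R v)) \<le> L * norm v * dist s t"
        by (simp add: mult_ac)
    qed (use lipschitz_on_nonneg[OF lip] in simp)
    then obtain N where N: "negligible N" "\<And>t. t \<notin> N \<Longrightarrow> \<exists>d. ((\<lambda>t. f (x + t *\<^sub>R v)) has_real_derivative d) (at t)"
      using lipschitz_real_differentiable_AE by blast
    have "{t. x + t *\<^sub>R v \<in> S} \<subseteq> N"
    proof
      fix t assume t: "t \<in> {t. x + t *\<^sub>R v \<in> S}"
      show "t \<in> N"
      proof (rule ccontr)
        assume "t \<notin> N"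
        then obtain d where "((\<lambda>t. f (x + t *\<^sub>R v)) has_real_derivative d) (at t)"
          using N by blast
        then have "(q (x + t *\<^sub>R v) \<longlongrightarrow> d) (at 0)"
          unfolding DERIV_def q_def by (simp add: algebra_simps)
        then have "W (x + t *\<^sub>R v)"
          unfolding W_def using limit_imp_rational_Cauchy by blast
        then show False
          using t by (simp add: S_def)
      qed
    qed
    then have "negligible {t. x + t *\<^sub>R v \<in> S}"
      using N(1) negligible_subset by blast
    moreover have "{t. x + t *\<^sub>R v \<in> S} \<in> sets lborel"
      by measurable
    ultimately show "emeasure lborel {t. x + t *\<^sub>R v \<in> S} = 0"
      by (simp add: negligible_iff_null_sets null_sets_completion_iff null_setsD1)
  qed
  then have "AE x in lborel. x \<notin> S"
    by (intro AE_not_in) (auto simp: null_sets_def)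
  then show ?thesis
  proof eventually_elim
    case (elim x)
    then have "W x"
      by (simp add: S_def)
    have "\<exists>d. (q x \<longlongrightarrow> d) (at 0)"
    proof (intro rational_Cauchy_imp_limit)
      fix t :: real assume "t \<noteq> 0"
      then show "isCont (q x) t"
        unfolding q_def by (intro continuous_intros isCont_o2[OF _ isC]) auto
    qed (rule \<open>W x\<close>[unfolded W_def])
    then show ?case
      unfolding q_def .
  qed
qed

section \<open>Additivity of directional derivatives\<close>

text \<open>The limit along one fixed sequence makes this measurable in \<open>x\<close>; where the
  two-sided limit exists, it is the directional derivative.\<close>

definition dir_deriv :: "('a::real_vector \<Rightarrow> real) \<Rightarrow> 'a \<Rightarrow> 'a \<Rightarrow> real" where
  "dir_deriv f v x = lim (\<lambda>n. (f (x + (1 / real (Suc n)) *\<^sub>R v) - f x) / (1 / real (Suc n)))"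

lemma tendsto_quotient_seq:
  assumes "((\<lambda>t. (f (x + t *\<^sub>R v) - f x) / t) \<longlongrightarrow> d) (at 0)"
  shows "(\<lambda>n. (f (x + (1 / real (Suc n)) *\<^sub>R v) - f x) / (1 / real (Suc n))) \<longlonglongrightarrow> d"
proof -
  have "filterlim (\<lambda>n. 1 / real (Suc n)) (at 0) sequentially"
    unfolding filterlim_at using LIMSEQ_inverse_real_of_nat
    by (auto simp: inverse_eq_divide)
  from filterlim_compose[OF assms this] show ?thesis .
qed

lemma dir_deriv_eqI:
  assumes "((\<lambda>t. (f (x + t *\<^sub>R v) - f x) / t) \<longlongrightarrow> d) (at 0)"
  shows "dir_deriv f v x = d"
  unfolding dir_deriv_def by (rule limI[OF tendsto_quotient_seq[OF assms]])

text \<open>At almost every \<open>x\<close> the value \<open>k x\<close> is the limit of the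
  averages of \<open>k\<close> over shrinking cubes with corner \<open>x\<close>, and these all
  vanish.\<close>

lemma AE_eq_0_of_integral_cbox_0:
  fixes k :: "'a::euclidean_space \<Rightarrow> real"
  assumes "\<And>a b. (k has_integral 0) (cbox a b)"
  shows "AE x in lborel. k x = 0"
proof -
  obtain N where N: "negligible N" "\<And>x e. \<lbrakk>x \<notin> N; 0 < e\<rbrakk> \<Longrightarrow> \<exists>d>0. \<forall>h. 0 < h \<and> h < d \<longrightarrow>
     norm (integral (cbox x (x + h *\<^sub>R One)) k /\<^sub>R h ^ DIM('a) - k x) < e"
    using integrable_ccontinuous_explicit[of k] assms by (metis has_integral_integrable)
  have "k x = 0" if x: "x \<notin> N" for x
  proof (rule ccontr)
    assume "k x \<noteq> 0"
    then obtain d where "d > 0" "\<And>h. 0 < h \<and> h < d \<Longrightarrow>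
       norm (integral (cbox x (x + h *\<^sub>R One)) k /\<^sub>R h ^ DIM('a) - k x) < norm (k x)"
      using N(2)[OF x, of "norm (k x)"] by auto
    from this(2)[of "d/2"] this(1) integral_unique[OF assms] show False
      by simp
  qed
  then have "AE x in lebesgue. k x = 0"
    using N(1) by (intro AE_I'[of N]) (auto simp: negligible_iff_null_sets)
  then show ?thesis
    by (simp add: AE_completion_iff)
qed

lemma lipschitz_quotient_bound:
  fixes f :: "'a::real_normed_vector \<Rightarrow> real"
  assumes lip: "L-lipschitz_on UNIV f"
  shows "\<bar>(f (x + t *\<^sub>R v) - f x) / t\<bar> \<le> L * norm v"
proof -
  have "\<bar>f (x + t *\<^sub>R v) - f x\<bar> \<le> L * (\<bar>t\<bar> * norm v)"
    using lipschitz_onD[OF lip, of "x + t *\<^sub>R v" x] by (simp add: dist_norm)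
  then show ?thesis
    using lipschitz_on_nonneg[OF lip] by (cases "t = 0") (auto simp: field_simps)
qed

lemma measurable_dir_deriv:
  fixes f :: "'a::euclidean_space \<Rightarrow> real"
  assumes lip: "L-lipschitz_on UNIV f"
  shows "dir_deriv f v \<in> borel_measurable borel"
proof -
  have "continuous_on UNIV f"
    using lip by (rule lipschitz_on_continuous_on)
  then have [measurable]: "f \<in> borel_measurable borel"
    by (rule borel_measurable_continuous_onI)
  show ?thesis
    unfolding dir_deriv_def[abs_def] by measurable
qed

text \<open>Off the boundary of the box, a null set, the translated indicator is eventually equal to
  the original one. All the translates lie in one ball, so dominated convergence applies.\<close>

lemma translated_box_indicator_L1_tendsto:
  fixes u :: "'a::euclidean_space"
  shows "(\<lambda>n. \<integral>x. \<bar>indicator (cbox a b) (x - (1 / real (Suc n)) *\<^sub>R u) - indicator (cbox a b) x\<bar> \<partial>lborel) \<longlonglongrightarrow> (0::real)"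
proof -
  obtain R where R: "cbox a b \<subseteq> cball 0 R" "R > 0"
    using bounded_subset_ballD[OF bounded_cbox[of a b], of 0] ball_subset_cball by blast
  have "(\<lambda>n. \<integral>x. \<bar>indicator (cbox a b) (x - (1 / real (Suc n)) *\<^sub>R u) - indicator (cbox a b) x\<bar> \<partial>lborel)
      \<longlonglongrightarrow> (\<integral>x. (0::real) \<partial>(lborel :: 'a measure))"
  proof (rule integral_dominated_convergence[where w = "indicator (cball 0 (R + norm u))"])
    have neg: "negligible (cbox a b - box a b)"
      by (rule negligible_frontier_interval)
    have "AE x in lebesgue. x \<notin> cbox a b - box a b"
      using neg by (intro AE_not_in) (simp add: negligible_iff_null_sets)
    then have "AE x in lborel. x \<notin> cbox a b - box a b"
      by (simp add: AE_completion_iff)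
    then show "AE x in lborel. (\<lambda>n. \<bar>indicator (cbox a b) (x - (1 / real (Suc n)) *\<^sub>R u) - indicator (cbox a b) x\<bar>) \<longlonglongrightarrow> (0::real)"
    proof eventually_elim
      case (elim x)
      have lim: "(\<lambda>n. x - (1 / real (Suc n)) *\<^sub>R u) \<longlonglongrightarrow> x - 0 *\<^sub>R u"
        using LIMSEQ_inverse_real_of_nat unfolding inverse_eq_divide
        by (intro tendsto_intros)
      consider "x \<in> box a b" | "x \<in> - cbox a b"
        using elim by auto
      then have "\<forall>\<^sub>F n in sequentially. indicator (cbox a b) (x - (1 / real (Suc n)) *\<^sub>R u) = (indicator (cbox a b) x :: real)"
      proof cases
        case 1
        have "\<forall>\<^sub>F n in sequentially. x - (1 / real (Suc n)) *\<^sub>R u \<in> box a b"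
          using lim 1 by (intro topological_tendstoD) auto
        then show ?thesis
          by eventually_elim (use 1 box_subset_cbox in \<open>auto simp: indicator_def\<close>)
      next
        case 2
        have "\<forall>\<^sub>F n in sequentially. x - (1 / real (Suc n)) *\<^sub>R u \<in> - cbox a b"
          using lim 2 by (intro topological_tendstoD) auto
        then show ?thesis
          by eventually_elim (use 2 in \<open>auto simp: indicator_def\<close>)
      qed
      then show ?case
        by (intro tendsto_eventually) (auto elim: eventually_mono)
    qed
    show "integrable lborel (indicator (cball 0 (R + norm u)) :: 'a \<Rightarrow> real)"
      by (intro integrable_real_indicator) (use emeasure_bounded_finite[OF bounded_cball] in auto)
    show "AE x in lborel. norm \<bar>(indicator (cbox a b) (x - (1 / real (Suc n)) *\<^sub>R u) :: real) - indicator (cbox a b) x\<bar>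
        \<le> (indicator (cball 0 (R + norm u)) x :: real)" for n
    proof (rule AE_I2)
      fix x
      have "norm x \<le> R + norm u" if "x - (1 / real (Suc n)) *\<^sub>R u \<in> cbox a b"
      proof -
        have "norm ((1 / real (Suc n)) *\<^sub>R u) \<le> norm u"
          by (simp add: field_simps mult_left_le_one_le)
        moreover have "norm (x - (1 / real (Suc n)) *\<^sub>R u) \<le> R"
          using that R by auto
        ultimately show ?thesis
          using norm_triangle_sub[of x "(1 / real (Suc n)) *\<^sub>R u"] by linarith
      qed
      moreover have "norm x \<le> R + norm u" if "x \<in> cbox a b"
        using that R by (smt (verit) mem_cball_0 norm_ge_zero subset_iff)
      ultimately show "norm \<bar>(indicator (cbox a b) (x - (1 / real (Suc n)) *\<^sub>R u) :: real) - indicator (cbox a b) x\<bar>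
        \<le> (indicator (cball 0 (R + norm u)) x :: real)"
        by (auto simp: indicator_def)
    qed
  qed measurable
  then show ?thesis by simp
qed

text \<open>The integral over a box \<open>Q\<close> of the second difference quotient in the directions \<open>u\<close>, \<open>v\<close> is
  the difference of the integrals over \<open>Q + u/n\<close> and \<open>Q\<close> of one bounded function.\<close>

lemma dir_deriv_add_AE:
  fixes f :: "'a::euclidean_space \<Rightarrow> real"
  assumes lip: "L-lipschitz_on UNIV f"
  shows "AE x in lborel. dir_deriv f (u + v) x = dir_deriv f u x + dir_deriv f v x"
proof -
  have cont: "continuous_on UNIV f"
    using lip by (rule lipschitz_on_continuous_on)
  then have [measurable]: "f \<in> borel_measurable borel"
    by (rule borel_measurable_continuous_onI)
  note [measurable] = measurable_dir_deriv[OF lip]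
  note L0 = lipschitz_on_nonneg[OF lip]
  define t where "t = (\<lambda>n. 1 / real (Suc n))"
  define q where "q = (\<lambda>w n x. (f (x + t n *\<^sub>R w) - f x) / t n)"
  have [measurable]: "q w n \<in> borel_measurable borel" for w n
    unfolding q_def by measurable
  have q_le: "\<bar>q w n x\<bar> \<le> L * norm w" for w n x
    unfolding q_def by (rule lipschitz_quotient_bound[OF lip])
  have q_lim: "AE x in lborel. (\<lambda>n. q w n x) \<longlonglongrightarrow> dir_deriv f w x" for w
    using lipschitz_directional_derivative_AE[OF lip, of w]
  proof eventually_elim
    case (elim x)
    then obtain d where d: "((\<lambda>t. (f (x + t *\<^sub>R w) - f x) / t) \<longlongrightarrow> d) (at 0)" by blast
    show ?case
      using tendsto_quotient_seq[OF d] dir_deriv_eqI[OF d] by (simp add: q_def t_def)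
  qed
  define k where "k = (\<lambda>x. dir_deriv f (u + v) x - dir_deriv f u x - dir_deriv f v x)"
  define B where "B = L * norm (u + v) + L * norm u + L * norm v"
  have "(k has_integral 0) (cbox a b)" for a b
  proof -
    let ?Q = "cbox a b"
    let ?I = "indicator (cbox a b) :: 'a \<Rightarrow> real"
    define s where "s = (\<lambda>n x. ?I x * (q (u + v) n x - q u n x - q v n x))"
    have intI: "integrable lborel ?I"
      by (intro integrable_real_indicator) (use emeasure_bounded_finite[OF bounded_cbox, of a b] in \<open>auto simp del: emeasure_lborel_cbox_eq\<close>)
    then have intB: "integrable lborel (\<lambda>x. B * ?I x)"
      by simp
    have bnd: "\<bar>s n x\<bar> \<le> B * ?I x" for n x
      using q_le[of "u + v" n x] q_le[of u n x] q_le[of v n x]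
      by (auto simp: s_def indicator_def B_def)
    have lim: "AE x in lborel. (\<lambda>n. s n x) \<longlonglongrightarrow> ?I x * k x"
      using q_lim[of "u + v"] q_lim[of u] q_lim[of v]
    proof eventually_elim
      case (elim x)
      then show ?case unfolding s_def k_def by (intro tendsto_intros)
    qed
    have meas: "(\<lambda>x. ?I x * k x) \<in> borel_measurable lborel" "\<And>n. s n \<in> borel_measurable lborel"
      unfolding k_def s_def by measurable
    have "AE x in lborel. norm (s n x) \<le> B * ?I x" for n
      using bnd by simp
    note dom = meas intB lim this
    have int: "integrable lborel (\<lambda>x. ?I x * k x)"
      by (rule integrable_dominated_convergence[OF dom])
    have conv: "(\<lambda>n. \<integral>x. s n x \<partial>lborel) \<longlonglongrightarrow> (\<integral>x. ?I x * k x \<partial>lborel)"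
      by (rule integral_dominated_convergence[OF dom])
    have bound: "\<bar>\<integral>x. s n x \<partial>lborel\<bar> \<le> (L * norm v) * (\<integral>x. \<bar>?I (x - t n *\<^sub>R u) - ?I x\<bar> \<partial>lborel)" for n
    proof -
      \<comment> \<open>The difference quotient in direction \<open>u + v\<close> minus that in
        direction \<open>u\<close> is the one in direction \<open>v\<close> based at the shifted
        point \<open>x + t n *\<^sub>R u\<close>.\<close>
      have s_eq: "s n x = ?I x * q v n (x + t n *\<^sub>R u) - ?I x * q v n x" for x
        by (simp add: s_def q_def algebra_simps diff_divide_distrib add_divide_distrib)
      \<comment> \<open>The translated integrand: after the change of variable both integrals
        contain the same \<open>q v n\<close>, so only the difference of the two indicators
        remains.\<close>
      define g where "g = (\<lambda>x. ?I (x - t n *\<^sub>R u) * q v n x)"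
      have intq: "integrable lborel (\<lambda>x. ?I x * q v n x)"
      proof (rule Bochner_Integration.integrable_bound[where f = "\<lambda>x. (L * norm v) * ?I x"])
        show "AE x in lborel. norm (?I x * q v n x) \<le> norm ((L * norm v) * ?I x)"
          using q_le L0 by (auto simp: indicator_def)
      qed (use intI in auto)
      have "integrable lborel (\<lambda>x. ?I x * q v n (x + t n *\<^sub>R u))"
      proof (rule Bochner_Integration.integrable_bound[where f = "\<lambda>x. (L * norm v) * ?I x"])
        show "AE x in lborel. norm (?I x * q v n (x + t n *\<^sub>R u)) \<le> norm ((L * norm v) * ?I x)"
          using q_le L0 by (auto simp: indicator_def)
      qed (use intI in auto)
      then have intg': "integrable lborel (\<lambda>x. g (t n *\<^sub>R u + x))"
        by (simp add: g_def add.commute)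
      then have intg: "integrable (distr lborel borel ((+) (t n *\<^sub>R u))) g"
        by (subst integrable_distr_eq) (auto simp: g_def)
      then have intg: "integrable lborel g"
        by (simp add: lborel_distr_plus)
      have "(\<integral>x. g (t n *\<^sub>R u + x) \<partial>lborel) = (\<integral>x. g x \<partial>(distr lborel borel ((+) (t n *\<^sub>R u))))"
        by (subst integral_distr) (auto simp: g_def)
      then have shift: "(\<integral>x. g (t n *\<^sub>R u + x) \<partial>lborel) = (\<integral>x. g x \<partial>lborel)"
        by (simp add: lborel_distr_plus)
      have "(\<integral>x. s n x \<partial>lborel) = (\<integral>x. g (t n *\<^sub>R u + x) - ?I x * q v n x \<partial>lborel)"
        by (rule Bochner_Integration.integral_cong) (auto simp: s_eq g_def add.commute)
      also have "\<dots> = (\<integral>x. g x \<partial>lborel) - (\<integral>x. ?I x * q v n x \<partial>lborel)"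
        using intg' intq by (simp add: shift)
      also have "\<dots> = (\<integral>x. g x - ?I x * q v n x \<partial>lborel)"
        using intg intq by simp
      also have "\<bar>\<dots>\<bar> \<le> (\<integral>x. \<bar>g x - ?I x * q v n x\<bar> \<partial>lborel)"
        by (rule integral_abs_bound)
      also have "\<dots> \<le> (\<integral>x. (L * norm v) * \<bar>?I (x - t n *\<^sub>R u) - ?I x\<bar> \<partial>lborel)"
      proof (rule integral_mono)
        have "integrable lborel (\<lambda>x. ?I (x - t n *\<^sub>R u))"
        proof -
          have "integrable (distr lborel borel ((+) (t n *\<^sub>R u))) (\<lambda>x. ?I (x - t n *\<^sub>R u))"
            by (subst integrable_distr_eq) (use intI in auto)
          then show ?thesis by (simp add: lborel_distr_plus)
        qed
        then show "integrable lborel (\<lambda>x. (L * norm v) * \<bar>?I (x - t n *\<^sub>R u) - ?I x\<bar>)"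
          using intI by auto
        show "integrable lborel (\<lambda>x. \<bar>g x - ?I x * q v n x\<bar>)"
          using intg intq by auto
        fix x
        have "\<bar>g x - ?I x * q v n x\<bar> = \<bar>q v n x\<bar> * \<bar>?I (x - t n *\<^sub>R u) - ?I x\<bar>"
          by (simp add: g_def abs_mult[symmetric] algebra_simps)
        also have "\<dots> \<le> (L * norm v) * \<bar>?I (x - t n *\<^sub>R u) - ?I x\<bar>"
          by (intro mult_right_mono q_le) auto
        finally show "\<bar>g x - ?I x * q v n x\<bar> \<le> (L * norm v) * \<bar>?I (x - t n *\<^sub>R u) - ?I x\<bar>" .
      qed
      finally show ?thesis by simp
    qed
    have "(\<lambda>n. \<integral>x. s n x \<partial>lborel) \<longlonglongrightarrow> 0"
    proof (rule Lim_null_comparison[OF always_eventually])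
      show "\<forall>n. norm (\<integral>x. s n x \<partial>lborel) \<le> (L * norm v) * (\<integral>x. \<bar>?I (x - t n *\<^sub>R u) - ?I x\<bar> \<partial>lborel)"
        using bound by simp
      show "(\<lambda>n. (L * norm v) * (\<integral>x. \<bar>?I (x - t n *\<^sub>R u) - ?I x\<bar> \<partial>lborel)) \<longlonglongrightarrow> 0"
        using tendsto_mult_right_zero[OF translated_box_indicator_L1_tendsto[of a b u]]
        by (simp add: t_def)
    qed
    then have "(\<integral>x. ?I x * k x \<partial>lborel) = 0"
      using conv LIMSEQ_unique by blast
    then have "(LINT x:?Q|lborel. k x) = 0" "set_integrable lborel ?Q k"
      using int unfolding set_lebesgue_integral_def set_integrable_def by auto
    then show ?thesis
      using set_borel_integral_eq_integral[of ?Q k] by (metis has_integral_iff)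
  qed
  then have "AE x in lborel. k x = 0"
    by (rule AE_eq_0_of_integral_cbox_0)
  then show ?thesis
    by eventually_elim (simp add: k_def)
qed

text \<open>For almost every \<open>x\<close> the directional derivatives in a countable dense set
  \<open>D\<close> of directions exist and add up, so on \<open>D\<close> they are given by a vector
  \<open>g\<close>. The Lipschitz bound and compactness of the unit sphere upgrade this to uniform
  approximation in all directions.\<close>

theorem lipschitz_differentiable_AE:
  fixes f :: "'a::euclidean_space \<Rightarrow> real"
  assumes lip: "L-lipschitz_on UNIV f"
  shows "AE x in lborel. f differentiable (at x)"
proof -
  note L0 = lipschitz_on_nonneg[OF lip]
  define comb :: "('a \<Rightarrow> rat) \<Rightarrow> 'a set \<Rightarrow> 'a" where "comb = (\<lambda>c F. \<Sum>b\<in>F. real_of_rat (c b) *\<^sub>R b)"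
  \<comment> \<open>Sums over arbitrary subsets \<open>F\<close> of the basis are included, so that
    the induction on \<open>F\<close> below uses additivity only for directions in
    \<open>D\<close>.\<close>
  define D where "D = (\<lambda>(c, F). comb c F) ` ((Basis \<rightarrow>\<^sub>E UNIV) \<times> Pow Basis)"
  have D_countable: "countable D"
    unfolding D_def by (intro countable_image countable_SIGMA countable_PiE) (auto simp: countable_finite)
  have comb_restrict: "comb c F = comb (restrict c Basis) F" if "F \<subseteq> Basis" for c F
    unfolding comb_def using that by (intro sum.cong) auto
  have comb_D: "comb c F \<in> D" if "F \<subseteq> Basis" for c F
    unfolding D_def using that by (subst comb_restrict[OF that]) (auto intro!: image_eqI[of _ _ "(restrict c Basis, F)"])
  have D_dense: "\<exists>v\<in>D. norm (v - w) < e" if "e > 0" for w and e :: real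
  proof -
    define e' where "e' = e / (2 * DIM('a))"
    have e': "e' > 0" using that by (simp add: e'_def)
    have "\<exists>c. \<forall>b. \<bar>real_of_rat (c b) - w \<bullet> b\<bar> < e'"
    proof (rule choice, rule allI)
      fix b
      obtain r where "w \<bullet> b < real_of_rat r" "real_of_rat r < w \<bullet> b + e'"
        using of_rat_dense[of "w \<bullet> b" "w \<bullet> b + e'"] e' by auto
      then show "\<exists>r. \<bar>real_of_rat r - w \<bullet> b\<bar> < e'"
        by (intro exI[of _ r]) auto
    qed
    then obtain c where c: "\<And>b. \<bar>real_of_rat (c b) - w \<bullet> b\<bar> < e'" by blast
    have "norm (comb c Basis - w) \<le> (\<Sum>b\<in>Basis. \<bar>(comb c Basis - w) \<bullet> b\<bar>)"
      by (rule norm_le_l1)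
    also have "\<dots> \<le> (\<Sum>b\<in>(Basis :: 'a set). e')"
    proof (rule sum_mono)
      fix b :: 'a assume b: "b \<in> Basis"
      have "comb c Basis \<bullet> b = real_of_rat (c b)"
        unfolding comb_def by (rule inner_sum_left_Basis[OF b])
      then show "\<bar>(comb c Basis - w) \<bullet> b\<bar> \<le> e'"
        using c[of b] by (simp add: inner_diff_left)
    qed
    also have "\<dots> < e"
      using that by (simp add: e'_def)
    finally show ?thesis
      using comb_D[of Basis c] by blast
  qed
  have "AE x in lborel. \<forall>v\<in>D. \<exists>d. ((\<lambda>t. (f (x + t *\<^sub>R v) - f x) / t) \<longlongrightarrow> d) (at 0)"
    using lipschitz_directional_derivative_AE[OF lip] D_countable by (subst AE_ball_countable) auto
  moreover have "AE x in lborel. \<forall>u\<in>D. \<forall>v\<in>D. dir_deriv f (u + v) x = dir_deriv f u x + dir_deriv f v x"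
    using dir_deriv_add_AE[OF lip] D_countable by (simp add: AE_ball_countable)
  ultimately show ?thesis
  proof eventually_elim
    case (elim x)
    define q where "q = (\<lambda>w t. (f (x + t *\<^sub>R w) - f x) / t)"
    have lim: "(q v \<longlongrightarrow> dir_deriv f v x) (at 0)" if "v \<in> D" for v
      using elim(1) that dir_deriv_eqI unfolding q_def by blast
    define g where "g = (\<Sum>b\<in>Basis. dir_deriv f b x *\<^sub>R b)"
    have bD: "c *\<^sub>R b \<in> D" if "b \<in> Basis" "c \<in> \<rat>" for b c
    proof -
      obtain r where "c = real_of_rat r"
        using \<open>c \<in> \<rat>\<close> Rats_cases by blast
      then show ?thesis
        using comb_D[of "{b}" "\<lambda>_. r"] that by (simp add: comb_def)
    qed
    have scale: "dir_deriv f (c *\<^sub>R b) x = c * dir_deriv f b x" if b: "b \<in> Basis" "c \<in> \<rat>" for b c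
    proof (cases "c = 0")
      case True
      have "((\<lambda>t. (f (x + t *\<^sub>R 0) - f x) / t) \<longlongrightarrow> 0) (at 0)"
        by simp
      then show ?thesis
        using True by (simp add: dir_deriv_eqI)
    next
      case False
      have "filterlim (\<lambda>t. t * c) (at 0) (at 0)"
        using False by (auto simp: filterlim_at eventually_at_filter intro!: tendsto_eq_intros)
      then have "((\<lambda>t. q b (t * c) * c) \<longlongrightarrow> dir_deriv f b x * c) (at 0)"
        using filterlim_compose[OF lim[of b]] bD[of b 1] b by (intro tendsto_intros) auto
      then have "((\<lambda>t. (f (x + t *\<^sub>R (c *\<^sub>R b)) - f x) / t) \<longlongrightarrow> dir_deriv f b x * c) (at 0)"
        using False by (simp add: q_def)
      then show ?thesis
        by (simp add: dir_deriv_eqI mult.commute)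
    qed
    have dir_comb: "dir_deriv f (comb c F) x = (\<Sum>b\<in>F. real_of_rat (c b) * dir_deriv f b x)"
      if "F \<subseteq> Basis" for c F
      using finite_subset[OF that finite_Basis] that
    proof (induction F)
      case empty
      have "((\<lambda>t. (f (x + t *\<^sub>R 0) - f x) / t) \<longlongrightarrow> 0) (at 0)"
        by simp
      then show ?case
        by (simp add: comb_def dir_deriv_eqI)
    next
      case (insert b F)
      then have "comb c (insert b F) = real_of_rat (c b) *\<^sub>R b + comb c F"
        by (simp add: comb_def)
      moreover have "real_of_rat (c b) *\<^sub>R b \<in> D" "comb c F \<in> D"
        using insert by (auto intro!: bD comb_D)
      ultimately show ?case
        using elim(2) insert scale[of b "real_of_rat (c b)"] by simp
    qed
    have dir_g: "dir_deriv f v x = g \<bullet> v" if vD: "v \<in> D" for v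
    proof -
      obtain c F where v: "v = comb c F" "F \<subseteq> Basis"
        using vD unfolding D_def by auto
      have "g \<bullet> v = (\<Sum>b\<in>F. real_of_rat (c b) * (g \<bullet> b))"
        unfolding v comb_def by (simp add: inner_sum_right)
      also have "\<dots> = (\<Sum>b\<in>F. real_of_rat (c b) * dir_deriv f b x)"
      proof (rule sum.cong[OF refl])
        fix b assume "b \<in> F"
        then show "real_of_rat (c b) * (g \<bullet> b) = real_of_rat (c b) * dir_deriv f b x"
          using v(2) unfolding g_def by (subst inner_sum_left_Basis) auto
      qed
      finally show ?thesis
        unfolding v(1) dir_comb[OF v(2)] by simp
    qed
    have "(f has_derivative (\<lambda>h. g \<bullet> h)) (at x)"
      unfolding has_derivative_at_alt
    proof (intro conjI allI impI bounded_linear_inner_right)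
      fix e :: real assume e: "e > 0"
      \<comment> \<open>Replacing a unit vector \<open>w\<close> by a point \<open>v\<close> of a
        finite \<delta>-net costs at most \<open>(L + norm g) * \<delta>\<close>, relative to the
        step length. That is half of \<open>e\<close>; the other half is for the difference
        quotients at the net points.\<close>
      define \<delta> where "\<delta> = e / (2 * (L + norm g + 1))"
      have den: "L + norm g + 1 > 0"
        using L0 norm_ge_zero[of g] by linarith
      then have \<delta>: "\<delta> > 0" "(L + norm g) * \<delta> \<le> e / 2"
        using e by (auto simp: \<delta>_def field_simps)
      have "sphere 0 1 \<subseteq> (\<Union>v\<in>D. ball v \<delta>)"
        using D_dense[OF \<delta>(1)] by (auto simp: dist_norm)
      then obtain D' where D': "D' \<subseteq> D" "finite D'" "sphere 0 1 \<subseteq> (\<Union>v\<in>D'. ball v \<delta>)"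
        using compactE_image[of "sphere 0 1" D "\<lambda>v. ball v \<delta>"] compact_sphere by (metis open_ball)
      have "\<forall>v\<in>D'. \<exists>r>0. \<forall>t. t \<noteq> 0 \<and> \<bar>t\<bar> < r \<longrightarrow> \<bar>q v t - g \<bullet> v\<bar> < e / 2"
      proof
        fix v assume "v \<in> D'"
        then have "(q v \<longlongrightarrow> g \<bullet> v) (at 0)"
          using D'(1) lim dir_g by fastforce
        from LIM_D[OF this, of "e/2"] e show "\<exists>r>0. \<forall>t. t \<noteq> 0 \<and> \<bar>t\<bar> < r \<longrightarrow> \<bar>q v t - g \<bullet> v\<bar> < e / 2"
          by auto
      qed
      then obtain r where r: "\<And>v. v \<in> D' \<Longrightarrow> r v > 0"
        "\<And>v t. v \<in> D' \<Longrightarrow> t \<noteq> 0 \<Longrightarrow> \<bar>t\<bar> < r v \<Longrightarrow> \<bar>q v t - g \<bullet> v\<bar> < e / 2"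
        by metis
      define d where "d = Min (insert 1 (r ` D'))"
      have d: "d > 0" "\<And>v. v \<in> D' \<Longrightarrow> d \<le> r v"
        using D'(2) r(1) by (auto simp: d_def)
      show "\<exists>d>0. \<forall>y. norm (y - x) < d \<longrightarrow> norm (f y - f x - g \<bullet> (y - x)) \<le> e * norm (y - x)"
      proof (intro exI conjI allI impI)
        fix y assume y: "norm (y - x) < d"
        show "norm (f y - f x - g \<bullet> (y - x)) \<le> e * norm (y - x)"
        proof (cases "y = x")
          case False
          define t where "t = norm (y - x)"
          define w where "w = (1 / t) *\<^sub>R (y - x)"
          have t: "t > 0" "t < d"
            using False y by (auto simp: t_def)
          have "norm w = 1"
            using t by (simp add: w_def t_def)
          have y_eq: "y = x + t *\<^sub>R w"
            using t by (simp add: w_def)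
          obtain v where v: "v \<in> D'" "norm (v - w) < \<delta>"
            using D'(3) \<open>norm w = 1\<close> by (force simp: dist_norm)
          have "\<bar>q v t - g \<bullet> v\<bar> < e / 2"
            using r(2)[OF v(1), of t] d(2)[OF v(1)] t by auto
          then have 1: "\<bar>f (x + t *\<^sub>R v) - f x - t * (g \<bullet> v)\<bar> \<le> e / 2 * t"
            using t by (simp add: q_def field_simps abs_if split: if_splits)
          have "\<bar>f (x + t *\<^sub>R w) - f (x + t *\<^sub>R v)\<bar> \<le> L * norm (t *\<^sub>R w - t *\<^sub>R v)"
            using lipschitz_onD[OF lip, of "x + t *\<^sub>R w" "x + t *\<^sub>R v"] by (simp add: dist_norm)
          also have "norm (t *\<^sub>R w - t *\<^sub>R v) = t * norm (v - w)"
            using t by (simp add: norm_minus_commute flip: scaleR_diff_right)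
          finally have 2: "\<bar>f (x + t *\<^sub>R w) - f (x + t *\<^sub>R v)\<bar> \<le> t * (L * norm (v - w))"
            by (simp add: mult_ac)
          have 3: "\<bar>t * (g \<bullet> v) - t * (g \<bullet> w)\<bar> \<le> t * (norm g * norm (v - w))"
            using Cauchy_Schwarz_ineq2[of g "v - w"] t
            by (simp add: abs_mult inner_diff_right flip: right_diff_distrib)
          have "L * norm (v - w) + norm g * norm (v - w) \<le> (L + norm g) * \<delta>"
            using v(2) L0 by (simp add: mult_left_mono flip: distrib_right)
          then have "t * (L * norm (v - w)) + t * (norm g * norm (v - w)) \<le> t * (e / 2)"
            using \<delta>(2) t by (simp flip: distrib_left)
          moreover have "e / 2 * t + t * (e / 2) = e * t"
            by simp
          ultimately have "\<bar>f (x + t *\<^sub>R w) - f x - t * (g \<bullet> w)\<bar> \<le> e * t"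
            using 1 2 3 unfolding abs_le_iff by linarith
          then show ?thesis
            using \<open>norm w = 1\<close> t unfolding y_eq by simp
        qed simp
      qed (rule d(1))
    qed
    then show ?case
      by (auto simp: differentiable_def)
  qed
qed

section \<open>Calculus of smooth maps\<close>

lemma ck_on_SucD: "ck_on (Suc k) S f \<Longrightarrow> ck_on k S f"
proof (induction k arbitrary: f)
  case 0
  then show ?case
    by (auto intro!: continuous_at_imp_continuous_on differentiable_imp_continuous_within)
qed auto

lemma frechet_derivative_cong_open:
  assumes "open S" "x \<in> S" "\<And>y. y \<in> S \<Longrightarrow> f y = g y"
  shows "frechet_derivative f (at x) = frechet_derivative g (at x)"
proof -
  have "(f has_derivative F) (at x) \<longleftrightarrow> (g has_derivative F) (at x)" for F
    using has_derivative_transform_within_open[of f F x UNIV S g]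
      has_derivative_transform_within_open[of g F x UNIV S f] assms by auto
  then show ?thesis
    unfolding frechet_derivative_def by simp
qed

lemma differentiable_cong_open:
  assumes "open S" "x \<in> S" "\<And>y. y \<in> S \<Longrightarrow> f y = g y"
  shows "f differentiable (at x) \<longleftrightarrow> g differentiable (at x)"
  using has_derivative_transform_within_open[of f _ x UNIV S g]
    has_derivative_transform_within_open[of g _ x UNIV S f] assms
  unfolding differentiable_def by metis

lemma ck_on_cong:
  assumes "open S" "\<And>x. x \<in> S \<Longrightarrow> f x = g x"
  shows "ck_on k S f \<longleftrightarrow> ck_on k S g"
  using assms(2)
proof (induction k arbitrary: f g)
  case 0
  then show ?case by (simp cong: continuous_on_cong)
next
  case (Suc k)
  have "f differentiable (at x) \<longleftrightarrow> g differentiable (at x)" if "x \<in> S" for x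
    by (rule differentiable_cong_open[OF assms(1) that Suc.prems])
  moreover have "ck_on k S (\<lambda>x. frechet_derivative f (at x) v) \<longleftrightarrow> ck_on k S (\<lambda>x. frechet_derivative g (at x) v)" for v
    by (rule Suc.IH) (use frechet_derivative_cong_open[OF assms(1) _ Suc.prems] in auto)
  ultimately show ?case by simp
qed

text \<open>Serves functions that are smooth for different reasons in different places, such as a
  function of one chart extended by 0.\<close>

lemma ck_on_local:
  assumes "\<And>x. x \<in> S \<Longrightarrow> \<exists>U. open U \<and> x \<in> U \<and> ck_on k U f"
  shows "ck_on k S f"
  using assms
proof (induction k arbitrary: f)
  case 0
  have "isCont f x" if x: "x \<in> S" for x
  proof -
    obtain U where "open U" "x \<in> U" "continuous_on U f"
      using 0[OF x] by auto
    then show ?thesis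
      by (simp add: continuous_on_eq_continuous_at)
  qed
  then show ?case
    by (simp add: continuous_at_imp_continuous_on)
next
  case (Suc k)
  have "f differentiable (at x)" if x: "x \<in> S" for x
    using Suc.prems[OF x] by auto
  moreover have "ck_on k S (\<lambda>x. frechet_derivative f (at x) v)" for v
  proof (rule Suc.IH)
    fix x assume "x \<in> S"
    then obtain U where "open U" "x \<in> U" "ck_on (Suc k) U f"
      using Suc.prems by blast
    then show "\<exists>U. open U \<and> x \<in> U \<and> ck_on k U (\<lambda>x. frechet_derivative f (at x) v)"
      by (intro exI[of _ U]) simp
  qed
  ultimately show ?case by simp
qed

lemma ck_on_const: "ck_on k S (\<lambda>x. c)"
  by (induction k arbitrary: c) auto

lemma ck_on_bounded_linear:
  assumes "bounded_linear h"
  shows "ck_on k S h"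
proof (cases k)
  case 0
  then show ?thesis
    using bounded_linear.continuous_on[OF assms continuous_on_id] by simp
next
  case (Suc j)
  have "(h has_derivative h) (at x)" for x
    using assms by (rule bounded_linear_imp_has_derivative)
  then have "h differentiable (at x)" "frechet_derivative h (at x) = h" for x
    by (rule differentiableI, rule frechet_derivative_at[symmetric])
  then show ?thesis
    using Suc by (simp add: ck_on_const)
qed

lemma frechet_has_derivative:
  "f differentiable (at x) \<Longrightarrow> (f has_derivative frechet_derivative f (at x)) (at x)"
  by (simp add: frechet_derivative_works)

lemma ck_on_bounded_linear_compose:
  assumes "open S" "bounded_linear h" "ck_on k S f"
  shows "ck_on k S (\<lambda>x. h (f x))"
  using assms(3)
proof (induction k arbitrary: f)
  case 0
  then show ?case
    using assms(2) by (simp add: bounded_linear.continuous_on)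
next
  case (Suc k)
  have d: "((\<lambda>x. h (f x)) has_derivative (\<lambda>v. h (frechet_derivative f (at x) v))) (at x)" if "x \<in> S" for x
    using Suc.prems that
    by (intro bounded_linear.has_derivative[OF assms(2)] frechet_has_derivative) auto
  have "ck_on k S (\<lambda>x. frechet_derivative (\<lambda>x. h (f x)) (at x) v)" for v
  proof -
    have "ck_on k S (\<lambda>x. h (frechet_derivative f (at x) v))"
      using Suc by auto
    then show ?thesis
      by (rule iffD1[OF ck_on_cong[OF assms(1)], rotated]) (simp add: frechet_derivative_at[OF d, symmetric])
  qed
  then show ?case
    using d by (auto simp: differentiable_def)
qed

lemma ck_on_add:
  assumes "open S" "ck_on k S f" "ck_on k S g"
  shows "ck_on k S (\<lambda>x. f x + g x)"
  using assms(2,3)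
proof (induction k arbitrary: f g)
  case 0
  then show ?case by (simp add: continuous_on_add)
next
  case (Suc k)
  have d: "((\<lambda>x. f x + g x) has_derivative (\<lambda>v. frechet_derivative f (at x) v + frechet_derivative g (at x) v)) (at x)" if "x \<in> S" for x
    using Suc.prems that
    by (intro has_derivative_add frechet_has_derivative) auto
  have "ck_on k S (\<lambda>x. frechet_derivative (\<lambda>x. f x + g x) (at x) v)" for v
  proof -
    have "ck_on k S (\<lambda>x. frechet_derivative f (at x) v + frechet_derivative g (at x) v)"
      using Suc by auto
    then show ?thesis
      by (rule iffD1[OF ck_on_cong[OF assms(1)], rotated]) (simp add: frechet_derivative_at[OF d, symmetric])
  qed
  then show ?case
    using d by (auto simp: differentiable_def)
qed

lemma ck_on_sum:
  assumes "open S" "\<And>i. i \<in> I \<Longrightarrow> ck_on k S (f i)"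
  shows "ck_on k S (\<lambda>x. \<Sum>i\<in>I. f i x)"
  using assms(2)
  by (induction I rule: infinite_finite_induct) (auto intro: ck_on_add[OF assms(1)] ck_on_const)

lemma ck_on_scaleR:
  fixes f :: "'v::real_normed_vector \<Rightarrow> real"
  assumes "open S" "ck_on k S f" "ck_on k S g"
  shows "ck_on k S (\<lambda>x. f x *\<^sub>R g x)"
  using assms(2,3)
proof (induction k arbitrary: f g)
  case 0
  then show ?case by (simp add: continuous_on_scaleR)
next
  case (Suc k)
  have d: "((\<lambda>x. f x *\<^sub>R g x) has_derivative
      (\<lambda>v. f x *\<^sub>R frechet_derivative g (at x) v + frechet_derivative f (at x) v *\<^sub>R g x)) (at x)" if "x \<in> S" for x
    using Suc.prems that
    by (intro has_derivative_scaleR frechet_has_derivative) auto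
  have "ck_on k S (\<lambda>x. frechet_derivative (\<lambda>x. f x *\<^sub>R g x) (at x) v)" for v
  proof -
    have "ck_on k S (\<lambda>x. f x *\<^sub>R frechet_derivative g (at x) v + frechet_derivative f (at x) v *\<^sub>R g x)"
      using Suc by (intro ck_on_add[OF assms(1)] Suc.IH) (auto intro: ck_on_SucD)
    then show ?thesis
      by (rule iffD1[OF ck_on_cong[OF assms(1)], rotated]) (simp add: frechet_derivative_at[OF d, symmetric])
  qed
  then show ?case
    using d by (auto simp: differentiable_def)
qed

text \<open>\<open>ck_on\<close> controls derivatives in fixed directions, but in the chain rule the
  direction \<open>frechet_derivative g (at x) v\<close> varies with \<open>x\<close>. Expanding it
  in the basis leaves products of functions to which the induction hypothesis applies.\<close>

lemma ck_on_compose: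
  fixes f :: "'u::euclidean_space \<Rightarrow> 'w::real_normed_vector" and g :: "'v::real_normed_vector \<Rightarrow> 'u"
  assumes "open S" "g ` S \<subseteq> T" "ck_on k T f" "ck_on k S g"
  shows "ck_on k S (\<lambda>x. f (g x))"
  using assms(3,4)
proof (induction k arbitrary: f)
  case 0
  then show ?case
    using continuous_on_compose2[of T f S g] assms(2) by simp
next
  case (Suc k)
  have d: "((\<lambda>x. f (g x)) has_derivative (\<lambda>v. frechet_derivative f (at (g x)) (frechet_derivative g (at x) v))) (at x)" if "x \<in> S" for x
  proof (rule has_derivative_compose[OF frechet_has_derivative frechet_has_derivative])
    show "g differentiable (at x)"
      using Suc.prems that by simp
    show "f differentiable (at (g x))"
      using Suc.prems assms(2) that by (simp add: image_subset_iff)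
  qed
  have e: "frechet_derivative f (at (g x)) w = (\<Sum>b\<in>Basis. (w \<bullet> b) *\<^sub>R frechet_derivative f (at (g x)) b)" if "x \<in> S" for x w
  proof -
    have lin: "linear (frechet_derivative f (at (g x)))"
      using Suc.prems that assms(2) by (intro linear_frechet_derivative) auto
    have "frechet_derivative f (at (g x)) w = frechet_derivative f (at (g x)) (\<Sum>b\<in>Basis. (w \<bullet> b) *\<^sub>R b)"
      by (simp add: euclidean_representation)
    also have "\<dots> = (\<Sum>b\<in>Basis. (w \<bullet> b) *\<^sub>R frechet_derivative f (at (g x)) b)"
      unfolding linear_sum[OF lin] linear_scale[OF lin] ..
    finally show ?thesis .
  qed
  have "ck_on k S (\<lambda>x. frechet_derivative (\<lambda>x. f (g x)) (at x) v)" for v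
  proof -
    have "ck_on k S (\<lambda>x. \<Sum>b\<in>Basis. (frechet_derivative g (at x) v \<bullet> b) *\<^sub>R frechet_derivative f (at (g x)) b)"
    proof (intro ck_on_sum ck_on_scaleR assms(1))
      fix b
      show "ck_on k S (\<lambda>x. frechet_derivative g (at x) v \<bullet> b)"
        using Suc.prems by (intro ck_on_bounded_linear_compose[OF assms(1) bounded_linear_inner_left]) auto
      show "ck_on k S (\<lambda>x. frechet_derivative f (at (g x)) b)"
        using Suc.prems by (intro Suc.IH[of "\<lambda>y. frechet_derivative f (at y) b"]) (auto intro: ck_on_SucD)
    qed
    then show ?thesis
      by (rule iffD1[OF ck_on_cong[OF assms(1)], rotated])
        (simp add: frechet_derivative_at[OF d, symmetric] e[symmetric])
  qed
  then show ?case
    using d by (auto simp: differentiable_def)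
qed

lemma smooth_map_on_differentiable:
  "smooth_map_on S f \<Longrightarrow> x \<in> S \<Longrightarrow> f differentiable (at x)"
  unfolding smooth_map_on_def using ck_on.simps(2) by blast

lemma smooth_map_on_deriv:
  "smooth_map_on S f \<Longrightarrow> smooth_map_on S (\<lambda>x. frechet_derivative f (at x) v)"
  unfolding smooth_map_on_def using ck_on.simps(2) by blast

lemma smooth_map_on_continuous: "smooth_map_on S f \<Longrightarrow> continuous_on S f"
  unfolding smooth_map_on_def using ck_on.simps(1) by blast

section \<open>Smooth bump functions\<close>

text \<open>The functions \<open>p(1/t) * exp(-1/t)\<close>, extended by 0, form a family closed
  under differentiation: the derivative belongs to the polynomial \<open>X^2 * (p - p')\<close>.
  Smoothness of the whole family thus follows by induction on the order.\<close>

definition exp_flat :: "real poly \<Rightarrow> real \<Rightarrow> real" where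
  "exp_flat p t = (if t > 0 then poly p (1 / t) * exp (- 1 / t) else 0)"

lemma poly_times_exp_neg_tendsto_0:
  fixes p :: "real poly"
  shows "((\<lambda>x. poly p x * exp (- x)) \<longlongrightarrow> 0) at_top"
proof -
  have "((\<lambda>x. \<Sum>i\<le>degree p. coeff p i * (x ^ i / exp x)) \<longlongrightarrow> (\<Sum>i\<le>degree p. coeff p i * 0)) at_top"
    by (intro tendsto_intros tendsto_power_div_exp_0)
  moreover have "(\<Sum>i\<le>degree p. coeff p i * (x ^ i / exp x)) = poly p x * exp (- x)" for x
    by (simp add: poly_altdef sum_distrib_right exp_minus divide_inverse mult.assoc)
  ultimately show ?thesis by simp
qed

lemma exp_flat_derivative:
  "(exp_flat p has_real_derivative exp_flat ([:0, 0, 1:] * (p - pderiv p)) t) (at t)"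
proof -
  let ?q = "[:0, 0, 1:] * (p - pderiv p)"
  consider "t < 0" | "t > 0" | "t = 0" by linarith
  then show ?thesis
  proof cases
    case 1
    have "((\<lambda>_. 0) has_real_derivative 0) (at t)" by simp
    then have "(exp_flat p has_real_derivative 0) (at t)"
      by (rule has_field_derivative_transform_within_open[where S = "{..<0}"]) (use 1 in \<open>auto simp: exp_flat_def\<close>)
    then show ?thesis using 1 by (simp add: exp_flat_def)
  next
    case 2
    have "((\<lambda>t. poly p (1 / t) * exp (- 1 / t)) has_real_derivative exp_flat ?q t) (at t)"
      using 2 by (auto intro!: derivative_eq_intros simp: exp_flat_def field_simps power2_eq_square)
    then show ?thesis
      by (rule has_field_derivative_transform_within_open[where S = "{0<..}"]) (use 2 in \<open>auto simp: exp_flat_def\<close>)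
  next
    case 3
    have "((\<lambda>h. exp_flat p h / h) \<longlongrightarrow> 0) (at_right 0)"
    proof -
      \<comment> \<open>With \<open>x = inverse h\<close> the difference quotient at 0 becomes
        \<open>x * p(x) * exp(-x)\<close>, and \<open>pCons 0 p\<close> is
        \<open>X * p\<close>.\<close>
      have "((\<lambda>h. poly (pCons 0 p) (inverse h) * exp (- inverse h)) \<longlongrightarrow> 0) (at_right (0::real))"
        using filterlim_compose[OF poly_times_exp_neg_tendsto_0 filterlim_inverse_at_top_right] .
      then show ?thesis
        by (rule Lim_transform_eventually)
          (auto simp: exp_flat_def eventually_at_filter field_simps)
    qed
    moreover have "((\<lambda>h. exp_flat p h / h) \<longlongrightarrow> 0) (at_left 0)"
      by (rule tendsto_eventually) (auto simp: exp_flat_def eventually_at_filter)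
    ultimately have "((\<lambda>h. exp_flat p h / h) \<longlongrightarrow> 0) (at 0)"
      by (simp add: filterlim_split_at)
    then show ?thesis
      using 3 by (simp add: DERIV_def exp_flat_def)
  qed
qed

lemma ck_on_exp_flat: "ck_on k UNIV (exp_flat p)"
proof (induction k arbitrary: p)
  case 0
  show ?case
    using DERIV_isCont[OF exp_flat_derivative] by (simp add: continuous_at_imp_continuous_on)
next
  case (Suc k)
  let ?q = "[:0, 0, 1:] * (p - pderiv p)"
  have d: "(exp_flat p has_derivative (\<lambda>v. exp_flat ?q t * v)) (at t)" for t
    using exp_flat_derivative unfolding has_field_derivative_def .
  have "frechet_derivative (exp_flat p) (at t) v = exp_flat (smult v ?q) t" for t v
    by (simp only: frechet_derivative_at[OF d, symmetric]) (simp add: exp_flat_def)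
  then show ?case
    using d Suc.IH by (auto simp: differentiable_def)
qed

lemma smooth_bump:
  obtains \<eta> :: "'a::euclidean_space \<Rightarrow> real" where "smooth_map_on UNIV \<eta>"
    "\<And>x. \<eta> x \<ge> 0" "\<And>x. norm x \<ge> 1 \<Longrightarrow> \<eta> x = 0" "integrable lborel \<eta>" "(\<integral>x. \<eta> x \<partial>lborel) = 1"
proof -
  \<comment> \<open>The squared norm is polynomial in the coordinates, whereas the norm is not
    differentiable at 0.\<close>
  define \<eta> :: "'a \<Rightarrow> real" where "\<eta> = (\<lambda>x. exp_flat 1 (1 - x \<bullet> x))"
  have ck: "ck_on k UNIV \<eta>" for k
    unfolding \<eta>_def
  proof (rule ck_on_compose[OF _ _ ck_on_exp_flat])
    have "ck_on k UNIV (\<lambda>x::'a. 1 + (-1) *\<^sub>R (\<Sum>b\<in>Basis. (x \<bullet> b) *\<^sub>R (x \<bullet> b)))"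
      by (intro ck_on_add ck_on_scaleR ck_on_sum ck_on_const ck_on_bounded_linear bounded_linear_inner_left) auto
    then show "ck_on k UNIV (\<lambda>x::'a. 1 - x \<bullet> x)"
      by (simp add: euclidean_inner[symmetric])
  qed auto
  have cont: "continuous_on UNIV \<eta>"
    using ck[of 0] by simp
  then have [measurable]: "\<eta> \<in> borel_measurable borel"
    by (rule borel_measurable_continuous_onI)
  have nonneg: "\<eta> x \<ge> 0" for x
    by (simp add: \<eta>_def exp_flat_def)
  have zero: "\<eta> x = 0" if "norm x \<ge> 1" for x
  proof -
    have "1 \<le> x \<bullet> x"
      using that by (simp add: dot_square_norm)
    then show ?thesis by (simp add: \<eta>_def exp_flat_def)
  qed
  have le1: "\<eta> x \<le> 1" for x
    by (simp add: \<eta>_def exp_flat_def)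
  have int: "integrable lborel \<eta>"
  proof (rule Bochner_Integration.integrable_bound)
    show "integrable lborel (indicator (cball 0 1) :: 'a \<Rightarrow> real)"
      by (intro integrable_real_indicator) (use emeasure_bounded_finite[OF bounded_cball] in auto)
    show "AE x in lborel. norm (\<eta> x) \<le> norm (indicator (cball 0 1) x :: real)"
      using zero le1 nonneg by (auto simp: indicator_def)
  qed auto
  have pos: "(\<integral>x. \<eta> x \<partial>lborel) > 0"
  proof (rule ccontr)
    assume "\<not> ?thesis"
    then have "(\<integral>x. \<eta> x \<partial>lborel) = 0"
      using Bochner_Integration.integral_nonneg[of lborel \<eta>] nonneg by fastforce
    then have "AE x in lborel. \<eta> x = 0"
      using integral_nonneg_eq_0_iff_AE[OF int] nonneg by auto
    moreover have "\<eta> x \<noteq> 0" if "x \<in> ball 0 1" for x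
    proof -
      have "x \<bullet> x < 1"
        using that by (simp add: dot_square_norm power_less_one_iff abs_square_less_1)
      then show ?thesis by (simp add: \<eta>_def exp_flat_def)
    qed
    ultimately have "AE x in lborel. x \<notin> ball (0::'a) 1"
      by (auto elim: eventually_mono)
    then have "ball (0::'a) 1 \<in> null_sets lborel"
      by (subst AE_iff_null_sets) auto
    then have "negligible (ball (0::'a) 1)"
      by (simp add: negligible_iff_null_sets null_sets_completionI)
    then show False
      using open_not_negligible[of "ball (0::'a) 1"] by simp
  qed
  define I where "I = (\<integral>x. \<eta> x \<partial>lborel)"
  show thesis
  proof
    show "smooth_map_on UNIV (\<lambda>x. (1 / I) *\<^sub>R \<eta> x)"
      unfolding smooth_map_on_def by (intro allI ck_on_scaleR ck_on_const ck) auto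
    show "(\<integral>x. (1 / I) *\<^sub>R \<eta> x \<partial>lborel) = 1"
      using pos by (simp add: I_def)
  qed (use pos nonneg zero int in \<open>auto simp: I_def\<close>)
qed

section \<open>Mollification\<close>

lemma integral_lborel_affine:
  fixes h :: "'a::euclidean_space \<Rightarrow> real"
  assumes "c \<noteq> 0" and [measurable]: "h \<in> borel_measurable borel"
  shows "(\<integral>x. h x \<partial>lborel) = \<bar>c\<bar> ^ DIM('a) * (\<integral>x. h (t + c *\<^sub>R x) \<partial>lborel)"
    and "integrable lborel h \<longleftrightarrow> integrable lborel (\<lambda>x. h (t + c *\<^sub>R x))"
proof -
  have L: "lborel = density (distr lborel borel (\<lambda>x::'a. t + c *\<^sub>R x)) (\<lambda>_. ennreal (\<bar>c\<bar> ^ DIM('a)))"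
    using lborel_affine[OF assms(1), of t] by simp
  have "(\<integral>x. h x \<partial>lborel) = (\<integral>x. h x \<partial>density (distr lborel borel (\<lambda>x::'a. t + c *\<^sub>R x)) (\<lambda>_. ennreal (\<bar>c\<bar> ^ DIM('a))))"
    using L by (rule arg_cong)
  also have "\<dots> = \<bar>c\<bar> ^ DIM('a) * (\<integral>x. h (t + c *\<^sub>R x) \<partial>lborel)"
    by (subst integral_density) (auto simp: integral_distr)
  finally show "(\<integral>x. h x \<partial>lborel) = \<bar>c\<bar> ^ DIM('a) * (\<integral>x. h (t + c *\<^sub>R x) \<partial>lborel)" .
  have "integrable lborel h \<longleftrightarrow> integrable (density (distr lborel borel (\<lambda>x::'a. t + c *\<^sub>R x)) (\<lambda>_. ennreal (\<bar>c\<bar> ^ DIM('a)))) h"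
    by (rule arg_cong[where f = "\<lambda>M. integrable M h", OF L])
  also have "\<dots> \<longleftrightarrow> integrable lborel (\<lambda>x. h (t + c *\<^sub>R x))"
    using assms(1) by (subst integrable_density) (auto simp: integrable_distr_eq)
  finally show "integrable lborel h \<longleftrightarrow> integrable lborel (\<lambda>x. h (t + c *\<^sub>R x))" .
qed

lemma continuous_zero_outside_cbox:
  fixes h :: "'a::euclidean_space \<Rightarrow> real"
  assumes "continuous_on UNIV h" "\<And>x. x \<notin> cbox a b \<Longrightarrow> h x = 0"
  shows "integrable lborel h" "(\<integral>x. h x \<partial>lborel) = integral (cbox a b) h"
proof -
  have c: "continuous_on (cbox a b) h"
    using assms(1) continuous_on_subset by blast
  have eq: "(\<lambda>x. indicator (cbox a b) x *\<^sub>R h x) = h"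
    using assms(2) by (auto simp: indicator_def fun_eq_iff)
  have i: "set_integrable lborel (cbox a b) h"
    using borel_integrable_compact[OF compact_cbox c] unfolding set_integrable_def .
  then show "integrable lborel h"
    unfolding set_integrable_def eq .
  show "(\<integral>x. h x \<partial>lborel) = integral (cbox a b) h"
    using set_borel_integral_eq_integral(2)[OF i] unfolding set_lebesgue_integral_def eq .
qed

lemma continuous_bounded_support_integrable:
  fixes h :: "'a::euclidean_space \<Rightarrow> real"
  assumes "continuous_on UNIV h" "\<And>x. x \<notin> cball c R \<Longrightarrow> h x = 0"
  shows "integrable lborel h"
proof -
  obtain a b where "cball c R \<subseteq> cbox a b"
    using bounded_subset_cbox_symmetric[OF bounded_cball] by metis
  then show ?thesis
    using continuous_zero_outside_cbox(1)[of h a b] assms by blast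
qed

text \<open>The convolution of \<open>F\<close> and \<open>\<psi>\<close>, written with
  \<open>x\<close> in the smooth factor so that derivatives fall on \<open>\<psi>\<close>.\<close>

definition mconv :: "('a::euclidean_space \<Rightarrow> real) \<Rightarrow> ('a \<Rightarrow> real) \<Rightarrow> 'a \<Rightarrow> real" where
  "mconv F \<psi> x = (\<integral>t. F t * \<psi> (x - t) \<partial>lborel)"

lemma frechet_derivative_zero_outside:
  fixes \<psi> :: "'a::real_normed_vector \<Rightarrow> real"
  assumes "\<forall>y. norm y \<ge> R \<longrightarrow> \<psi> y = 0" "norm y > R"
  shows "frechet_derivative \<psi> (at y) v = 0"
proof -
  have "open {y. R < norm y}"
    by (intro open_Collect_less continuous_intros)
  then have "frechet_derivative \<psi> (at y) = frechet_derivative (\<lambda>_. 0) (at y)"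
    by (rule frechet_derivative_cong_open) (use assms in auto)
  then show ?thesis by simp
qed

text \<open>For \<open>x\<close> in the unit ball around \<open>x0\<close> the integrand vanishes
  outside one fixed box, so the integral may be taken over that box and differentiated under the
  integral sign.\<close>

lemma mconv_has_derivative:
  fixes F \<psi> :: "'a::euclidean_space \<Rightarrow> real"
  assumes F: "continuous_on UNIV F" and \<psi>: "smooth_map_on UNIV \<psi>"
    and supp: "\<forall>y. norm y \<ge> R \<longrightarrow> \<psi> y = 0"
  shows "(mconv F \<psi> has_derivative (\<lambda>v. mconv F (\<lambda>y. frechet_derivative \<psi> (at y) v) x0)) (at x0)"
proof -
  note FC = continuous_on_compose2[OF F _ subset_UNIV]
  note PC = continuous_on_compose2[OF smooth_map_on_continuous[OF \<psi>] _ subset_UNIV]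
  note DC = continuous_on_compose2[OF smooth_map_on_continuous[OF smooth_map_on_deriv[OF \<psi>]] _ subset_UNIV]
  obtain a b where ab: "cball x0 (\<bar>R\<bar> + 1) \<subseteq> cbox a b"
    using bounded_subset_cbox_symmetric[OF bounded_cball] by metis
  have far: "norm (x - t) > R" if "x \<in> ball x0 1" "t \<notin> cbox a b" for x t
  proof -
    have "dist x0 t > \<bar>R\<bar> + 1"
      using ab that(2) by (meson linorder_not_less mem_cball subsetD)
    moreover have "dist x0 t \<le> dist x0 x + dist x t"
      by (rule dist_triangle)
    ultimately show ?thesis
      using that(1) by (simp add: dist_norm)
  qed
  have bl: "bounded_linear (frechet_derivative \<psi> (at y))" for y
    using frechet_has_derivative[OF smooth_map_on_differentiable[OF \<psi>]] has_derivative_bounded_linear by blast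
  \<comment> \<open>\<open>leibniz_rule\<close> takes the derivatives as a continuous family of
    bounded linear maps.\<close>
  define fx where "fx = (\<lambda>x t. Blinfun (\<lambda>v. F t * frechet_derivative \<psi> (at (x - t)) v))"
  have fx: "blinfun_apply (fx x t) = (\<lambda>v. F t * frechet_derivative \<psi> (at (x - t)) v)" for x t
    unfolding fx_def by (rule bounded_linear_Blinfun_apply) (intro bounded_linear_const_mult bl)
  have eq: "mconv F \<psi> x = integral (cbox a b) (\<lambda>t. F t * \<psi> (x - t))" if "x \<in> ball x0 1" for x
    unfolding mconv_def
    by (rule continuous_zero_outside_cbox)
      (use far[OF that] supp in \<open>auto intro!: continuous_intros FC PC less_imp_le\<close>)
  have cont: "continuous_on (ball x0 1 \<times> cbox a b) (\<lambda>(x, t). fx x t)"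
    unfolding split_beta
    by (rule continuous_on_blinfun_componentwise)
      (auto simp: fx intro!: continuous_intros FC DC)
  have cont0: "continuous_on (cbox a b) (fx x0)"
    by (rule continuous_on_blinfun_componentwise)
      (auto simp: fx intro!: continuous_intros FC DC)
  have "((\<lambda>x. integral (cbox a b) (\<lambda>t. F t * \<psi> (x - t))) has_derivative blinfun_apply (integral (cbox a b) (fx x0))) (at x0 within ball x0 1)"
  proof (rule leibniz_rule[OF _ _ cont])
    fix x t
    have "((\<lambda>x. \<psi> (x - t)) has_derivative (\<lambda>v. frechet_derivative \<psi> (at (x - t)) v)) (at x)"
      by (rule has_derivative_compose[OF _ frechet_has_derivative[OF smooth_map_on_differentiable[OF \<psi>]]])
        (auto intro!: derivative_eq_intros)
    then have "((\<lambda>x. F t * \<psi> (x - t)) has_derivative (\<lambda>v. F t * frechet_derivative \<psi> (at (x - t)) v)) (at x)"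
      by (rule has_derivative_mult_right)
    then show "((\<lambda>x. F t * \<psi> (x - t)) has_derivative blinfun_apply (fx x t)) (at x within ball x0 1)"
      unfolding fx by (rule has_derivative_at_withinI)
    show "(\<lambda>t. F t * \<psi> (x - t)) integrable_on cbox a b"
      by (intro integrable_continuous continuous_intros FC PC)
  qed auto
  then have "((\<lambda>x. integral (cbox a b) (\<lambda>t. F t * \<psi> (x - t))) has_derivative blinfun_apply (integral (cbox a b) (fx x0))) (at x0)"
    by (metis at_within_open centre_in_ball open_ball zero_less_one)
  then have d: "(mconv F \<psi> has_derivative blinfun_apply (integral (cbox a b) (fx x0))) (at x0)"
    by (rule has_derivative_transform_within_open[where s = "ball x0 1"]) (simp_all add: eq)
  have "blinfun_apply (integral (cbox a b) (fx x0)) v = mconv F (\<lambda>y. frechet_derivative \<psi> (at y) v) x0" for v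
  proof -
    have "blinfun_apply (integral (cbox a b) (fx x0)) v = integral (cbox a b) (\<lambda>t. blinfun_apply (fx x0 t) v)"
      using integral_linear[OF integrable_continuous[OF cont0] blinfun.bounded_linear_left[of v]]
      by (simp add: o_def)
    also have "\<dots> = mconv F (\<lambda>y. frechet_derivative \<psi> (at y) v) x0"
      unfolding mconv_def fx
      by (rule continuous_zero_outside_cbox(2)[symmetric])
        (use far[of x0] frechet_derivative_zero_outside[OF supp] in \<open>auto intro!: continuous_intros FC DC\<close>)
    finally show ?thesis .
  qed
  then show ?thesis
    using d by presburger
qed

lemma ck_on_mconv:
  fixes F \<psi> :: "'a::euclidean_space \<Rightarrow> real"
  assumes F: "continuous_on UNIV F" and \<psi>: "smooth_map_on UNIV \<psi>"
    and supp: "\<forall>y. norm y \<ge> R \<longrightarrow> \<psi> y = 0"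
  shows "ck_on k UNIV (mconv F \<psi>)"
  using \<psi> supp
proof (induction k arbitrary: \<psi> R)
  case 0
  have "isCont (mconv F \<psi>) x" for x
    using mconv_has_derivative[OF F 0] has_derivative_continuous by blast
  then show ?case
    by (simp add: continuous_at_imp_continuous_on)
next
  case (Suc k)
  note d = mconv_has_derivative[OF F Suc.prems]
  have "ck_on k UNIV (\<lambda>x. frechet_derivative (mconv F \<psi>) (at x) v)" for v
  proof -
    \<comment> \<open>\<open>frechet_derivative_zero_outside\<close> covers norms strictly larger
      than \<open>R\<close>, hence the larger radius; its value does not matter in the
      induction.\<close>
    have "\<forall>y. norm y \<ge> R + 1 \<longrightarrow> frechet_derivative \<psi> (at y) v = 0"
      using frechet_derivative_zero_outside[OF Suc.prems(2)] by auto
    from Suc.IH[OF smooth_map_on_deriv[OF Suc.prems(1)] this] show ?thesis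
      by (simp only: frechet_derivative_at[OF d, symmetric])
  qed
  then show ?case
    using d by (auto simp: differentiable_def)
qed

lemma mconv_eq:
  assumes "continuous_on UNIV F" "continuous_on UNIV \<psi>"
  shows "mconv F \<psi> x = (\<integral>y. F (x - y) * \<psi> y \<partial>lborel)"
proof -
  have "(\<lambda>t. F t * \<psi> (x - t)) \<in> borel_measurable borel"
    by (intro borel_measurable_continuous_onI continuous_intros continuous_on_compose2[OF assms(1)]
        continuous_on_compose2[OF assms(2)]) auto
  from integral_lborel_affine(1)[of "-1", OF _ this, of x] show ?thesis
    by (simp add: mconv_def)
qed

text \<open>The last identity is the decisive one: the \<open>1 / \<epsilon>\<close> in the mass of
  the derivative is compensated by the distance of a differentiable function from its affine
  approximation, which is \<open>o(\<epsilon>)\<close> on a ball of radius \<epsilon>.\<close>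

lemma mollifier_scaled:
  fixes \<rho> :: "'a::euclidean_space \<Rightarrow> real"
  assumes \<rho>: "smooth_map_on UNIV \<rho>" "\<And>x. \<rho> x \<ge> 0" "\<forall>x. norm x \<ge> 1 \<longrightarrow> \<rho> x = 0" "(\<integral>x. \<rho> x \<partial>lborel) = 1"
    and \<epsilon>: "\<epsilon> > 0"
  defines "\<psi> \<equiv> \<lambda>x. (1 / \<epsilon>) ^ DIM('a) * \<rho> ((1 / \<epsilon>) *\<^sub>R x)"
  shows "smooth_map_on UNIV \<psi>" "\<And>x. \<psi> x \<ge> 0" "\<forall>x. norm x \<ge> \<epsilon> \<longrightarrow> \<psi> x = 0" "(\<integral>x. \<psi> x \<partial>lborel) = 1"
    "(\<integral>x. \<bar>frechet_derivative \<psi> (at x) v\<bar> \<partial>lborel) = (\<integral>x. \<bar>frechet_derivative \<rho> (at x) v\<bar> \<partial>lborel) / \<epsilon>"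
proof -
  have "ck_on k UNIV (\<lambda>x. \<rho> ((1 / \<epsilon>) *\<^sub>R x))" for k
  proof (rule ck_on_compose[where T = UNIV and f = \<rho> and g = "(*\<^sub>R) (1 / \<epsilon>)"])
    show "ck_on k UNIV \<rho>"
      using \<rho>(1) by (simp add: smooth_map_on_def)
    show "ck_on k UNIV ((*\<^sub>R) (1 / \<epsilon>) :: 'a \<Rightarrow> 'a)"
      by (rule ck_on_bounded_linear[OF bounded_linear_scaleR_right])
  qed auto
  then show "smooth_map_on UNIV \<psi>"
    unfolding \<psi>_def smooth_map_on_def using ck_on_bounded_linear_compose[OF open_UNIV bounded_linear_mult_right] by blast
  show "\<psi> x \<ge> 0" for x
    using \<rho>(2) \<epsilon> by (simp add: \<psi>_def)
  show "\<forall>x. norm x \<ge> \<epsilon> \<longrightarrow> \<psi> x = 0"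
  proof (intro allI impI)
    fix x :: 'a assume "norm x \<ge> \<epsilon>"
    then show "\<psi> x = 0"
      using \<rho>(3)[rule_format, of "(1 / \<epsilon>) *\<^sub>R x"] \<epsilon> by (simp add: \<psi>_def)
  qed
  have [measurable]: "\<rho> \<in> borel_measurable borel"
    by (rule borel_measurable_continuous_onI[OF smooth_map_on_continuous[OF \<rho>(1)]])
  show "(\<integral>x. \<psi> x \<partial>lborel) = 1"
    using integral_lborel_affine(1)[of "1/\<epsilon>" \<rho> 0] \<epsilon> \<rho>(4) by (simp add: \<psi>_def)
  have d: "(\<psi> has_derivative (\<lambda>v. (1 / \<epsilon>) ^ DIM('a) * frechet_derivative \<rho> (at ((1 / \<epsilon>) *\<^sub>R x)) ((1 / \<epsilon>) *\<^sub>R v))) (at x)" for x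
    unfolding \<psi>_def
    by (intro has_derivative_mult_right has_derivative_compose[OF _ frechet_has_derivative[OF smooth_map_on_differentiable[OF \<rho>(1)]]]
        has_derivative_scaleR_right has_derivative_ident) auto
  have lin: "linear (frechet_derivative \<rho> (at x))" for x
    using smooth_map_on_differentiable[OF \<rho>(1)] by (intro linear_frechet_derivative) auto
  have fd: "frechet_derivative \<psi> (at x) v = (1 / \<epsilon>) ^ DIM('a) * ((1 / \<epsilon>) * frechet_derivative \<rho> (at ((1 / \<epsilon>) *\<^sub>R x)) v)" for x
    unfolding frechet_derivative_at[OF d, symmetric] linear_scale[OF lin] by simp
  have "(\<lambda>x. frechet_derivative \<rho> (at x) v) \<in> borel_measurable borel"
    by (rule borel_measurable_continuous_onI[OF smooth_map_on_continuous[OF smooth_map_on_deriv[OF \<rho>(1)]]])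
  then have "(\<integral>x. \<bar>frechet_derivative \<rho> (at x) v\<bar> \<partial>lborel)
      = (1 / \<epsilon>) ^ DIM('a) * (\<integral>x. \<bar>frechet_derivative \<rho> (at ((1 / \<epsilon>) *\<^sub>R x)) v\<bar> \<partial>lborel)"
    using integral_lborel_affine(1)[of "1/\<epsilon>" "\<lambda>x. \<bar>frechet_derivative \<rho> (at x) v\<bar>" 0] \<epsilon> by simp
  then show "(\<integral>x. \<bar>frechet_derivative \<psi> (at x) v\<bar> \<partial>lborel) = (\<integral>x. \<bar>frechet_derivative \<rho> (at x) v\<bar> \<partial>lborel) / \<epsilon>"
    using \<epsilon> by (simp add: fd abs_mult field_simps)
qed

text \<open>The gradient of the mollified function converges at every point where the function is
  differentiable, because mollification reproduces the gradient of an affine function.\<close>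

theorem lipschitz_mollification:
  fixes F :: "'a::euclidean_space \<Rightarrow> real"
  assumes lip: "L-lipschitz_on UNIV F"
  obtains W :: "nat \<Rightarrow> 'a \<Rightarrow> real" where
    "\<And>n. smooth_map_on UNIV (W n)" "\<And>n. L-lipschitz_on UNIV (W n)"
    "\<And>n x. \<bar>W n x - F x\<bar> \<le> L / Suc n"
    "\<And>n x. (\<And>y. y \<in> cball x (1 / Suc n) \<Longrightarrow> F y = 0) \<Longrightarrow> W n x = 0"
    "\<And>x v. F differentiable (at x) \<Longrightarrow>
       (\<lambda>n. frechet_derivative (W n) (at x) v) \<longlonglongrightarrow> frechet_derivative F (at x) v"
proof -
  obtain \<rho> :: "'a \<Rightarrow> real" where \<rho>: "smooth_map_on UNIV \<rho>" "\<And>x. \<rho> x \<ge> 0" "\<forall>x. norm x \<ge> 1 \<longrightarrow> \<rho> x = 0"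
      "integrable lborel \<rho>" "(\<integral>x. \<rho> x \<partial>lborel) = 1"
    using smooth_bump[where 'a = 'a] by metis
  define \<epsilon> where "\<epsilon> = (\<lambda>n. 1 / real (Suc n))"
  have \<epsilon>: "\<epsilon> n > 0" for n by (simp add: \<epsilon>_def)
  define \<psi> where "\<psi> = (\<lambda>n x. (1 / \<epsilon> n) ^ DIM('a) * \<rho> ((1 / \<epsilon> n) *\<^sub>R x))"
  have \<psi>_n: "\<psi> n x = (1 / \<epsilon> n) ^ DIM('a) * \<rho> ((1 / \<epsilon> n) *\<^sub>R x)" for n x
    by (simp add: \<psi>_def)
  note \<psi> = mollifier_scaled[OF \<rho>(1,2,3,5) \<epsilon>, folded \<psi>_n]
  define W where "W = (\<lambda>n. mconv F (\<psi> n))"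
  note L0 = lipschitz_on_nonneg[OF lip]
  have F: "continuous_on UNIV F"
    using lip by (rule lipschitz_on_continuous_on)
  have \<psi>c: "continuous_on UNIV (\<psi> n)" for n
    using smooth_map_on_continuous[OF \<psi>(1)] .
  have int: "integrable lborel (\<lambda>y. G (x - y) * \<psi> n y)" if "continuous_on UNIV G" for G :: "'a \<Rightarrow> real" and n x
  proof (rule continuous_bounded_support_integrable[where c = 0 and R = "\<epsilon> n"])
    show "continuous_on UNIV (\<lambda>y. G (x - y) * \<psi> n y)"
      by (intro continuous_intros continuous_on_compose2[OF that] \<psi>c) auto
    show "G (x - y) * \<psi> n y = 0" if "y \<notin> cball 0 (\<epsilon> n)" for y
      using \<psi>(3)[rule_format, of n y] that by simp
  qed
  have int\<psi>: "integrable lborel (\<psi> n)" for n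
    using int[of "\<lambda>_. 1"] by simp
  have W_eq: "W n x = (\<integral>y. F (x - y) * \<psi> n y \<partial>lborel)" for n x
    unfolding W_def by (rule mconv_eq[OF F \<psi>c])
  have const: "(\<integral>y. c * \<psi> n y \<partial>lborel) = c" for c n
    by (simp add: \<psi>(4))
  have FL: "\<bar>F x - F y\<bar> \<le> L * norm (x - y)" for x y
    using lipschitz_onD[OF lip, of x y] by (simp add: dist_norm)
  show thesis
  proof
    show "smooth_map_on UNIV (W n)" for n
      unfolding smooth_map_on_def W_def using ck_on_mconv[OF F \<psi>(1,3)] by blast
    show "L-lipschitz_on UNIV (W n)" for n
    proof (rule lipschitz_onI[OF _ L0])
      fix x z
      have "W n x - W n z = (\<integral>y. F (x - y) * \<psi> n y - F (z - y) * \<psi> n y \<partial>lborel)"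
        unfolding W_eq using int[OF F] by simp
      also have "\<bar>\<dots>\<bar> \<le> (\<integral>y. \<bar>F (x - y) * \<psi> n y - F (z - y) * \<psi> n y\<bar> \<partial>lborel)"
        by (rule integral_abs_bound)
      also have "\<dots> \<le> (\<integral>y. (L * norm (x - z)) * \<psi> n y \<partial>lborel)"
      proof (rule integral_mono)
        fix y
        have "\<bar>F (x - y) * \<psi> n y - F (z - y) * \<psi> n y\<bar> = \<bar>F (x - y) - F (z - y)\<bar> * \<psi> n y"
          using \<psi>(2) by (simp add: abs_mult flip: left_diff_distrib)
        also have "\<dots> \<le> (L * norm (x - z)) * \<psi> n y"
          using FL[of "x - y" "z - y"] \<psi>(2) by (intro mult_right_mono) auto
        finally show "\<bar>F (x - y) * \<psi> n y - F (z - y) * \<psi> n y\<bar> \<le> (L * norm (x - z)) * \<psi> n y" .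
      qed (use int[OF F] int\<psi> in auto)
      finally show "dist (W n x) (W n z) \<le> L * dist x z"
        by (simp only: const dist_norm real_norm_def)
    qed
    show "\<bar>W n x - F x\<bar> \<le> L / Suc n" for n x
    proof -
      have "W n x - F x = (\<integral>y. F (x - y) * \<psi> n y \<partial>lborel) - (\<integral>y. F x * \<psi> n y \<partial>lborel)"
        by (simp only: W_eq const)
      also have "\<dots> = (\<integral>y. F (x - y) * \<psi> n y - F x * \<psi> n y \<partial>lborel)"
        using int[OF F] int\<psi> by simp
      also have "\<bar>\<dots>\<bar> \<le> (\<integral>y. \<bar>F (x - y) * \<psi> n y - F x * \<psi> n y\<bar> \<partial>lborel)"
        by (rule integral_abs_bound)
      also have "\<dots> \<le> (\<integral>y. (L * \<epsilon> n) * \<psi> n y \<partial>lborel)"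
      proof (rule integral_mono)
        fix y
        have "\<bar>F (x - y) * \<psi> n y - F x * \<psi> n y\<bar> = \<bar>F (x - y) - F x\<bar> * \<psi> n y"
          using \<psi>(2) by (simp add: abs_mult flip: left_diff_distrib)
        also have "\<dots> \<le> (L * norm y) * \<psi> n y"
          using FL[of "x - y" x] \<psi>(2) by (intro mult_right_mono) auto
        also have "\<dots> \<le> (L * \<epsilon> n) * \<psi> n y"
          using \<psi>(2)[of n y] \<psi>(3)[rule_format, of n y] L0
          by (cases "norm y \<ge> \<epsilon> n") (auto intro!: mult_right_mono mult_left_mono)
        finally show "\<bar>F (x - y) * \<psi> n y - F x * \<psi> n y\<bar> \<le> (L * \<epsilon> n) * \<psi> n y" .
      qed (use int[OF F] int\<psi> in auto)
      finally show ?thesis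
        by (simp only: const) (simp add: \<epsilon>_def)
    qed
    show "W n x = 0" if "\<And>y. y \<in> cball x (1 / Suc n) \<Longrightarrow> F y = 0" for n x
    proof -
      have "F (x - y) * \<psi> n y = 0" for y
      proof (cases "norm y \<ge> \<epsilon> n")
        case False
        then show ?thesis
          using that[of "x - y"] by (simp add: dist_norm \<epsilon>_def)
      qed (simp add: \<psi>(3))
      then have "(\<lambda>y. F (x - y) * \<psi> n y) = (\<lambda>_. 0)"
        by (rule ext)
      then show ?thesis by (simp only: W_eq) simp
    qed
    show "(\<lambda>n. frechet_derivative (W n) (at x) v) \<longlonglongrightarrow> frechet_derivative F (at x) v"
      if diff: "F differentiable (at x)" for x v
    proof -
      define g where "g = frechet_derivative F (at x)"
      have g: "(F has_derivative g) (at x)"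
        unfolding g_def by (rule frechet_has_derivative[OF diff])
      have blg: "bounded_linear g"
        using g has_derivative_bounded_linear by blast
      note ling = bounded_linear.linear[OF blg]
      have gc: "continuous_on S (\<lambda>z. g (h z))" if "continuous_on S h" for S and h :: "'a \<Rightarrow> 'a"
        by (rule bounded_linear.continuous_on[OF blg that])
      define A where "A = (\<lambda>t. F x + g (t - x))"
      have A: "continuous_on UNIV A"
        unfolding A_def by (intro continuous_intros gc)
      define D where "D = (\<lambda>n y. frechet_derivative (\<psi> n) (at y) v)"
      have Dc: "continuous_on UNIV (D n)" for n
        unfolding D_def by (rule smooth_map_on_continuous[OF smooth_map_on_deriv[OF \<psi>(1)]])
      have D0: "D n y = 0" if "norm y > \<epsilon> n" for n y
        unfolding D_def using \<psi>(3) that by (rule frechet_derivative_zero_outside)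
      have intD: "integrable lborel (\<lambda>t. G t * D n (x - t))" if "continuous_on UNIV G" for G :: "'a \<Rightarrow> real" and n
        by (rule continuous_bounded_support_integrable[where c = x and R = "\<epsilon> n"])
          (use D0 in \<open>auto intro!: continuous_intros that continuous_on_compose2[OF Dc _ subset_UNIV] simp: dist_norm\<close>)
      have FW: "frechet_derivative (W n) (at x) v = mconv F (D n) x" for n
        unfolding W_def D_def by (subst frechet_derivative_at[OF mconv_has_derivative[OF F \<psi>(1,3)], symmetric]) simp
      \<comment> \<open>Convolution with \<open>\<psi> n\<close> shifts the affine function
        \<open>A\<close> by the constant \<integral> g \<psi>, leaving its derivative
        \<open>g\<close> unchanged.\<close>
      have A_conv: "mconv A (D n) x = g v" for n
      proof -
        have "mconv A (\<psi> n) = (\<lambda>z. A z - (\<integral>y. g y * \<psi> n y \<partial>lborel))"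
        proof
          fix z
          have "mconv A (\<psi> n) z = (\<integral>y. A (z - y) * \<psi> n y \<partial>lborel)"
            by (rule mconv_eq[OF A \<psi>c])
          also have "\<dots> = (\<integral>y. A z * \<psi> n y - g y * \<psi> n y \<partial>lborel)"
          proof (rule Bochner_Integration.integral_cong[OF refl])
            fix y
            have "z - y - x = (z - x) - y" by simp
            then have "A (z - y) = A z - g y"
              unfolding A_def by (simp only: linear_diff[OF ling, of "z - x" y])
            then show "A (z - y) * \<psi> n y = A z * \<psi> n y - g y * \<psi> n y"
              by (simp add: left_diff_distrib)
          qed
          also have "\<dots> = (\<integral>y. A z * \<psi> n y \<partial>lborel) - (\<integral>y. g y * \<psi> n y \<partial>lborel)"
          proof (rule Bochner_Integration.integral_diff)
            have "integrable lborel (\<lambda>y. g (- (0 - y)) * \<psi> n y)"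
              by (rule int) (intro gc continuous_intros)
            then show "integrable lborel (\<lambda>y. g y * \<psi> n y)" by simp
          qed (use int\<psi> in auto)
          finally show "mconv A (\<psi> n) z = A z - (\<integral>y. g y * \<psi> n y \<partial>lborel)"
            by (simp only: const)
        qed
        moreover have "((\<lambda>z. A z - (\<integral>y. g y * \<psi> n y \<partial>lborel)) has_derivative g) (at x)"
          unfolding A_def by (auto intro!: derivative_eq_intros bounded_linear.has_derivative[OF blg])
        ultimately have "(mconv A (\<psi> n) has_derivative g) (at x)" by simp
        from has_derivative_unique[OF mconv_has_derivative[OF A \<psi>(1,3)] this] show ?thesis
          unfolding D_def by (rule fun_cong)
      qed
      define C where "C = (\<integral>y. \<bar>frechet_derivative \<rho> (at y) v\<bar> \<partial>lborel)"
      have C0: "C \<ge> 0"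
        unfolding C_def by (rule Bochner_Integration.integral_nonneg) simp
      have intD1: "(\<integral>t. \<bar>D n (x - t)\<bar> \<partial>lborel) = C / \<epsilon> n" for n
      proof -
        have "(\<lambda>t. \<bar>D n t\<bar>) \<in> borel_measurable borel"
          by (intro borel_measurable_continuous_onI continuous_intros Dc)
        from integral_lborel_affine(1)[of "-1", OF _ this, of x] show ?thesis
          by (simp add: D_def \<psi>(5) C_def)
      qed
      show ?thesis
        unfolding g_def[symmetric] FW
      proof (rule LIMSEQ_I)
        fix e :: real assume e: "e > 0"
        \<comment> \<open>On the support of \<open>D n (x - t)\<close> the difference of
          \<open>F\<close> and \<open>A\<close> is at most \<open>\<delta> * \<epsilon> n\<close>,
          and the integral of \<open>\<bar>D n\<bar>\<close> is \<open>C / \<epsilon> n\<close>. The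
          product is \<open>\<delta> * C < e\<close>.\<close>
        define \<delta> where "\<delta> = e / (C + 1)"
        have \<delta>: "\<delta> > 0" "\<delta> * C < e"
          using e C0 by (auto simp: \<delta>_def field_simps)
        obtain d where d: "d > 0" "\<And>y. norm (y - x) < d \<Longrightarrow> norm (F y - F x - g (y - x)) \<le> \<delta> * norm (y - x)"
          using g \<delta>(1) unfolding has_derivative_at_alt by blast
        obtain N where N: "1 / Suc N < d"
          using nat_approx_posE[OF d(1)] .
        have "norm (mconv F (D n) x - g v) < e" if "n \<ge> N" for n
        proof -
          have "\<epsilon> n \<le> 1 / Suc N"
            unfolding \<epsilon>_def using that by (intro divide_left_mono) auto
          then have "\<epsilon> n < d" using N by simp
          have "mconv F (D n) x - g v = mconv F (D n) x - mconv A (D n) x"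
            by (simp only: A_conv)
          also have "\<dots> = (\<integral>t. F t * D n (x - t) - A t * D n (x - t) \<partial>lborel)"
            unfolding mconv_def using intD[OF F] intD[OF A] by simp
          also have "norm \<dots> \<le> (\<integral>t. norm (F t * D n (x - t) - A t * D n (x - t)) \<partial>lborel)"
            by (rule integral_norm_bound)
          also have "\<dots> \<le> (\<integral>t. (\<delta> * \<epsilon> n) * \<bar>D n (x - t)\<bar> \<partial>lborel)"
          proof (rule integral_mono)
            show "integrable lborel (\<lambda>t. (\<delta> * \<epsilon> n) * \<bar>D n (x - t)\<bar>)"
              using integrable_abs[OF intD[OF continuous_on_const[of UNIV 1]]] by simp
            fix t
            have eq: "norm (F t * D n (x - t) - A t * D n (x - t)) = \<bar>F t - F x - g (t - x)\<bar> * \<bar>D n (x - t)\<bar>"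
              unfolding A_def by (simp add: diff_diff_add flip: left_diff_distrib abs_mult)
            show "norm (F t * D n (x - t) - A t * D n (x - t)) \<le> (\<delta> * \<epsilon> n) * \<bar>D n (x - t)\<bar>"
            proof (cases "norm (x - t) > \<epsilon> n")
              case False
              then have "norm (t - x) \<le> \<epsilon> n"
                by (simp add: norm_minus_commute)
              then have "\<bar>F t - F x - g (t - x)\<bar> \<le> \<delta> * norm (t - x)"
                using d(2)[of t] \<open>\<epsilon> n < d\<close> by simp
              also have "\<dots> \<le> \<delta> * \<epsilon> n"
                using \<delta>(1) \<open>norm (t - x) \<le> \<epsilon> n\<close> by (intro mult_left_mono) auto
              finally show ?thesis
                unfolding eq by (rule mult_right_mono) simp
            qed (simp add: D0)
          qed (use intD[OF F] intD[OF A] in auto)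
          also have "\<dots> = \<delta> * C"
            using \<epsilon>[of n] by (simp add: intD1)
          finally show ?thesis using \<delta>(2) by simp
        qed
        then show "\<exists>N. \<forall>n\<ge>N. norm (mconv F (D n) x - g v) < e" by blast
      qed
    qed
  qed
qed

section \<open>Gradients on a Riemannian manifold\<close>

lemma inner_transpose: "(transpose M *v x) \<bullet> y = x \<bullet> (M *v y)" for M :: "real ^ 'm ^ 'n"
  by (simp add: dot_lmul_matrix transpose_matrix_vector)

lemma matrix_inv_mult:
  fixes M :: "real ^ 'n ^ 'n"
  assumes "invertible M"
  shows "matrix_inv M ** M = mat 1" "M ** matrix_inv M = mat 1"
proof -
  have "\<exists>N. M ** N = mat 1 \<and> N ** M = mat 1"
    using assms by (simp add: invertible_def)
  then have "M ** matrix_inv M = mat 1 \<and> matrix_inv M ** M = mat 1"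
    unfolding matrix_inv_def by (rule someI_ex)
  then show "matrix_inv M ** M = mat 1" "M ** matrix_inv M = mat 1" by auto
qed

locale riem_atlas =
  fixes A :: "('a::metric_space, 'n::finite) riem_chart set"
  assumes atlas: "smooth_atlas A" and metric: "riemannian_metric A"
begin

lemma chart_at: "chart_at A p \<in> A" "p \<in> dom (chart_at A p)"
proof -
  have "\<exists>c. c \<in> A \<and> p \<in> dom c"
    using atlas unfolding smooth_atlas_def by blast
  then have "chart_at A p \<in> A \<and> p \<in> dom (chart_at A p)"
    unfolding chart_at_def by (rule someI_ex)
  then show "chart_at A p \<in> A" "p \<in> dom (chart_at A p)" by auto
qed

lemma
  assumes "c \<in> A"
  shows open_dom: "open (dom c)" and open_coord: "open (coord c ` dom c)"
    and homeo: "homeomorphism (dom c) (coord c ` dom c) (coord c) (coord_inv c)"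
  using atlas assms unfolding smooth_atlas_def by auto

lemma coord_inv_coord: "c \<in> A \<Longrightarrow> p \<in> dom c \<Longrightarrow> coord_inv c (coord c p) = p"
  using homeo unfolding homeomorphism_def by blast

lemma coord_coord_inv: "c \<in> A \<Longrightarrow> x \<in> coord c ` dom c \<Longrightarrow> coord c (coord_inv c x) = x"
  using homeo unfolding homeomorphism_def by blast

lemma coord_inv_in: "c \<in> A \<Longrightarrow> x \<in> coord c ` dom c \<Longrightarrow> coord_inv c x \<in> dom c"
  using homeo unfolding homeomorphism_def by blast

lemma continuous_coord: "c \<in> A \<Longrightarrow> continuous_on (dom c) (coord c)"
  using homeo unfolding homeomorphism_def by blast

lemma continuous_coord_inv: "c \<in> A \<Longrightarrow> continuous_on (coord c ` dom c) (coord_inv c)"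
  using homeo unfolding homeomorphism_def by blast

lemma coord_image_eq:
  assumes "c \<in> A" "S \<subseteq> dom c"
  shows "coord c ` S = coord c ` dom c \<inter> coord_inv c -` S"
  using assms coord_inv_coord coord_coord_inv coord_inv_in by (auto simp: image_iff subset_iff)

lemma open_coord_image:
  assumes "c \<in> A" "open S" "S \<subseteq> dom c"
  shows "open (coord c ` S)"
  unfolding coord_image_eq[OF assms(1,3)]
  using continuous_open_preimage[OF continuous_coord_inv open_coord assms(2)] assms(1) by simp

lemma transition_smooth:
  "c \<in> A \<Longrightarrow> d \<in> A \<Longrightarrow> smooth_map_on (coord c ` (dom c \<inter> dom d)) (transition c d)"
  using atlas unfolding smooth_atlas_def by auto

lemma open_overlap: "c \<in> A \<Longrightarrow> d \<in> A \<Longrightarrow> open (coord c ` (dom c \<inter> dom d))"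
  by (intro open_coord_image open_Int open_dom) auto

lemma transition_coord: "c \<in> A \<Longrightarrow> p \<in> dom c \<Longrightarrow> transition c d (coord c p) = coord d p"
  by (simp add: transition_def coord_inv_coord)

lemma coord_inv_transition:
  "c \<in> A \<Longrightarrow> d \<in> A \<Longrightarrow> x \<in> coord c ` (dom c \<inter> dom d) \<Longrightarrow> coord_inv d (transition c d x) = coord_inv c x"
  by (auto simp: transition_coord coord_inv_coord)

lemma gram_smooth: "c \<in> A \<Longrightarrow> smooth_map_on (coord c ` dom c) (gram c \<circ> coord_inv c)"
  using metric unfolding riemannian_metric_def by auto

lemma gram_sym: "c \<in> A \<Longrightarrow> p \<in> dom c \<Longrightarrow> transpose (gram c p) = gram c p"
  using metric unfolding riemannian_metric_def by auto

lemma gram_pos: "c \<in> A \<Longrightarrow> p \<in> dom c \<Longrightarrow> v \<noteq> 0 \<Longrightarrow> v \<bullet> (gram c p *v v) > 0"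
  using metric unfolding riemannian_metric_def by auto

lemma gram_nonneg: "c \<in> A \<Longrightarrow> p \<in> dom c \<Longrightarrow> v \<bullet> (gram c p *v v) \<ge> 0"
  using gram_pos[of c p v] by (cases "v = 0") auto

lemma gram_inner_commute:
  assumes "c \<in> A" "p \<in> dom c"
  shows "v \<bullet> (gram c p *v w) = w \<bullet> (gram c p *v v)"
  using inner_transpose[of "gram c p" v w] by (simp add: gram_sym[OF assms] inner_commute)

lemma gram_invertible:
  assumes "c \<in> A" "p \<in> dom c"
  shows "invertible (gram c p)"
proof -
  have "v = 0" if "gram c p *v v = 0" for v
    using gram_pos[OF assms, of v] that by auto
  then show ?thesis
    by (simp add: invertible_left_inverse matrix_left_invertible_ker)
qed

lemma gram_transform:
  assumes "c \<in> A" "d \<in> A" "p \<in> dom c" "p \<in> dom d"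
  shows "gram c p = transpose (jacobian (transition c d) (at (coord c p))) ** gram d p ** jacobian (transition c d) (at (coord c p))"
proof -
  have *: "\<forall>c\<in>A. \<forall>d\<in>A. \<forall>p\<in>dom c \<inter> dom d. gram c p =
      transpose (jacobian (transition c d) (at (coord c p))) ** gram d p ** jacobian (transition c d) (at (coord c p))"
    using metric unfolding riemannian_metric_def Let_def by (elim conjE)
  show ?thesis
    by (rule bspec[OF bspec[OF bspec[OF * assms(1)] assms(2)] IntI[OF assms(3,4)]])
qed

lemma transition_has_derivative:
  assumes "c \<in> A" "d \<in> A" "p \<in> dom c" "p \<in> dom d"
  shows "(transition c d has_derivative (\<lambda>v. jacobian (transition c d) (at (coord c p)) *v v)) (at (coord c p))"
  using smooth_map_on_differentiable[OF transition_smooth[OF assms(1,2)], of "coord c p"] assms(3,4)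
  by (simp add: jacobian_works)

subsection \<open>The metric as an inner product\<close>

definition gnorm :: "('a, 'n) riem_chart \<Rightarrow> 'a \<Rightarrow> real ^ 'n \<Rightarrow> real" where
  "gnorm c p v = sqrt (v \<bullet> (gram c p *v v))"

lemma gnorm_nonneg: "c \<in> A \<Longrightarrow> p \<in> dom c \<Longrightarrow> gnorm c p v \<ge> 0"
  by (simp add: gnorm_def gram_nonneg)

lemma gnorm_sq: "c \<in> A \<Longrightarrow> p \<in> dom c \<Longrightarrow> (gnorm c p v)\<^sup>2 = v \<bullet> (gram c p *v v)"
  by (simp add: gnorm_def gram_nonneg)

lemma gnorm_scaleR: "gnorm c p (a *\<^sub>R v) = \<bar>a\<bar> * gnorm c p v"
  by (simp add: gnorm_def matrix_vector_mult_scaleR real_sqrt_mult mult.assoc[symmetric])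

lemma gnorm_zero [simp]: "gnorm c p 0 = 0"
  by (simp add: gnorm_def)

lemma gnorm_Cauchy_Schwarz:
  assumes c: "c \<in> A" "p \<in> dom c"
  shows "\<bar>v \<bullet> (gram c p *v w)\<bar> \<le> gnorm c p v * gnorm c p w"
proof (cases "w = 0")
  case False
  define a where "a = w \<bullet> (gram c p *v w)"
  define b where "b = v \<bullet> (gram c p *v w)"
  have a: "a > 0" unfolding a_def using gram_pos[OF c False] .
  have "0 \<le> (a *\<^sub>R v - b *\<^sub>R w) \<bullet> (gram c p *v (a *\<^sub>R v - b *\<^sub>R w))"
    by (rule gram_nonneg[OF c])
  also have "\<dots> = a * (a * (v \<bullet> (gram c p *v v)) - b\<^sup>2)"
    using gram_inner_commute[OF c, of w v]
    by (simp add: matrix_vector_mult_diff_distrib matrix_vector_mult_scaleR inner_diff_left inner_diff_right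
        a_def[symmetric] b_def[symmetric] algebra_simps power2_eq_square)
  finally have "b\<^sup>2 \<le> (v \<bullet> (gram c p *v v)) * a"
    using a by (simp add: zero_le_mult_iff mult.commute)
  then have "sqrt (b\<^sup>2) \<le> sqrt ((v \<bullet> (gram c p *v v)) * a)"
    by (rule real_sqrt_le_mono)
  then show ?thesis
    by (simp add: gnorm_def real_sqrt_mult a_def b_def)
qed simp

lemma gnorm_triangle:
  assumes c: "c \<in> A" "p \<in> dom c"
  shows "gnorm c p (v + w) \<le> gnorm c p v + gnorm c p w"
proof (rule power2_le_imp_le)
  have "(gnorm c p (v + w))\<^sup>2 = (gnorm c p v)\<^sup>2 + 2 * (v \<bullet> (gram c p *v w)) + (gnorm c p w)\<^sup>2"
    using gram_inner_commute[OF c, of w v]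
    by (simp add: gnorm_sq[OF c] matrix_vector_right_distrib inner_add_left inner_add_right)
  also have "\<dots> \<le> (gnorm c p v + gnorm c p w)\<^sup>2"
    using gnorm_Cauchy_Schwarz[OF c, of v w] by (simp add: power2_sum)
  finally show "(gnorm c p (v + w))\<^sup>2 \<le> (gnorm c p v + gnorm c p w)\<^sup>2" .
qed (simp add: gnorm_nonneg[OF c])

lemma gnorm_transform:
  assumes "c \<in> A" "d \<in> A" "p \<in> dom c" "p \<in> dom d"
  shows "gnorm c p v = gnorm d p (jacobian (transition c d) (at (coord c p)) *v v)"
proof -
  define J where "J = jacobian (transition c d) (at (coord c p))"
  have "v \<bullet> (gram c p *v v) = (J *v v) \<bullet> (gram d p *v (J *v v))"
    unfolding gram_transform[OF assms] J_def[symmetric]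
    unfolding matrix_vector_mul_assoc[symmetric] inner_commute[of v] inner_transpose
    by (rule inner_commute)
  then show ?thesis
    by (simp add: gnorm_def J_def)
qed

text \<open>On the compact product of \<open>K\<close> and the unit sphere the continuous function
  \<open>gnorm\<close> has a positive minimum and a maximum; homogeneity extends the bounds to all
  vectors.\<close>

lemma gnorm_comparable:
  assumes c: "c \<in> A" and K: "compact K" "K \<subseteq> dom c"
  obtains l where "l > 0" "\<And>p v. p \<in> K \<Longrightarrow> norm v \<le> l * gnorm c p v"
    "\<And>p v. p \<in> K \<Longrightarrow> gnorm c p v \<le> l * norm v"
proof (cases "K = {}")
  case True
  then show thesis using that[of 1] by simp
next
  case False
  define S where "S = K \<times> sphere (0 :: real ^ 'n) 1"
  have S: "compact S" "S \<noteq> {}"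
    unfolding S_def using K False by (auto intro: compact_Times)
  have "continuous_on K (\<lambda>p. (gram c \<circ> coord_inv c) (coord c p))"
    using K(2) smooth_map_on_continuous[OF gram_smooth[OF c]]
    by (intro continuous_on_compose2[OF _ continuous_on_subset[OF continuous_coord[OF c] K(2)]]) auto
  then have g: "continuous_on K (gram c)"
    by (rule continuous_on_eq) (use K(2) coord_inv_coord[OF c] in auto)
  have "continuous_on S (\<lambda>z. gnorm c (fst z) (snd z))"
    unfolding gnorm_def matrix_vector_mult_def
    by (intro continuous_intros continuous_on_compose2[OF g]) (auto simp: S_def)
  note cont = this
  obtain z1 where z1: "z1 \<in> S" "\<forall>z\<in>S. gnorm c (fst z1) (snd z1) \<le> gnorm c (fst z) (snd z)"
    using continuous_attains_inf[OF S cont] by blast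
  obtain z2 where z2: "z2 \<in> S" "\<forall>z\<in>S. gnorm c (fst z) (snd z) \<le> gnorm c (fst z2) (snd z2)"
    using continuous_attains_sup[OF S cont] by blast
  define a where "a = gnorm c (fst z1) (snd z1)"
  define b where "b = gnorm c (fst z2) (snd z2)"
  have a: "a > 0"
    using z1(1) K(2) gram_pos[OF c, of "fst z1" "snd z1"] by (force simp: a_def gnorm_def S_def)
  have bounds: "a * norm v \<le> gnorm c p v \<and> gnorm c p v \<le> b * norm v" if p: "p \<in> K" for p v
  proof (cases "v = 0")
    case False
    have "(p, (1 / norm v) *\<^sub>R v) \<in> S"
      using p False by (simp add: S_def)
    with z1(2) z2(2) have "a \<le> gnorm c p ((1 / norm v) *\<^sub>R v)" "gnorm c p ((1 / norm v) *\<^sub>R v) \<le> b"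
      by (force simp: a_def b_def)+
    then show ?thesis
      using False by (simp add: gnorm_scaleR field_simps)
  qed simp
  show thesis
  proof
    show "max (1 / a) b > 0" using a by (simp add: less_max_iff_disj)
    fix p v assume p: "p \<in> K"
    have n: "gnorm c p v \<ge> 0"
      using gnorm_nonneg[OF c] p K(2) by auto
    have "norm v \<le> (1 / a) * gnorm c p v"
      using bounds[OF p, of v] a by (simp add: field_simps)
    also have "\<dots> \<le> max (1 / a) b * gnorm c p v"
      by (intro mult_right_mono n) simp
    finally show "norm v \<le> max (1 / a) b * gnorm c p v" .
    have "gnorm c p v \<le> b * norm v"
      using bounds[OF p, of v] by simp
    also have "\<dots> \<le> max (1 / a) b * norm v"
      by (intro mult_right_mono) auto
    finally show "gnorm c p v \<le> max (1 / a) b * norm v" .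
  qed
qed

subsection \<open>Differentials\<close>

definition mdiff :: "('a, 'n) riem_chart \<Rightarrow> ('a \<Rightarrow> real) \<Rightarrow> 'a \<Rightarrow> bool" where
  "mdiff c f p \<longleftrightarrow> (f \<circ> coord_inv c) differentiable (at (coord c p))"

text \<open>The components of the differential \<open>df\<close>. They are linear in
  \<open>f\<close> and transform by the transposed Jacobian, without the metric, which enters only
  when the index is raised to form the gradient.\<close>

definition covec :: "('a, 'n) riem_chart \<Rightarrow> ('a \<Rightarrow> real) \<Rightarrow> 'a \<Rightarrow> real ^ 'n" where
  "covec c f p = (\<chi> i. frechet_derivative (f \<circ> coord_inv c) (at (coord c p)) (axis i 1))"

lemma covec_eqI:
  assumes "((f \<circ> coord_inv c) has_derivative D) (at (coord c p))"
  shows "covec c f p = (\<chi> i. D (axis i 1))" "mdiff c f p"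
  using assms frechet_derivative_at[OF assms] by (auto simp: covec_def mdiff_def differentiable_def)

lemma covec_has_derivative:
  assumes "mdiff c f p"
  shows "((f \<circ> coord_inv c) has_derivative (\<lambda>v. covec c f p \<bullet> v)) (at (coord c p))"
proof -
  define D where "D = frechet_derivative (f \<circ> coord_inv c) (at (coord c p))"
  have d: "((f \<circ> coord_inv c) has_derivative D) (at (coord c p))"
    unfolding D_def using assms mdiff_def frechet_has_derivative by blast
  have lin: "linear D"
    using d has_derivative_linear by blast
  have "D v = covec c f p \<bullet> v" for v
  proof -
    have "D v = D (\<Sum>i\<in>UNIV. v $ i *\<^sub>R axis i 1)"
      using basis_expansion[of v] by (simp add: scalar_mult_eq_scaleR)
    also have "\<dots> = (\<Sum>i\<in>UNIV. v $ i * D (axis i 1))"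
      unfolding linear_sum[OF lin] linear_scale[OF lin] by simp
    finally show ?thesis
      by (simp add: covec_def D_def inner_vec_def mult.commute)
  qed
  then have "D = (\<lambda>v. covec c f p \<bullet> v)" by (rule ext)
  with d show ?thesis by simp
qed

lemma covec_unique:
  assumes "((f \<circ> coord_inv c) has_derivative (\<lambda>v. w \<bullet> v)) (at (coord c p))"
  shows "covec c f p = w"
  using covec_eqI(1)[OF assms] by (simp add: vec_eq_iff inner_axis)

lemma covec_add:
  assumes "mdiff c f p" "mdiff c g p"
  shows "mdiff c (\<lambda>x. f x + g x) p" "covec c (\<lambda>x. f x + g x) p = covec c f p + covec c g p"
proof -
  have "((\<lambda>x. (f \<circ> coord_inv c) x + (g \<circ> coord_inv c) x) has_derivative (\<lambda>v. covec c f p \<bullet> v + covec c g p \<bullet> v)) (at (coord c p))"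
    by (intro has_derivative_add covec_has_derivative assms)
  then have d: "(((\<lambda>x. f x + g x) \<circ> coord_inv c) has_derivative (\<lambda>v. (covec c f p + covec c g p) \<bullet> v)) (at (coord c p))"
    by (simp add: o_def inner_add_left)
  show "mdiff c (\<lambda>x. f x + g x) p" "covec c (\<lambda>x. f x + g x) p = covec c f p + covec c g p"
    by (rule covec_eqI(2)[OF d], rule covec_unique[OF d])
qed

lemma covec_scale:
  assumes "mdiff c f p"
  shows "mdiff c (\<lambda>x. k * f x) p" "covec c (\<lambda>x. k * f x) p = k *\<^sub>R covec c f p"
proof -
  have "((\<lambda>x. k * (f \<circ> coord_inv c) x) has_derivative (\<lambda>v. k * (covec c f p \<bullet> v))) (at (coord c p))"
    by (intro has_derivative_mult_right covec_has_derivative assms)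
  then have d: "(((\<lambda>x. k * f x) \<circ> coord_inv c) has_derivative (\<lambda>v. (k *\<^sub>R covec c f p) \<bullet> v)) (at (coord c p))"
    by (simp add: o_def)
  show "mdiff c (\<lambda>x. k * f x) p" "covec c (\<lambda>x. k * f x) p = k *\<^sub>R covec c f p"
    by (rule covec_eqI(2)[OF d], rule covec_unique[OF d])
qed

lemma covec_transform:
  assumes "c \<in> A" "d \<in> A" "p \<in> dom c" "p \<in> dom d" "mdiff d f p"
  shows "mdiff c f p" "covec c f p = transpose (jacobian (transition c d) (at (coord c p))) *v covec d f p"
proof -
  define J where "J = jacobian (transition c d) (at (coord c p))"
  have "((f \<circ> coord_inv d) has_derivative (\<lambda>v. covec d f p \<bullet> v)) (at (transition c d (coord c p)))"
    using covec_has_derivative[OF assms(5)] assms by (simp add: transition_coord)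
  from has_derivative_compose[OF transition_has_derivative[OF assms(1-4)] this]
  have "((\<lambda>x. (f \<circ> coord_inv d) (transition c d x)) has_derivative (\<lambda>v. covec d f p \<bullet> (J *v v))) (at (coord c p))"
    unfolding J_def .
  then have "((f \<circ> coord_inv c) has_derivative (\<lambda>v. covec d f p \<bullet> (J *v v))) (at (coord c p))"
    by (rule has_derivative_transform_within_open[OF _ open_overlap[OF assms(1,2)]])
      (use assms coord_inv_transition in auto)
  moreover have "covec d f p \<bullet> (J *v v) = (transpose J *v covec d f p) \<bullet> v" for v
    by (rule inner_transpose[symmetric])
  ultimately have d: "((f \<circ> coord_inv c) has_derivative (\<lambda>v. (transpose J *v covec d f p) \<bullet> v)) (at (coord c p))"
    by simp
  show "mdiff c f p" "covec c f p = transpose (jacobian (transition c d) (at (coord c p))) *v covec d f p"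
    using covec_eqI(2)[OF d] covec_unique[OF d] unfolding J_def by auto
qed

lemma mdiff_chart_indep:
  assumes "c \<in> A" "d \<in> A" "p \<in> dom c" "p \<in> dom d"
  shows "mdiff c f p \<longleftrightarrow> mdiff d f p"
  using covec_transform(1) assms by blast

lemma gradient_eq: "gradient c f p = (if mdiff c f p then matrix_inv (gram c p) *v covec c f p else 0)"
  by (simp add: gradient_def mdiff_def covec_def)

lemma gram_matrix_inv:
  assumes "c \<in> A" "p \<in> dom c"
  shows "gram c p *v (matrix_inv (gram c p) *v w) = w"
  using matrix_inv_mult(2)[OF gram_invertible[OF assms]] by (simp add: matrix_vector_mul_assoc)

lemma matrix_inv_eqI:
  assumes "c \<in> A" "p \<in> dom c" "gram c p *v v = w"
  shows "matrix_inv (gram c p) *v w = v"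
  using matrix_inv_mult(1)[OF gram_invertible[OF assms(1,2)]] assms(3)[symmetric] by (simp add: matrix_vector_mul_assoc)

text \<open>The norm of the dual metric \<open>g\<^sup>-\<^sup>1\<close> on covectors. On the
  differential of \<open>f\<close> it is the length of the gradient.\<close>

definition dual_norm :: "('a, 'n) riem_chart \<Rightarrow> 'a \<Rightarrow> real ^ 'n \<Rightarrow> real" where
  "dual_norm c p w = gnorm c p (matrix_inv (gram c p) *v w)"

lemma dual_norm_nonneg: "c \<in> A \<Longrightarrow> p \<in> dom c \<Longrightarrow> dual_norm c p w \<ge> 0"
  by (simp add: dual_norm_def gnorm_nonneg)

lemma dual_norm_add:
  "c \<in> A \<Longrightarrow> p \<in> dom c \<Longrightarrow> dual_norm c p (v + w) \<le> dual_norm c p v + dual_norm c p w"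
  by (simp add: dual_norm_def matrix_vector_right_distrib gnorm_triangle)

lemma dual_norm_scaleR: "dual_norm c p (k *\<^sub>R w) = \<bar>k\<bar> * dual_norm c p w"
  by (simp add: dual_norm_def matrix_vector_mult_scaleR gnorm_scaleR)

lemma dual_norm_pairing:
  assumes "c \<in> A" "p \<in> dom c"
  shows "\<bar>w \<bullet> v\<bar> \<le> dual_norm c p w * gnorm c p v"
proof -
  have "w \<bullet> v = v \<bullet> (gram c p *v (matrix_inv (gram c p) *v w))"
    by (simp add: gram_matrix_inv[OF assms] inner_commute)
  then show ?thesis
    using gnorm_Cauchy_Schwarz[OF assms] by (simp add: dual_norm_def mult.commute)
qed

text \<open>For \<open>v = g\<^sup>-\<^sup>1 w\<close> the square of the dual norm is
  \<open>v \<bullet> w\<close>, at most \<open>norm v * norm w\<close>, and \<open>norm v\<close> is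
  at most \<open>l\<close> times the dual norm. One factor cancels.\<close>

lemma dual_norm_le:
  assumes "c \<in> A" "p \<in> dom c" "\<And>v. norm v \<le> l * gnorm c p v"
  shows "dual_norm c p w \<le> l * norm w"
proof -
  define v where "v = matrix_inv (gram c p) *v w"
  define s where "s = gnorm c p v"
  have s0: "s \<ge> 0" unfolding s_def by (rule gnorm_nonneg[OF assms(1,2)])
  have "s * s = v \<bullet> w"
    using gnorm_sq[OF assms(1,2), of v] gram_matrix_inv[OF assms(1,2), of w]
    by (simp add: s_def v_def power2_eq_square)
  also have "\<dots> \<le> norm v * norm w"
    using Cauchy_Schwarz_ineq2[of v w] by linarith
  also have "\<dots> \<le> (l * s) * norm w"
    using assms(3)[of v] by (intro mult_right_mono) (auto simp: s_def)
  finally have "s * s \<le> s * (l * norm w)"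
    by (simp add: mult_ac)
  moreover have "0 \<le> l * norm w"
  proof (cases "w = 0")
    case False
    then have "0 < l * gnorm c p w"
      using assms(3)[of w] by (meson less_le_trans zero_less_norm_iff)
    then have "0 < l"
      using gnorm_nonneg[OF assms(1,2), of w] by (auto simp: zero_less_mult_iff)
    then show ?thesis by simp
  qed simp
  ultimately show ?thesis
    using s0 by (cases "s = 0") (auto simp: dual_norm_def v_def[symmetric] s_def[symmetric])
qed

text \<open>With \<open>v\<close> the raised covector in the chart \<open>c\<close>, the
  transformation law of the metric gives
  \<open>J\<^sup>T (gram d p *v (J *v v)) = J\<^sup>T *v w\<close>. Here \<open>J\<close> is
  invertible, since \<open>det J\<close> divides the nonzero \<open>det (gram c p)\<close>;
  cancelling shows that \<open>J *v v\<close> is the raised covector in \<open>d\<close>.\<close>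

lemma dual_norm_transform:
  assumes "c \<in> A" "d \<in> A" "p \<in> dom c" "p \<in> dom d"
  shows "dual_norm c p (transpose (jacobian (transition c d) (at (coord c p))) *v w) = dual_norm d p w"
proof -
  define J where "J = jacobian (transition c d) (at (coord c p))"
  define v where "v = matrix_inv (gram c p) *v (transpose J *v w)"
  have "gram c p *v v = transpose J *v w"
    unfolding v_def by (rule gram_matrix_inv[OF assms(1,3)])
  then have *: "transpose J *v (gram d p *v (J *v v)) = transpose J *v w"
    by (simp add: gram_transform[OF assms] J_def[symmetric] matrix_vector_mul_assoc matrix_mul_assoc)
  have inj: "y = z" if "transpose J *v y = transpose J *v z" for y z :: "real ^ 'n"
  proof -
    have "det (gram c p) \<noteq> 0"
      using gram_invertible[OF assms(1,3)] by (simp add: invertible_det_nz)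
    then have "det J \<noteq> 0"
      by (simp add: gram_transform[OF assms] J_def[symmetric] det_mul)
    then have "invertible (transpose J)"
      by (simp add: invertible_det_nz)
    from injD[OF inj_matrix_vector_mult[OF this] that] show ?thesis .
  qed
  have "gram d p *v (J *v v) = w"
    using inj[OF *] .
  then have "matrix_inv (gram d p) *v w = J *v v"
    by (rule matrix_inv_eqI[OF assms(2,4)])
  then show ?thesis
    using gnorm_transform[OF assms, of v] by (simp add: dual_norm_def v_def J_def)
qed

text \<open>Frees \<open>grad_norm\<close> from the arbitrary choice in \<open>chart_at\<close>, so
  that estimates may be made in any convenient chart.\<close>

lemma grad_norm_chart:
  assumes "c \<in> A" "p \<in> dom c"
  shows "grad_norm A f p = (if mdiff c f p then dual_norm c p (covec c f p) else 0)"
proof -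
  note d = chart_at[of p]
  have "grad_norm A f p = (if mdiff (chart_at A p) f p then dual_norm (chart_at A p) p (covec (chart_at A p) f p) else 0)"
    by (simp add: grad_norm_def gradient_eq dual_norm_def gnorm_def Let_def)
  then show ?thesis
    using mdiff_chart_indep[OF assms(1) d(1) assms(2) d(2), of f]
      covec_transform(2)[OF assms(1) d(1) assms(2) d(2), of f]
      dual_norm_transform[OF assms(1) d(1) assms(2) d(2)] by simp
qed

lemma grad_norm_nonneg: "grad_norm A f p \<ge> 0"
  using grad_norm_chart[OF chart_at] dual_norm_nonneg[OF chart_at] by simp

text \<open>Carried along because \<open>grad_norm\<close> is 0 at points of non-differentiability:
  subadditivity could fail there, for two non-differentiable functions with smooth sum.\<close>

definition mdifferentiable :: "('a \<Rightarrow> real) \<Rightarrow> 'a \<Rightarrow> bool" where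
  "mdifferentiable f p \<longleftrightarrow> mdiff (chart_at A p) f p"

lemma mdifferentiable_chart:
  "c \<in> A \<Longrightarrow> p \<in> dom c \<Longrightarrow> mdifferentiable f p \<longleftrightarrow> mdiff c f p"
  unfolding mdifferentiable_def using mdiff_chart_indep chart_at by blast

lemma grad_norm_add:
  assumes "mdifferentiable f p" "mdifferentiable g p"
  shows "mdifferentiable (\<lambda>x. f x + g x) p" "grad_norm A (\<lambda>x. f x + g x) p \<le> grad_norm A f p + grad_norm A g p"
  using assms covec_add[of "chart_at A p" f p g] dual_norm_add[OF chart_at]
  by (auto simp: mdifferentiable_def grad_norm_chart[OF chart_at])

lemma grad_norm_scale:
  assumes "mdifferentiable f p"
  shows "mdifferentiable (\<lambda>x. k * f x) p" "grad_norm A (\<lambda>x. k * f x) p = \<bar>k\<bar> * grad_norm A f p"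
  using assms covec_scale[of "chart_at A p" f p k] dual_norm_scaleR
  by (auto simp: mdifferentiable_def grad_norm_chart[OF chart_at])

lemma grad_norm_cong:
  assumes "open U" "p \<in> U" "\<And>x. x \<in> U \<Longrightarrow> f x = g x"
  shows "grad_norm A f p = grad_norm A g p" "mdifferentiable f p \<longleftrightarrow> mdifferentiable g p"
proof -
  define c where "c = chart_at A p"
  note c = chart_at[of p, folded c_def]
  have o: "open (coord c ` (dom c \<inter> U))"
    by (intro open_coord_image open_Int open_dom assms c) auto
  have m: "coord c p \<in> coord c ` (dom c \<inter> U)"
    using c assms by auto
  have e: "(f \<circ> coord_inv c) y = (g \<circ> coord_inv c) y" if "y \<in> coord c ` (dom c \<inter> U)" for y
    using that assms(3) coord_inv_coord[OF c(1)] by auto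
  have 1: "mdiff c f p \<longleftrightarrow> mdiff c g p"
    unfolding mdiff_def by (rule differentiable_cong_open[OF o m e])
  have 2: "covec c f p = covec c g p"
    unfolding covec_def by (simp only: frechet_derivative_cong_open[OF o m e])
  show "grad_norm A f p = grad_norm A g p" "mdifferentiable f p \<longleftrightarrow> mdifferentiable g p"
    using 1 2 by (simp_all add: grad_norm_chart[OF c] mdifferentiable_chart[OF c])
qed

lemma grad_norm_const: "grad_norm A (\<lambda>_. k) p = 0" "mdifferentiable (\<lambda>_. k) p"
proof -
  define c where "c = chart_at A p"
  note c = chart_at[of p, folded c_def]
  have d: "(((\<lambda>_. k) \<circ> coord_inv c) has_derivative (\<lambda>v. 0 \<bullet> v)) (at (coord c p))"
    by (simp add: o_def)
  have "covec c (\<lambda>_. k) p = 0" "mdiff c (\<lambda>_. k) p"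
    using covec_unique[OF d] covec_eqI(2)[OF d] by auto
  then show "grad_norm A (\<lambda>_. k) p = 0" "mdifferentiable (\<lambda>_. k) p"
    using dual_norm_scaleR[of c p 0 0] by (simp_all add: grad_norm_chart[OF c] mdifferentiable_chart[OF c])
qed

lemma grad_norm_zero_outside_support:
  assumes "p \<notin> closure {x. f x \<noteq> 0}"
  shows "grad_norm A f p = 0" "mdifferentiable f p"
proof -
  have *: "open (- closure {x. f x \<noteq> 0})" "p \<in> - closure {x. f x \<noteq> 0}"
    using assms by auto
  have "f x = 0" if "x \<in> - closure {x. f x \<noteq> 0}" for x
    using that closure_subset[of "{x. f x \<noteq> 0}"] by blast
  from grad_norm_cong[OF * this] show "grad_norm A f p = 0" "mdifferentiable f p"
    by (simp_all add: grad_norm_const)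
qed

end

section \<open>Test functions\<close>

lemma continuous_on_det:
  fixes M :: "'b::topological_space \<Rightarrow> real ^ 'n ^ 'n"
  assumes "\<And>i j. continuous_on S (\<lambda>x. M x $ i $ j)"
  shows "continuous_on S (\<lambda>x. det (M x))"
  unfolding det_def by (intro continuous_intros assms)

text \<open>By Cramer's rule the components are quotients of determinants, which are polynomials in
  the entries.\<close>

lemma continuous_on_matrix_inv_mult:
  fixes M :: "'b::topological_space \<Rightarrow> real ^ 'n ^ 'n" and w :: "'b \<Rightarrow> real ^ 'n"
  assumes M: "continuous_on S M" and w: "continuous_on S w" and inv: "\<And>x. x \<in> S \<Longrightarrow> invertible (M x)"
  shows "continuous_on S (\<lambda>x. matrix_inv (M x) *v w x)"
proof -
  have det: "det (M x) \<noteq> 0" if "x \<in> S" for x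
    using inv[OF that] by (simp add: invertible_det_nz)
  have "matrix_inv (M x) *v w x = (\<chi> k. det (\<chi> i j. if j = k then w x $ i else M x $ i $ j) / det (M x))"
    if "x \<in> S" for x
    using matrix_inv_mult(2)[OF inv[OF that]]
    by (intro iffD1[OF cramer[OF det[OF that]]]) (simp add: matrix_vector_mul_assoc)
  moreover have "continuous_on S (\<lambda>x. \<chi> k. det (\<chi> i j. if j = k then w x $ i else M x $ i $ j) / det (M x))"
  proof -
    have "continuous_on S (\<lambda>x. (\<chi> i j. if j = k then w x $ i else M x $ i $ j) $ i $ j)" for i j k
      using bounded_linear.continuous_on[OF bounded_linear_vec_nth w, of i]
        bounded_linear.continuous_on[OF bounded_linear_vec_nth[of j] bounded_linear.continuous_on[OF bounded_linear_vec_nth[of i] M]]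
      by (cases "j = k") simp_all
    then have num: "continuous_on S (\<lambda>x. det (\<chi> i j. if j = k then w x $ i else M x $ i $ j))" for k
      by (rule continuous_on_det)
    have "continuous_on S (\<lambda>x. det (M x))"
      by (intro continuous_on_det continuous_intros M)
    with num show ?thesis
      using det by (intro continuous_on_vec_lambda continuous_on_divide) auto
  qed
  ultimately show ?thesis
    by (subst continuous_on_cong) auto
qed

text \<open>Links the gauge integral of the fundamental theorem of calculus with the Lebesgue
  integral defining the length of a curve. If the right side is infinite there is nothing to show;
  otherwise \<open>f\<close> is absolutely integrable and the two integrals agree.\<close>

lemma has_integral_le_nn_integral:
  fixes f :: "real \<Rightarrow> real"
  assumes I: "(f has_integral I) {a..b}"
  shows "ennreal \<bar>I\<bar> \<le> (\<integral>\<^sup>+x. indicator {a..b} x * ennreal \<bar>f x\<bar> \<partial>lborel)"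
proof (cases "(\<integral>\<^sup>+x. indicator {a..b} x * ennreal \<bar>f x\<bar> \<partial>lborel) = \<infinity>")
  case False
  let ?g = "\<lambda>x. indicator {a..b} x * f x"
  have m: "?g \<in> borel_measurable lebesgue"
    using has_integral_implies_lebesgue_measurable[OF I] by simp
  have eq: "(\<integral>\<^sup>+x. ennreal (norm (?g x)) \<partial>lebesgue) = (\<integral>\<^sup>+x. indicator {a..b} x * ennreal \<bar>f x\<bar> \<partial>lborel)"
    unfolding nn_integral_completion by (intro nn_integral_cong) (auto simp: indicator_def)
  have int: "integrable lebesgue ?g"
    using m eq False by (intro integrableI_bounded) (auto simp: less_top)
  then have "set_integrable lebesgue {a..b} f"
    by (simp add: set_integrable_def)
  then have "(f has_integral (LINT x:{a..b}|lebesgue. f x)) {a..b}"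
    by (rule has_integral_set_lebesgue)
  then have "I = (\<integral>x. ?g x \<partial>lebesgue)"
    using has_integral_unique[OF I] by (simp add: set_lebesgue_integral_def)
  then have "ennreal \<bar>I\<bar> \<le> (\<integral>\<^sup>+x. ennreal (norm (?g x)) \<partial>lebesgue)"
    using integral_norm_bound_ennreal[OF int] by simp
  then show ?thesis unfolding eq .
qed simp

lemma closed_subset_compact:
  fixes S :: "'b::t2_space set"
  assumes "compact K" "closed S" "S \<subseteq> K"
  shows "compact S"
  using compact_Int_closed[OF assms(1,2)] assms(3) by (simp add: inf_absorb2)

context riem_atlas
begin

section \<open>Regularity and algebra of test functions\<close>

lemma test_mdifferentiable:
  assumes "u \<in> test_functions A"
  shows "mdifferentiable u p"
proof -
  have "smooth_map_on (coord (chart_at A p) ` dom (chart_at A p)) (u \<circ> coord_inv (chart_at A p))"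
    using assms chart_at by (simp add: test_functions_def)
  then show ?thesis
    unfolding mdifferentiable_def mdiff_def
    by (rule smooth_map_on_differentiable) (use chart_at in auto)
qed

lemma continuous_on_UNIV_by_charts:
  assumes "\<And>c. c \<in> A \<Longrightarrow> continuous_on (dom c) h"
  shows "continuous_on UNIV h"
proof -
  have "isCont h p" for p
    using assms[OF chart_at(1)[of p]] open_dom[OF chart_at(1)[of p]] chart_at(2)[of p]
    by (auto simp: continuous_on_eq_continuous_at)
  then show ?thesis
    by (simp add: continuous_at_imp_continuous_on)
qed

lemma continuous_on_dom_by_coord:
  assumes "c \<in> A" "continuous_on (coord c ` dom c) h"
  shows "continuous_on (dom c) (\<lambda>p. h (coord c p))"
  by (rule continuous_on_compose2[OF assms(2) continuous_coord[OF assms(1)]]) simp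

lemma continuous_gram: "c \<in> A \<Longrightarrow> continuous_on (dom c) (gram c)"
  using continuous_on_dom_by_coord[OF _ smooth_map_on_continuous[OF gram_smooth]]
  by (rule continuous_on_eq) (auto simp: coord_inv_coord)

lemma test_continuous:
  assumes "u \<in> test_functions A"
  shows "continuous_on UNIV u"
proof (rule continuous_on_UNIV_by_charts)
  fix c assume c: "c \<in> A"
  then have "smooth_map_on (coord c ` dom c) (u \<circ> coord_inv c)"
    using assms by (simp add: test_functions_def)
  from continuous_on_dom_by_coord[OF c smooth_map_on_continuous[OF this]]
  show "continuous_on (dom c) u"
    by (rule continuous_on_eq) (auto simp: coord_inv_coord c)
qed

lemma test_grad_continuous:
  assumes "u \<in> test_functions A"
  shows "continuous_on UNIV (grad_norm A u)"
proof (rule continuous_on_UNIV_by_charts)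
  fix c assume c: "c \<in> A"
  then have s: "smooth_map_on (coord c ` dom c) (u \<circ> coord_inv c)"
    using assms by (simp add: test_functions_def)
  have "continuous_on (dom c) (covec c u)"
    unfolding covec_def
    by (intro continuous_intros continuous_on_dom_by_coord[OF c] smooth_map_on_continuous[OF smooth_map_on_deriv[OF s]])
  then have w: "continuous_on (dom c) (\<lambda>p. matrix_inv (gram c p) *v covec c u p)"
    by (intro continuous_on_matrix_inv_mult continuous_gram c gram_invertible)
  have "continuous_on (dom c) (\<lambda>p. dual_norm c p (covec c u p))"
    unfolding dual_norm_def gnorm_def matrix_vector_mult_def[of "gram c _"]
    by (intro continuous_intros w continuous_gram c)
  then show "continuous_on (dom c) (grad_norm A u)"
  proof (rule continuous_on_eq)
    fix p assume "p \<in> dom c"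
    then show "dual_norm c p (covec c u p) = grad_norm A u p"
      using test_mdifferentiable[OF assms, of p] by (simp add: grad_norm_chart[OF c] mdifferentiable_chart[OF c])
  qed
qed

lemma test_add:
  assumes "u \<in> test_functions A" "v \<in> test_functions A"
  shows "(\<lambda>x. u x + v x) \<in> test_functions A"
proof -
  have "{x. u x + v x \<noteq> 0} \<subseteq> {x. u x \<noteq> 0} \<union> {x. v x \<noteq> 0}"
    by auto
  from closure_mono[OF this]
  have "closure {x. u x + v x \<noteq> 0} \<subseteq> closure {x. u x \<noteq> 0} \<union> closure {x. v x \<noteq> 0}"
    by (simp add: closure_Un)
  moreover have "compact (closure {x. u x \<noteq> 0} \<union> closure {x. v x \<noteq> 0})"
    using assms by (intro compact_Un) (auto simp: test_functions_def compactly_supported_def)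
  ultimately have "compactly_supported (\<lambda>x. u x + v x)"
    unfolding compactly_supported_def using closed_subset_compact closed_closure by blast
  moreover have "smooth_map_on (coord c ` dom c) ((\<lambda>x. u x + v x) \<circ> coord_inv c)" if c: "c \<in> A" for c
    using assms c unfolding test_functions_def smooth_map_on_def o_def
    by (intro allI ck_on_add[OF open_coord[OF c]]) auto
  ultimately show ?thesis
    by (simp add: test_functions_def)
qed

lemma test_scale:
  assumes "u \<in> test_functions A"
  shows "(\<lambda>x. k * u x) \<in> test_functions A"
proof -
  have "closure {x. k * u x \<noteq> 0} \<subseteq> closure {x. u x \<noteq> 0}"
    by (rule closure_mono) auto
  then have "compactly_supported (\<lambda>x. k * u x)"
    using assms closed_subset_compact[OF _ closed_closure]
    unfolding compactly_supported_def test_functions_def by blast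
  moreover have "smooth_map_on (coord c ` dom c) ((\<lambda>x. k * u x) \<circ> coord_inv c)" if c: "c \<in> A" for c
    using assms c unfolding test_functions_def smooth_map_on_def o_def
    by (intro allI ck_on_bounded_linear_compose[OF open_coord[OF c] bounded_linear_mult_right]) auto
  ultimately show ?thesis
    by (simp add: test_functions_def)
qed

lemma test_diff:
  assumes "u \<in> test_functions A" "v \<in> test_functions A"
  shows "(\<lambda>x. u x - v x) \<in> test_functions A"
  using test_add[OF assms(1) test_scale[OF assms(2), of "-1"]] by simp

lemma compact_supported_bounded:
  fixes h :: "'a \<Rightarrow> real"
  assumes "continuous_on UNIV h" "compact K" "\<And>x. x \<notin> K \<Longrightarrow> h x = 0"
  obtains B where "B > 0" "\<And>x. \<bar>h x\<bar> \<le> B"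
proof -
  have "bounded (h ` K)"
    using assms compact_continuous_image compact_imp_bounded continuous_on_subset by (metis subset_UNIV)
  then obtain B where B: "B > 0" "\<And>y. y \<in> h ` K \<Longrightarrow> norm y \<le> B"
    unfolding bounded_pos by blast
  have "\<bar>h x\<bar> \<le> B" for x
    using B assms(3)[of x] by (cases "x \<in> K") auto
  then show thesis using that B(1) by blast
qed

lemma test_grad_bounded:
  assumes "u \<in> test_functions A"
  obtains B where "B > 0" "\<And>p. grad_norm A u p \<le> B"
proof -
  have "compact (closure {x. u x \<noteq> 0})"
    using assms by (simp add: test_functions_def compactly_supported_def)
  then obtain B where "B > 0" "\<And>x. \<bar>grad_norm A u x\<bar> \<le> B"
    using compact_supported_bounded[OF test_grad_continuous[OF assms]] grad_norm_zero_outside_support(1) by metis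
  then show thesis
    using that[of B] abs_le_D1 by blast
qed

subsection \<open>Comparison with the distance\<close>

text \<open>By the chain rule the derivative of \<open>u\<close> along \<open>\<gamma>\<close> is
  the pairing of its differential with the velocity, so it is at most \<open>L\<close> times the
  speed. Integration uses the fundamental theorem with finitely many exceptional points.\<close>

lemma curve_length_bound:
  assumes u: "u \<in> test_functions A" and L: "L > 0" "\<And>p. grad_norm A u p \<le> L"
    and \<gamma>: "pw_C1_curve A \<gamma>"
  shows "ennreal (\<bar>u (\<gamma> 1) - u (\<gamma> 0)\<bar> / L) \<le> curve_length A \<gamma>"
proof -
  obtain S where cont: "continuous_on {0..1} \<gamma>" and S: "finite S"
    "\<And>c. c \<in> A \<Longrightarrow> (coord c \<circ> \<gamma>) C1_differentiable_on ({0..1} \<inter> \<gamma> -` dom c - S)"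
    using \<gamma> unfolding pw_C1_curve_def path_def by blast
  have der: "\<exists>D. ((u \<circ> \<gamma>) has_vector_derivative D) (at t) \<and> \<bar>D\<bar> \<le> L * curve_speed A \<gamma> t"
    if t: "t \<in> {0<..<1} - S" for t
  proof -
    define c where "c = chart_at A (\<gamma> t)"
    note c = chart_at[of "\<gamma> t", folded c_def]
    define v where "v = vector_derivative (coord c \<circ> \<gamma>) (at t)"
    have v: "((coord c \<circ> \<gamma>) has_vector_derivative v) (at t)"
    proof -
      have "t \<in> {0..1} \<inter> \<gamma> -` dom c - S"
        using t c(2) by auto
      then obtain D where "((coord c \<circ> \<gamma>) has_vector_derivative D) (at t)"
        using S(2)[OF c(1)] unfolding C1_differentiable_on_def by blast
      then show ?thesis
        unfolding v_def using vector_derivative_works differentiableI_vector by blast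
    qed
    have m: "mdiff c u (\<gamma> t)"
      using test_mdifferentiable[OF u, of "\<gamma> t"] mdifferentiable_chart[OF c, of u] by simp
    have "((u \<circ> coord_inv c) has_derivative (\<lambda>v. covec c u (\<gamma> t) \<bullet> v)) (at ((coord c \<circ> \<gamma>) t))"
      using covec_has_derivative[OF m] by simp
    from has_derivative_compose[OF v[unfolded has_vector_derivative_def] this]
    have "((\<lambda>s. (u \<circ> coord_inv c) ((coord c \<circ> \<gamma>) s)) has_vector_derivative (covec c u (\<gamma> t) \<bullet> v)) (at t)"
      by (simp add: has_vector_derivative_def)
    moreover have o: "open ({0<..<1} \<inter> \<gamma> -` dom c)"
      using continuous_on_subset[OF cont, of "{0<..<1}"] open_dom[OF c(1)]
      by (intro continuous_open_preimage) (auto simp: greaterThanLessThan_subseteq_atLeastAtMost_iff)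
    ultimately have "((u \<circ> \<gamma>) has_vector_derivative (covec c u (\<gamma> t) \<bullet> v)) (at t)"
      by (rule has_vector_derivative_transform_within_open) (use t c coord_inv_coord in auto)
    moreover have "\<bar>covec c u (\<gamma> t) \<bullet> v\<bar> \<le> L * curve_speed A \<gamma> t"
    proof -
      have "\<bar>covec c u (\<gamma> t) \<bullet> v\<bar> \<le> grad_norm A u (\<gamma> t) * gnorm c (\<gamma> t) v"
        using dual_norm_pairing[OF c] m by (simp add: grad_norm_chart[OF c])
      also have "\<dots> \<le> L * gnorm c (\<gamma> t) v"
        by (intro mult_right_mono L gnorm_nonneg c)
      also have "gnorm c (\<gamma> t) v = curve_speed A \<gamma> t"
        by (simp add: curve_speed_def Let_def gnorm_def c_def v_def)
      finally show ?thesis .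
    qed
    ultimately show ?thesis by blast
  qed
  then obtain D where D: "\<And>t. t \<in> {0<..<1} - S \<Longrightarrow> ((u \<circ> \<gamma>) has_vector_derivative D t) (at t)"
    "\<And>t. t \<in> {0<..<1} - S \<Longrightarrow> \<bar>D t\<bar> \<le> L * curve_speed A \<gamma> t"
    by metis
  have "continuous_on {0..1} (u \<circ> \<gamma>)"
    using cont test_continuous[OF u] by (metis continuous_on_compose continuous_on_subset subset_UNIV)
  then have "(D has_integral ((u \<circ> \<gamma>) 1 - (u \<circ> \<gamma>) 0)) {0..1}"
    using fundamental_theorem_of_calculus_interior_strong[OF S(1), of 0 1 "u \<circ> \<gamma>" D] D(1) by simp
  from has_integral_mult_right[OF this, of "1 / L"]
  have "((\<lambda>t. D t / L) has_integral ((u (\<gamma> 1) - u (\<gamma> 0)) / L)) {0..1}"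
    by simp
  from has_integral_le_nn_integral[OF this]
  have "ennreal (\<bar>u (\<gamma> 1) - u (\<gamma> 0)\<bar> / L) \<le> (\<integral>\<^sup>+t. indicator {0..1} t * ennreal \<bar>D t / L\<bar> \<partial>lborel)"
    using L(1) by simp
  also have "\<dots> \<le> (\<integral>\<^sup>+t. indicator {0..1} t * ennreal (curve_speed A \<gamma> t) \<partial>lborel)"
  proof (rule nn_integral_mono_AE)
    \<comment> \<open>At the exceptional points and at the two ends \<open>D\<close> carries no
      information; they form a null set.\<close>
    have "AE t in lborel. t \<notin> S \<union> {0, 1}"
      by (intro AE_not_in finite_imp_null_set_lborel) (use S(1) in auto)
    then show "AE t in lborel. indicator {0..1} t * ennreal \<bar>D t / L\<bar> \<le> indicator {0..1} t * ennreal (curve_speed A \<gamma> t)"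
    proof eventually_elim
      case (elim t)
      show ?case
      proof (cases "t \<in> {0..1}")
        case True
        then have "\<bar>D t / L\<bar> \<le> curve_speed A \<gamma> t"
          using D(2)[of t] elim L(1) by (auto simp: field_simps)
        then show ?thesis
          by (intro mult_left_mono ennreal_leI) auto
      qed simp
    qed
  qed
  finally show ?thesis
    unfolding curve_length_def .
qed

end

locale riem_man = riem_atlas A
  for A :: "('a::metric_space, 'n::finite) riem_chart set" +
  assumes dist: "\<And>p q. ennreal (dist p q) = riemannian_distance A p q"
begin

text \<open>Makes the Poincare inequality applicable to test functions: the length bound holds for
  every admissible curve, and the distance is the infimum of the lengths.\<close>

lemma test_lipschitz:
  assumes u: "u \<in> test_functions A"
  shows "lipschitz u"
proof -
  obtain L where L: "L > 0" "\<And>p. grad_norm A u p \<le> L"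
    using test_grad_bounded[OF u] by blast
  have "\<bar>u q - u p\<bar> / L \<le> dist p q" for p q
  proof -
    have "ennreal (\<bar>u q - u p\<bar> / L) \<le> riemannian_distance A p q"
      unfolding riemannian_distance_def
      using curve_length_bound[OF u L] by (intro INF_greatest) (auto simp: pathstart_def pathfinish_def)
    then show ?thesis
      by (simp add: dist[symmetric])
  qed
  then have "\<bar>u q - u p\<bar> \<le> L * dist p q" for p q
    using L(1) by (simp add: field_simps)
  then have "L-lipschitz_on UNIV u"
    using L(1) by (intro lipschitz_onI) (simp_all add: dist_real_def dist_commute)
  then show ?thesis
    unfolding lipschitz_def by blast
qed

text \<open>The coordinate segment from \<open>x\<close> to \<open>y\<close> stays in the convex
  ball, and its image is an admissible curve. On the compact image of the closed ball the metric is
  at most \<open>l\<close> times the Euclidean norm, so the length is at most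
  \<open>l * norm (x - y)\<close>.\<close>

lemma dist_coord_inv_le:
  assumes c: "c \<in> A" and x0: "x0 \<in> coord c ` dom c"
  obtains e B where "e > 0" "ball x0 e \<subseteq> coord c ` dom c"
    "\<And>x y. x \<in> ball x0 e \<Longrightarrow> y \<in> ball x0 e \<Longrightarrow> dist (coord_inv c x) (coord_inv c y) \<le> B * norm (x - y)"
proof -
  obtain e where e: "e > 0" "cball x0 e \<subseteq> coord c ` dom c"
    using open_coord[OF c] x0 open_contains_cball by blast
  have "compact (coord_inv c ` cball x0 e)" "coord_inv c ` cball x0 e \<subseteq> dom c"
    using compact_continuous_image[OF continuous_on_subset[OF continuous_coord_inv[OF c] e(2)] compact_cball]
      coord_inv_in[OF c] e(2) by auto
  then obtain l where l: "l > 0" "\<And>p v. p \<in> coord_inv c ` cball x0 e \<Longrightarrow> gnorm c p v \<le> l * norm v"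
    using gnorm_comparable[OF c] by metis
  have "dist (coord_inv c x) (coord_inv c y) \<le> l * norm (x - y)" if xy: "x \<in> ball x0 e" "y \<in> ball x0 e" for x y
  proof -
    define line where "line = (\<lambda>t::real. x + t *\<^sub>R (y - x))"
    define \<gamma> where "\<gamma> = coord_inv c \<circ> line"
    have line_in: "line t \<in> ball x0 e" if "t \<in> {0..1}" for t
    proof -
      have "line t = (1 - t) *\<^sub>R x + t *\<^sub>R y"
        by (simp add: line_def algebra_simps)
      then show ?thesis
        using convexD_alt[OF convex_ball xy, of t] that by simp
    qed
    have line_V: "line t \<in> coord c ` dom c" if "t \<in> {0..1}" for t
      using line_in[OF that] e(2) ball_subset_cball by blast
    have coord_\<gamma>: "coord c (\<gamma> t) = line t" "\<gamma> t \<in> dom c" if "t \<in> {0..1}" for t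
      using coord_coord_inv[OF c line_V[OF that]] coord_inv_in[OF c line_V[OF that]] by (simp_all add: \<gamma>_def)
    have line_c: "continuous_on S line" for S
      unfolding line_def by (intro continuous_intros)
    have line_d: "(line has_vector_derivative (y - x)) (at t)" for t
      unfolding line_def by (auto intro!: derivative_eq_intros)
    have overlap: "line t \<in> coord c ` (dom c \<inter> dom d)" if "t \<in> {0..1}" "\<gamma> t \<in> dom d" for t d
      using coord_\<gamma>[OF that(1)] that(2) by (metis IntI image_eqI)
    \<comment> \<open>Other charts are needed too: admissibility is required in all of them, and the
      speed is computed in the chart picked by \<open>chart_at\<close>.\<close>
    have d\<gamma>: "((coord d \<circ> \<gamma>) has_vector_derivative frechet_derivative (transition c d) (at (line t)) (y - x)) (at t)"
      if "d \<in> A" "t \<in> {0..1}" "\<gamma> t \<in> dom d" for d t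
    proof -
      have "(transition c d has_derivative frechet_derivative (transition c d) (at (line t))) (at (line t))"
        using smooth_map_on_differentiable[OF transition_smooth[OF c that(1)] overlap[OF that(2,3)]]
        by (rule frechet_has_derivative)
      then have "((transition c d \<circ> line) has_vector_derivative frechet_derivative (transition c d) (at (line t)) (y - x)) (at t)"
        using vector_derivative_diff_chain_within[where S = UNIV, OF line_d[of t] has_derivative_at_withinI] by blast
      then show ?thesis
        by (simp add: \<gamma>_def transition_def o_assoc)
    qed
    have "pw_C1_curve A \<gamma>"
      unfolding pw_C1_curve_def
    proof (intro conjI exI[of _ "{}"] ballI)
      show "path \<gamma>"
        unfolding path_def \<gamma>_def
        by (rule continuous_on_compose[OF line_c continuous_on_subset[OF continuous_coord_inv[OF c]]])
          (use line_V in auto)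
      fix d assume d: "d \<in> A"
      have "continuous_on ({0..1} \<inter> \<gamma> -` dom d) (\<lambda>t. frechet_derivative (transition c d) (at (line t)) (y - x))"
        by (rule continuous_on_compose2[OF smooth_map_on_continuous[OF smooth_map_on_deriv[OF transition_smooth[OF c d]]] line_c])
          (blast intro: overlap)
      then show "coord d \<circ> \<gamma> C1_differentiable_on {0..1} \<inter> \<gamma> -` dom d - {}"
        unfolding C1_differentiable_on_def
        using d\<gamma>[OF d] by (intro exI[of _ "\<lambda>t. frechet_derivative (transition c d) (at (line t)) (y - x)"]) auto
    qed simp
    then have "riemannian_distance A (\<gamma> 0) (\<gamma> 1) \<le> curve_length A \<gamma>"
      unfolding riemannian_distance_def by (intro INF_lower) (simp add: pathstart_def pathfinish_def)
    also have "curve_length A \<gamma> \<le> (\<integral>\<^sup>+ t. ennreal (l * norm (y - x)) * indicator {0..1::real} t \<partial>lborel)"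
      unfolding curve_length_def
    proof (rule nn_integral_mono)
      fix t :: real
      have "curve_speed A \<gamma> t \<le> l * norm (y - x)" if t: "t \<in> {0..1}"
      proof -
        define d where "d = chart_at A (\<gamma> t)"
        note d = chart_at[of "\<gamma> t", folded d_def]
        have "vector_derivative (coord d \<circ> \<gamma>) (at t) = jacobian (transition c d) (at (coord c (\<gamma> t))) *v (y - x)"
          using vector_derivative_at[OF d\<gamma>[OF d(1) t d(2)]]
            frechet_derivative_at[OF transition_has_derivative[OF c d(1) coord_\<gamma>(2)[OF t] d(2)]]
          by (simp add: coord_\<gamma>(1)[OF t])
        then have "curve_speed A \<gamma> t = gnorm c (\<gamma> t) (y - x)"
          using gnorm_transform[OF c d(1) coord_\<gamma>(2)[OF t] d(2)]
          by (simp add: curve_speed_def Let_def gnorm_def d_def)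
        moreover have "\<gamma> t \<in> coord_inv c ` cball x0 e"
          using line_in[OF t] by (auto simp: \<gamma>_def)
        ultimately show ?thesis
          using l(2) by simp
      qed
      then show "indicator {0..1} t * ennreal (curve_speed A \<gamma> t) \<le> ennreal (l * norm (y - x)) * indicator {0..1} t"
        by (auto simp: indicator_def intro: ennreal_leI)
    qed
    also have "\<dots> = ennreal (l * norm (y - x))"
      by (simp add: nn_integral_cmult_indicator)
    finally have "ennreal (dist (\<gamma> 0) (\<gamma> 1)) \<le> ennreal (l * norm (y - x))"
      by (simp add: dist)
    moreover have "\<gamma> 0 = coord_inv c x" "\<gamma> 1 = coord_inv c y"
      by (simp_all add: \<gamma>_def line_def)
    ultimately show ?thesis
      using l(1) by (simp add: norm_minus_commute)
  qed
  then show thesis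
    using that[of e l] e ball_subset_cball by blast
qed

end

section \<open>The Riemannian measure\<close>

text \<open>The segment from the identity to \<open>M\<close> consists of positive definite, hence
  invertible, matrices. The determinant starts at 1 and cannot vanish on the way.\<close>

lemma det_pos_of_positive_definite:
  fixes M :: "real ^ 'n ^ 'n"
  assumes "\<And>v. v \<noteq> 0 \<Longrightarrow> v \<bullet> (M *v v) > 0"
  shows "det M > 0"
proof (rule ccontr)
  assume "\<not> det M > 0"
  define P where "P = (\<lambda>t::real. (1 - t) *\<^sub>R mat 1 + t *\<^sub>R M)"
  have "continuous_on {0..1} (\<lambda>t. det (P t))"
    unfolding P_def det_def by (intro continuous_intros)
  moreover have "det (P 0) = 1" "det (P 1) = det M"
    by (simp_all add: P_def)
  ultimately obtain t where t: "0 \<le> t" "t \<le> 1" "det (P t) = 0"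
    using IVT2'[of "\<lambda>t. det (P t)" 1 0 0] \<open>\<not> det M > 0\<close> by auto
  have "v = 0" if "P t *v v = 0" for v
  proof (rule ccontr)
    assume v: "v \<noteq> 0"
    have "P t *v v = (1 - t) *\<^sub>R v + t *\<^sub>R (M *v v)"
      by (simp add: P_def matrix_vector_mult_add_rdistrib scaleR_matrix_vector_assoc[symmetric])
    then have "v \<bullet> (P t *v v) = (1 - t) * (v \<bullet> v) + t * (v \<bullet> (M *v v))"
      by (simp add: inner_add_right)
    moreover have "v \<bullet> v > 0" using v by simp
    ultimately have "v \<bullet> (P t *v v) > 0"
      using t assms[OF v] by (cases "t = 0") (auto intro: add_nonneg_pos)
    then show False using that by simp
  qed
  then have "invertible (P t)"
    by (simp add: invertible_left_inverse matrix_left_invertible_ker)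
  then show False
    using t(3) by (simp add: invertible_det_nz)
qed

locale riem_meas = riem_man A
  for A :: "('a::{metric_space, second_countable_topology}, 'n::finite) riem_chart set" +
  fixes \<mu> :: "'a measure"
  assumes meas: "riemannian_measure A \<mu>" and compl: "complete (UNIV :: 'a set)" and doubl: "doubling \<mu>"
begin

lemma sets_\<mu> [simp, measurable_cong]: "sets \<mu> = sets borel"
  using meas by (simp add: riemannian_measure_def)

lemma space_\<mu> [simp]: "space \<mu> = UNIV"
  using sets_eq_imp_space_eq[OF sets_\<mu>] by simp

lemma emeasure_in_chart:
  assumes "c \<in> A" "B \<in> sets borel" "B \<subseteq> dom c"
  shows "emeasure \<mu> B =
    (\<integral>\<^sup>+ x. indicator (coord c ` B) x * ennreal (sqrt (det (gram c (coord_inv c x)))) \<partial>lborel)"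
  using meas assms by (simp add: riemannian_measure_def)

text \<open>In a chart \<open>\<mu>\<close> has a density with respect to Lebesgue measure, so it
  has at least the null sets of the latter. This carries Rademacher's theorem to the
  manifold.\<close>

lemma AE_chart:
  assumes c: "c \<in> A" and P: "AE x in lborel. P x"
  shows "AE p in \<mu>. p \<in> dom c \<longrightarrow> P (coord c p)"
proof -
  obtain N where N: "{x. \<not> P x} \<subseteq> N" "N \<in> sets lborel" "emeasure lborel N = 0"
  proof (rule AE_E[OF P])
    fix N assume "{x \<in> space lborel. \<not> P x} \<subseteq> N" "emeasure lborel N = 0" "N \<in> sets lborel"
    then show thesis
      by (intro that[of N]) simp_all
  qed
  define B where "B = dom c \<inter> coord c -` N"
  \<comment> \<open>The chart is extended by 0 to a Borel function on the whole space, of which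
    preimages can be taken.\<close>
  have "(\<lambda>p. if p \<in> dom c then coord c p else 0) \<in> borel_measurable borel"
    by (rule borel_measurable_continuous_on_if[OF _ continuous_coord[OF c]]) (use open_dom[OF c] in auto)
  then have "dom c \<inter> ((\<lambda>p. if p \<in> dom c then coord c p else 0) -` N \<inter> space borel) \<in> sets borel"
    using N(2) open_dom[OF c] by (intro sets.Int measurable_sets) auto
  moreover have "dom c \<inter> ((\<lambda>p. if p \<in> dom c then coord c p else 0) -` N \<inter> space borel) = B"
    by (auto simp: B_def)
  ultimately have B: "B \<in> sets borel" by simp
  have "emeasure \<mu> B \<le> (\<integral>\<^sup>+ x. 0 \<partial>(lborel :: (real ^ 'n) measure))"
    unfolding emeasure_in_chart[OF c B, unfolded B_def, simplified, folded B_def]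
  proof (rule nn_integral_mono_AE)
    have "AE x in lborel. x \<notin> N"
      using N(2,3) by (intro AE_not_in) (auto simp: null_sets_def)
    then show "AE x in lborel. indicator (coord c ` B) x * ennreal (sqrt (det (gram c (coord_inv c x)))) \<le> 0"
      by eventually_elim (auto simp: B_def indicator_def)
  qed
  then have "B \<in> null_sets \<mu>"
    using B by (intro null_setsI) auto
  then have "AE p in \<mu>. p \<notin> B"
    by (rule AE_not_in)
  then show ?thesis
    by eventually_elim (use N(1) in \<open>auto simp: B_def\<close>)
qed

text \<open>On a compact coordinate ball the density \<open>w\<close> lies between two positive
  constants. This rules out locally that \<open>\<mu>\<close> vanishes or is infinite, neither of
  which contradicts doubling.\<close>

lemma small_open_set:
  assumes r: "r > 0"
  obtains U where "open U" "x \<in> U" "U \<subseteq> ball x r" "0 < emeasure \<mu> U" "emeasure \<mu> U < \<infinity>"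
proof -
  define c where "c = chart_at A x"
  note c = chart_at[of x, folded c_def]
  have o: "open (coord c ` (dom c \<inter> ball x r))"
    by (intro open_coord_image c open_Int open_dom) auto
  obtain e where e: "e > 0" "cball (coord c x) e \<subseteq> coord c ` (dom c \<inter> ball x r)"
  proof -
    have "coord c x \<in> coord c ` (dom c \<inter> ball x r)"
      using c(2) r by auto
    then show thesis
      using o that open_contains_cball by meson
  qed
  define U where "U = dom c \<inter> coord c -` ball (coord c x) e"
  have oU: "open U"
    unfolding U_def by (rule continuous_open_preimage[OF continuous_coord[OF c(1)] open_dom[OF c(1)]]) simp
  have eV: "cball (coord c x) e \<subseteq> coord c ` dom c"
    using e(2) by auto
  have imU: "coord c ` U = ball (coord c x) e"
    using eV ball_subset_cball[of "coord c x" e] unfolding U_def by (force simp: image_iff)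
  have UB: "U \<subseteq> ball x r"
  proof
    fix p assume p: "p \<in> U"
    then have "coord c p \<in> coord c ` (dom c \<inter> ball x r)"
      using imU e(2) ball_subset_cball by blast
    then obtain q where "q \<in> dom c" "q \<in> ball x r" "coord c p = coord c q" by auto
    then show "p \<in> ball x r"
      using coord_inv_coord[OF c(1)] p unfolding U_def by (metis IntD1)
  qed
  define w where "w = (\<lambda>y. sqrt (det (gram c (coord_inv c y))))"
  have "continuous_on (coord c ` dom c) (gram c \<circ> coord_inv c)"
    by (rule smooth_map_on_continuous[OF gram_smooth[OF c(1)]])
  then have "continuous_on (cball (coord c x) e) (\<lambda>y. gram c (coord_inv c y))"
    using eV by (auto simp: o_def intro: continuous_on_subset)
  then have wc: "continuous_on (cball (coord c x) e) w"
    unfolding w_def by (intro continuous_on_real_sqrt continuous_on_det continuous_intros)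
  have wpos: "w y > 0" if "y \<in> cball (coord c x) e" for y
    using det_pos_of_positive_definite[of "gram c (coord_inv c y)"] gram_pos[OF c(1) coord_inv_in[OF c(1)]] eV that
    unfolding w_def by auto
  have ne: "cball (coord c x) e \<noteq> {}" using e(1) by auto
  obtain a where a: "a \<in> cball (coord c x) e" "\<forall>y\<in>cball (coord c x) e. w a \<le> w y"
    using continuous_attains_inf[OF compact_cball ne wc] by blast
  obtain b where b: "b \<in> cball (coord c x) e" "\<forall>y\<in>cball (coord c x) e. w y \<le> w b"
    using continuous_attains_sup[OF compact_cball ne wc] by blast
  have em: "emeasure \<mu> U = (\<integral>\<^sup>+ y. indicator (ball (coord c x) e) y * ennreal (w y) \<partial>lborel)"
    using emeasure_in_chart[OF c(1), of U] oU imU by (simp add: w_def U_def)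
  have "emeasure \<mu> U \<le> (\<integral>\<^sup>+ y. ennreal (w b) * indicator (ball (coord c x) e) y \<partial>lborel)"
    unfolding em by (rule nn_integral_mono) (use b(2) in \<open>auto simp: indicator_def intro: ennreal_leI\<close>)
  also have "\<dots> = ennreal (w b) * emeasure lborel (ball (coord c x) e)"
    by (rule nn_integral_cmult_indicator) simp
  also have "\<dots> < \<infinity>"
    using emeasure_bounded_finite[OF bounded_ball, of "coord c x" e] by (simp add: ennreal_mult_less_top less_top del: emeasure_lborel_ball_finite)
  finally have fin: "emeasure \<mu> U < \<infinity>" .
  have "emeasure lborel (ball (coord c x) e) \<noteq> 0"
  proof
    assume "emeasure lborel (ball (coord c x) e) = 0"
    then have "negligible (ball (coord c x) e)"
      by (simp add: negligible_iff_null_sets null_sets_completionI null_setsI)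
    then show False
      using open_not_negligible[of "ball (coord c x) e"] e(1) by simp
  qed
  then have "0 < ennreal (w a) * emeasure lborel (ball (coord c x) e)"
    using wpos[OF a(1)] by (simp add: zero_less_iff_neq_zero)
  also have "\<dots> = (\<integral>\<^sup>+ y. ennreal (w a) * indicator (ball (coord c x) e) y \<partial>lborel)"
    by (rule nn_integral_cmult_indicator[symmetric]) simp
  also have "\<dots> \<le> emeasure \<mu> U"
    unfolding em by (rule nn_integral_mono) (use a(2) in \<open>auto simp: indicator_def intro: ennreal_leI\<close>)
  finally have pos: "0 < emeasure \<mu> U" .
  have "x \<in> U"
    using c(2) e(1) by (simp add: U_def)
  then show thesis
    using that[of U] oU UB pos fin by blast
qed

section \<open>Positivity and finiteness of the measure of balls\<close>

lemma emeasure_ball_pos: "r > 0 \<Longrightarrow> 0 < emeasure \<mu> (ball x r)"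
proof -
  assume "r > 0"
  then obtain U where "open U" "U \<subseteq> ball x r" "0 < emeasure \<mu> U"
    using small_open_set[of r x] by metis
  then show ?thesis
    using emeasure_mono[of U "ball x r" \<mu>] by (auto intro: order.strict_trans2)
qed

lemma doubling_constant:
  obtains D where "D \<ge> 1" "\<forall>x r. r > 0 \<longrightarrow> emeasure \<mu> (ball x (2 * r)) \<le> ennreal D * emeasure \<mu> (ball x r)"
proof -
  obtain C where C: "C > 0" "\<And>x r. r > 0 \<Longrightarrow> emeasure \<mu> (ball x (2 * r)) \<le> ennreal C * emeasure \<mu> (ball x r)"
    using doubl unfolding doubling_def by blast
  have "emeasure \<mu> (ball x (2 * r)) \<le> ennreal (max 1 C) * emeasure \<mu> (ball x r)" if "r > 0" for x r
    using C(2)[OF that, of x] by (rule order_trans) (intro mult_right_mono ennreal_leI, auto)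
  then show thesis
    using that[of "max 1 C"] by simp
qed

lemma doubling_power:
  assumes "\<forall>x r. r > 0 \<longrightarrow> emeasure \<mu> (ball x (2 * r)) \<le> ennreal D * emeasure \<mu> (ball x r)" "D \<ge> 1" "r > 0"
  shows "emeasure \<mu> (ball x (2 ^ n * r)) \<le> ennreal (D ^ n) * emeasure \<mu> (ball x r)"
proof (induction n)
  case (Suc n)
  have "emeasure \<mu> (ball x (2 ^ Suc n * r)) \<le> ennreal D * emeasure \<mu> (ball x (2 ^ n * r))"
    using assms(1)[rule_format, of "2 ^ n * r" x] assms(3) by (simp add: mult.assoc)
  also have "\<dots> \<le> ennreal D * (ennreal (D ^ n) * emeasure \<mu> (ball x r))"
    by (intro mult_left_mono Suc) simp
  finally show ?case
    using assms(2) by (simp add: ennreal_mult mult.assoc)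
qed simp

text \<open>Repeated doubling carries finiteness from a small ball inside a set of finite measure to
  the ball of radius \<open>r\<close>.\<close>

lemma emeasure_ball_finite: "emeasure \<mu> (ball x r) < \<infinity>"
proof (cases "r > 0")
  case True
  obtain D where D: "D \<ge> 1" "\<forall>x r. r > 0 \<longrightarrow> emeasure \<mu> (ball x (2 * r)) \<le> ennreal D * emeasure \<mu> (ball x r)"
    using doubling_constant by blast
  obtain U where U: "open U" "x \<in> U" "emeasure \<mu> U < \<infinity>"
    using small_open_set[of 1 x] by (metis zero_less_one)
  then obtain s where s: "s > 0" "ball x s \<subseteq> U"
    using open_contains_ball by blast
  obtain n where n: "r / s < 2 ^ n"
    using real_arch_pow[of 2 "r / s"] by auto
  then have "ball x r \<subseteq> ball x (2 ^ n * s)"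
    using s(1) by (intro subset_ball) (simp add: field_simps)
  then have "emeasure \<mu> (ball x r) \<le> emeasure \<mu> (ball x (2 ^ n * s))"
    by (intro emeasure_mono) auto
  also have "\<dots> \<le> ennreal (D ^ n) * emeasure \<mu> (ball x s)"
    by (rule doubling_power[OF D(2,1) s(1)])
  also have "\<dots> \<le> ennreal (D ^ n) * emeasure \<mu> U"
    using s U by (intro mult_left_mono emeasure_mono) auto
  also have "\<dots> < \<infinity>"
    using U(3) by (simp add: ennreal_mult_less_top)
  finally show ?thesis .
next
  case False
  then have e: "ball x r = {}" by auto
  show ?thesis unfolding e by simp
qed

lemma emeasure_ball_eq: "emeasure \<mu> (ball x r) = ennreal (measure \<mu> (ball x r))"
  using emeasure_ball_finite[of x r] by (intro emeasure_eq_ennreal_measure) auto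

lemma measure_ball_pos: "r > 0 \<Longrightarrow> measure \<mu> (ball x r) > 0"
  using emeasure_ball_pos[of r x] by (simp add: emeasure_ball_eq)

lemma measure_doubling:
  obtains D where "D \<ge> 1" "\<forall>x r n. r > 0 \<longrightarrow> measure \<mu> (ball x (2 ^ n * r)) \<le> D ^ n * measure \<mu> (ball x r)"
proof -
  obtain D where D: "D \<ge> 1" "\<forall>x r. r > 0 \<longrightarrow> emeasure \<mu> (ball x (2 * r)) \<le> ennreal D * emeasure \<mu> (ball x r)"
    using doubling_constant by blast
  have "measure \<mu> (ball x (2 ^ n * r)) \<le> D ^ n * measure \<mu> (ball x r)" if "r > 0" for x r n
    using doubling_power[OF D(2,1) that, of x n] D(1)
    by (simp add: emeasure_ball_eq ennreal_mult[symmetric])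
  then show thesis using that D(1) by blast
qed

lemma emeasure_bounded_set_finite: "bounded S \<Longrightarrow> S \<in> sets borel \<Longrightarrow> emeasure \<mu> S < \<infinity>"
proof -
  assume S: "bounded S" "S \<in> sets borel"
  then obtain x e where "S \<subseteq> cball x e"
    unfolding bounded_subset_cball by blast
  then have "S \<subseteq> ball x (e + 1)"
    by (force simp: subset_iff)
  then have "emeasure \<mu> S \<le> emeasure \<mu> (ball x (e + 1))"
    by (rule emeasure_mono) simp
  then show ?thesis
    using emeasure_ball_finite[of x "e + 1"] by (rule order.strict_trans1)
qed

text \<open>A complete space with a doubling measure is proper: disjoint balls of radius \<open>e/2\<close> in a ball of
  radius \<open>R\<close> carry a fixed proportion of its measure each, so there are boundedly many of them.\<close>

lemma compact_cball_proper: "compact (cball (x :: 'a) R)"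
  unfolding compact_eq_totally_bounded
proof (intro conjI allI impI)
  show "complete (cball x R)"
    by (rule complete_closed_subset[OF closed_cball subset_UNIV compl])
  fix e :: real assume e: "e > 0"
  \<comment> \<open>The balls of radius \<open>e / 2\<close> around points of
    \<open>cball x R\<close> all lie in \<open>ball x R'\<close>.\<close>
  define R' where "R' = \<bar>R\<bar> + e"
  obtain D where D: "D \<ge> 1" "\<forall>x r n. r > 0 \<longrightarrow> measure \<mu> (ball x (2 ^ n * r)) \<le> D ^ n * measure \<mu> (ball x r)"
    using measure_doubling by blast
  \<comment> \<open>After \<open>n\<close> doublings each of the small balls contains
    \<open>ball x R'\<close>, which gives the proportion \<open>1 / D ^ n\<close>.\<close>
  obtain n where n: "2 * R' / (e / 2) < 2 ^ n"
    using real_arch_pow[of 2 "2 * R' / (e / 2)"] by auto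
  define m where "m = measure \<mu> (ball x R')"
  have R': "R' > 0" using e by (simp add: R'_def)
  have m: "m > 0" unfolding m_def by (rule measure_ball_pos[OF R'])
  define sep where "sep = (\<lambda>F. finite F \<and> F \<subseteq> cball x R \<and> (\<forall>y\<in>F. \<forall>z\<in>F. y \<noteq> z \<longrightarrow> dist y z \<ge> e))"
  have card: "real (card F) \<le> D ^ n" if F: "sep F" for F
  proof -
    have big: "m \<le> D ^ n * measure \<mu> (ball y (e / 2))" if "y \<in> F" for y
    proof -
      have y: "dist x y \<le> R"
        using F that by (auto simp: sep_def)
      have "2 * R' \<le> 2 ^ n * (e / 2)"
        using n e by (simp add: field_simps)
      then have "ball x R' \<subseteq> ball y (2 ^ n * (e / 2))"
        using y dist_triangle[of y _ x] e unfolding R'_def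
        by (intro subsetI) (smt (verit, best) dist_commute mem_ball)
      then have "m \<le> measure \<mu> (ball y (2 ^ n * (e / 2)))"
        unfolding m_def using emeasure_ball_finite by (intro measure_mono_fmeasurable fmeasurableI) auto
      also have "\<dots> \<le> D ^ n * measure \<mu> (ball y (e / 2))"
        using D(2)[rule_format, of "e / 2" y n] e by simp
      finally show ?thesis .
    qed
    have "(\<Union>y\<in>F. ball y (e / 2)) \<subseteq> ball x R'"
    proof (clarsimp simp: R'_def)
      fix y z assume "y \<in> F" "dist y z * 2 < e"
      then show "dist x z < \<bar>R\<bar> + e"
        using F dist_triangle[of x z y] e by (auto simp: sep_def subset_iff)
    qed
    then have "measure \<mu> (\<Union>y\<in>F. ball y (e / 2)) \<le> m"
      unfolding m_def using emeasure_ball_finite by (intro measure_mono_fmeasurable fmeasurableI) (auto intro!: borel_open)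
    moreover have "measure \<mu> (\<Union>y\<in>F. ball y (e / 2)) = (\<Sum>y\<in>F. measure \<mu> (ball y (e / 2)))"
    proof (rule measure_finite_Union)
      show "finite F" using F by (simp add: sep_def)
      show "disjoint_family_on (\<lambda>y. ball y (e / 2)) F"
        unfolding disjoint_family_on_def
      proof (intro ballI impI)
        fix y z assume yz: "y \<in> F" "z \<in> F" "y \<noteq> z"
        then have "dist y z \<ge> e" using F by (auto simp: sep_def)
        then show "ball y (e / 2) \<inter> ball z (e / 2) = {}"
          by (intro disjoint_ballI) simp
      qed
    qed (use emeasure_ball_finite in \<open>auto simp: less_top\<close>)
    ultimately have "(\<Sum>y\<in>F. measure \<mu> (ball y (e / 2))) \<le> m" by simp
    then have "D ^ n * (\<Sum>y\<in>F. measure \<mu> (ball y (e / 2))) \<le> D ^ n * m"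
      using D(1) by (intro mult_left_mono) auto
    moreover have "real (card F) * m \<le> (\<Sum>y\<in>F. D ^ n * measure \<mu> (ball y (e / 2)))"
      using sum_mono[of F "\<lambda>_. m" "\<lambda>y. D ^ n * measure \<mu> (ball y (e / 2))"] big by simp
    ultimately have "real (card F) * m \<le> D ^ n * m"
      by (simp add: sum_distrib_left)
    then show ?thesis using m by simp
  qed
  \<comment> \<open>A strict bound on the cardinalities provides a separated set \<open>F\<close> of
    largest cardinality; no point can be added to it, so \<open>F\<close> is an
    \<open>e\<close>-net.\<close>
  define bd where "bd = nat \<lceil>D ^ n\<rceil> + 1"
  have "sep {}" by (simp add: sep_def)
  moreover have "\<forall>F. sep F \<longrightarrow> card F < bd"
  proof (intro allI impI)
    fix F assume "sep F"
    from card[OF this] show "card F < bd"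
      unfolding bd_def by linarith
  qed
  ultimately obtain F where F: "sep F" "\<And>G. sep G \<Longrightarrow> card G \<le> card F"
    using ex_has_greatest_nat[of sep "{}" card bd] by blast
  have "cball x R \<subseteq> (\<Union>y\<in>F. ball y e)"
  proof
    fix z assume z: "z \<in> cball x R"
    show "z \<in> (\<Union>y\<in>F. ball y e)"
    proof (rule ccontr)
      assume nz: "z \<notin> (\<Union>y\<in>F. ball y e)"
      then have "\<forall>y\<in>F. dist y z \<ge> e" by (auto simp: not_less)
      then have "sep (insert z F)"
        using F(1) z unfolding sep_def by (auto simp: dist_commute)
      moreover have "z \<notin> F" using nz e by auto
      moreover have "finite F" using F(1) by (simp add: sep_def)
      ultimately show False
        using F(2)[of "insert z F"] by simp
    qed
  qed
  moreover have "finite F"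
    using F(1) by (simp add: sep_def)
  ultimately show "\<exists>k. finite k \<and> cball x R \<subseteq> (\<Union>y\<in>k. ball y e)"
    by (intro exI[of _ F] conjI)
qed

lemma compact_of_closed_bounded:
  fixes S :: "'a set"
  assumes "closed S" "bounded S"
  shows "compact S"
proof -
  obtain x e where "S \<subseteq> cball x e"
    using assms(2) unfolding bounded_subset_cball by blast
  then show ?thesis
    by (rule closed_subset_compact[OF compact_cball_proper assms(1)])
qed

end

section \<open>Smooth approximation of Lipschitz functions\<close>

text \<open>On the ball \<open>X\<close>, which exceeds the support by a margin of 1, compactness
  gives one constant \<open>L\<close>. A point where \<open>F\<close> may be nonzero has distance at
  least 1 from the complement of \<open>X\<close>, so across the boundary a bound \<open>M\<close>
  on the values acts as a Lipschitz constant.\<close>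

lemma locally_lipschitz_bounded_support:
  fixes F :: "'v::euclidean_space \<Rightarrow> real"
  assumes loc: "\<And>x. \<exists>e>0. \<exists>B. \<forall>y\<in>ball x e. \<forall>z\<in>ball x e. \<bar>F y - F z\<bar> \<le> B * norm (y - z)"
    and supp: "\<And>x. norm x \<ge> R \<Longrightarrow> F x = 0" and R: "R > 0"
  obtains L where "L-lipschitz_on UNIV F"
proof -
  define X where "X = cball (0::'v) (R + 1)"
  \<comment> \<open>The notion is made for time-dependent maps; here time is the single point
    0.\<close>
  have "local_lipschitz {0::real} X (\<lambda>_. F)"
    unfolding local_lipschitz_def
  proof (intro ballI)
    fix x and t :: real
    obtain e B where eB: "e > 0" "\<forall>y\<in>ball x e. \<forall>z\<in>ball x e. \<bar>F y - F z\<bar> \<le> B * norm (y - z)"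
      using loc[of x] by blast
    have "(max B 0)-lipschitz_on (cball x (e / 2) \<inter> X) F"
    proof (rule lipschitz_onI)
      fix y z assume "y \<in> cball x (e / 2) \<inter> X" "z \<in> cball x (e / 2) \<inter> X"
      then have "y \<in> ball x e" "z \<in> ball x e"
        using eB(1) by auto
      then have "\<bar>F y - F z\<bar> \<le> B * norm (y - z)"
        using eB(2) by blast
      also have "\<dots> \<le> max B 0 * norm (y - z)"
        by (intro mult_right_mono) auto
      finally show "dist (F y) (F z) \<le> max B 0 * dist y z"
        by (simp add: dist_norm)
    qed simp
    then show "\<exists>u>0. \<exists>L. \<forall>t\<in>cball t u \<inter> {0}. L-lipschitz_on (cball x u \<inter> X) F"
      using eB(1) by (intro exI[of _ "e / 2"]) auto
  qed
  then obtain L where L: "L-lipschitz_on X F"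
    using local_lipschitz_compact_implies_lipschitz[where X = X and T = "{0::real}" and f = "\<lambda>_. F"] unfolding X_def by auto
  note L0 = lipschitz_on_nonneg[OF L]
  \<comment> \<open>Comparison with a point \<open>z\<close> of norm \<open>R + 1\<close>, where
    \<open>F\<close> vanishes: two points of \<open>X\<close> are at most \<open>2 * R + 2\<close>
    apart.\<close>
  define M where "M = L * (2 * R + 2)"
  have M: "\<bar>F x\<bar> \<le> M" if "x \<in> X" for x
  proof -
    obtain b :: 'v where b: "norm b = 1"
      using vector_choose_size[of 1] by auto
    define z where "z = (R + 1) *\<^sub>R b"
    have z: "norm z = R + 1" using b R by (simp add: z_def)
    have "dist (F x) (F z) \<le> L * dist x z"
      using L that z by (intro lipschitz_onD[OF L]) (auto simp: X_def)
    also have "dist x z \<le> 2 * R + 2"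
      using norm_triangle_ineq4[of x z] z that by (simp add: X_def dist_norm)
    finally show ?thesis
      using supp[of z] z L0 by (simp add: M_def mult_left_mono)
  qed
  have M0: "M \<ge> 0"
    using M[of 0] R by (simp add: X_def)
  have cross: "\<bar>F x - F y\<bar> \<le> M * norm (x - y)" if "x \<in> X" "y \<notin> X" for x y
  proof (cases "norm x \<ge> R")
    case True
    then show ?thesis
      using supp[of x] supp[of y] that(2) M0 by (simp add: X_def)
  next
    case False
    have "norm (x - y) \<ge> 1"
      using False that(2) norm_triangle_ineq2[of y x] by (simp add: X_def norm_minus_commute)
    then have "M * 1 \<le> M * norm (x - y)"
      using M0 by (rule mult_left_mono)
    then show ?thesis
      using M[OF that(1)] supp[of y] that(2) by (simp add: X_def)
  qed
  have "(L + M)-lipschitz_on UNIV F"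
  proof (rule lipschitz_onI)
    fix x y :: 'v
    have le: "a * norm (x - y) \<le> (L + M) * norm (x - y)" if "a \<le> L + M" for a
      using that by (intro mult_right_mono) auto
    consider "x \<in> X" "y \<in> X" | "x \<in> X" "y \<notin> X" | "x \<notin> X" "y \<in> X" | "x \<notin> X" "y \<notin> X" by blast
    then show "dist (F x) (F y) \<le> (L + M) * dist x y"
    proof cases
      case 1
      then show ?thesis
        using lipschitz_onD[OF L 1] le[of L] M0 by (simp add: dist_norm)
    next
      case 2
      then show ?thesis
        using cross[OF 2] le[of M] L0 by (simp add: dist_norm)
    next
      case 3
      then show ?thesis
        using cross[OF 3(2,1)] le[of M] L0 by (simp add: dist_norm norm_minus_commute abs_minus_commute)
    next
      case 4
      then show ?thesis
        using supp[of x] supp[of y] L0 M0 by (simp add: X_def)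
    qed
  qed (use L0 M0 in simp)
  then show thesis using that by blast
qed

lemma lipschitz_derivative_bound:
  fixes F :: "'v::real_normed_vector \<Rightarrow> real"
  assumes lip: "L-lipschitz_on UNIV F" and D: "(F has_derivative D) (at x)"
  shows "\<bar>D v\<bar> \<le> L * norm v"
proof (rule field_le_epsilon)
  fix e :: real assume e: "e > 0"
  define e' where "e' = e / (norm v + 1)"
  have nv: "norm v + 1 > 0"
    using norm_ge_zero[of v] by linarith
  have e': "e' > 0" "e' * norm v \<le> e"
    using e nv by (simp_all add: e'_def field_simps)
  obtain d where d: "d > 0" "\<And>y. norm (y - x) < d \<Longrightarrow> norm (F y - F x - D (y - x)) \<le> e' * norm (y - x)"
    using D e'(1) unfolding has_derivative_at_alt by blast
  define t where "t = d / (2 * (norm v + 1))"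
  have t: "t > 0" "t * norm v < d"
    using d(1) nv by (simp_all add: t_def field_simps add_strict_increasing)
  have lin: "D (t *\<^sub>R v) = t * D v"
    using linear_scale[OF has_derivative_linear[OF D]] by simp
  have "\<bar>F (x + t *\<^sub>R v) - F x - t * D v\<bar> \<le> e' * (t * norm v)"
    using d(2)[of "x + t *\<^sub>R v"] t lin by simp
  moreover have "\<bar>F (x + t *\<^sub>R v) - F x\<bar> \<le> L * (t * norm v)"
    using lipschitz_onD[OF lip, of "x + t *\<^sub>R v" x] t by (simp add: dist_norm)
  ultimately have "\<bar>t * D v\<bar> \<le> e' * (t * norm v) + L * (t * norm v)"
    by linarith
  then have "t * \<bar>D v\<bar> \<le> t * (e' * norm v + L * norm v)"
    using t(1) by (simp add: abs_mult algebra_simps)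
  then have "\<bar>D v\<bar> \<le> e' * norm v + L * norm v"
    using t(1) by simp
  then show "\<bar>D v\<bar> \<le> L * norm v + e"
    using e'(2) by linarith
qed

context riem_man
begin

section \<open>Functions carried by one chart\<close>

definition pullback :: "('a, 'n) riem_chart \<Rightarrow> (real ^ 'n \<Rightarrow> real) \<Rightarrow> 'a \<Rightarrow> real" where
  "pullback c W p = (if p \<in> dom c then W (coord c p) else 0)"

lemma pullback_coord_inv:
  "c \<in> A \<Longrightarrow> x \<in> coord c ` dom c \<Longrightarrow> (pullback c W \<circ> coord_inv c) x = W x"
  by (simp add: pullback_def coord_inv_in coord_coord_inv)

lemma pullback_covec:
  assumes c: "c \<in> A" "p \<in> dom c" and W: "(W has_derivative D) (at (coord c p))"
  shows "mdiff c (pullback c W) p" "covec c (pullback c W) p = (\<chi> i. D (axis i 1))"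
proof -
  have d: "((pullback c W \<circ> coord_inv c) has_derivative D) (at (coord c p))"
    using W by (rule has_derivative_transform_within_open[OF _ open_coord[OF c(1)]])
      (use c pullback_coord_inv in auto)
  show "mdiff c (pullback c W) p" "covec c (pullback c W) p = (\<chi> i. D (axis i 1))"
    using covec_eqI[OF d] by auto
qed

lemma pullback_test:
  assumes c: "c \<in> A" and W: "smooth_map_on UNIV W" and K: "compact K" "K \<subseteq> coord c ` dom c"
    and supp: "\<And>x. x \<notin> K \<Longrightarrow> W x = 0"
  shows "pullback c W \<in> test_functions A" "{p. pullback c W p \<noteq> 0} \<subseteq> coord_inv c ` K" "compact (coord_inv c ` K)"
proof -
  show cK: "compact (coord_inv c ` K)"
    using K continuous_coord_inv[OF c] by (metis compact_continuous_image continuous_on_subset)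
  show sub: "{p. pullback c W p \<noteq> 0} \<subseteq> coord_inv c ` K"
  proof
    fix p assume "p \<in> {p. pullback c W p \<noteq> 0}"
    then have p: "p \<in> dom c" "coord c p \<in> K"
      using supp by (auto simp: pullback_def split: if_splits)
    then have "p = coord_inv c (coord c p)"
      by (simp add: coord_inv_coord c)
    then show "p \<in> coord_inv c ` K"
      using p by blast
  qed
  have "closure {p. pullback c W p \<noteq> 0} \<subseteq> coord_inv c ` K"
    using sub compact_imp_closed[OF cK] by (rule closure_minimal)
  then have "compactly_supported (pullback c W)"
    unfolding compactly_supported_def using closed_subset_compact[OF cK closed_closure] by blast
  moreover have "smooth_map_on (coord d ` dom d) (pullback c W \<circ> coord_inv d)" if d: "d \<in> A" for d
    unfolding smooth_map_on_def
  proof (intro allI ck_on_local)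
    fix k x assume x: "x \<in> coord d ` dom d"
    show "\<exists>U. open U \<and> x \<in> U \<and> ck_on k U (pullback c W \<circ> coord_inv d)"
    proof (cases "coord_inv d x \<in> dom c")
      case True
      define U where "U = coord d ` (dom d \<inter> dom c)"
      have oU: "open U" unfolding U_def by (rule open_overlap[OF d c])
      have xU: "x \<in> U"
        using x True coord_inv_in[OF d x] coord_coord_inv[OF d x] unfolding U_def by (metis IntI image_eqI)
      have "ck_on k U (\<lambda>y. W (transition d c y))"
      proof (rule ck_on_compose[OF oU subset_UNIV, where f = W and g = "transition d c"])
        show "ck_on k UNIV W"
          using W unfolding smooth_map_on_def by blast
        show "ck_on k U (transition d c)"
          using transition_smooth[OF d c] unfolding smooth_map_on_def U_def by blast
      qed
      then have "ck_on k U (pullback c W \<circ> coord_inv d)"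
        by (rule iffD1[OF ck_on_cong[OF oU], rotated])
          (auto simp: U_def transition_coord coord_inv_coord d pullback_def)
      then show ?thesis
        using oU xU by blast
    next
      case False
      define U where "U = coord d ` (dom d - coord_inv c ` K)"
      have oU: "open U" unfolding U_def
        by (intro open_coord_image d open_Diff open_dom compact_imp_closed cK) auto
      have "coord_inv d x \<notin> coord_inv c ` K"
        using False K(2) coord_inv_in[OF c] by auto
      then have xU: "x \<in> U"
        using x coord_inv_in[OF d x] coord_coord_inv[OF d x] unfolding U_def by (metis DiffI image_eqI)
      have "ck_on k U (pullback c W \<circ> coord_inv d)"
        by (rule iffD1[OF ck_on_cong[OF oU] ck_on_const[of k U 0]])
          (use sub in \<open>auto simp: U_def coord_inv_coord d\<close>)
      then show ?thesis
        using oU xU by blast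
    qed
  qed
  ultimately show "pullback c W \<in> test_functions A"
    by (simp add: test_functions_def)
qed

lemma chart_extension_lipschitz:
  assumes c: "c \<in> A" and f: "lipschitz f" and K: "compact K" "K \<subseteq> dom c" and supp: "\<And>p. p \<notin> K \<Longrightarrow> f p = 0"
  defines "F \<equiv> \<lambda>x. if x \<in> coord c ` dom c then f (coord_inv c x) else 0"
  obtains L where "L-lipschitz_on UNIV F"
proof -
  obtain l where l: "l-lipschitz_on UNIV f"
    using f unfolding lipschitz_def by blast
  note l0 = lipschitz_on_nonneg[OF l]
  have cK: "compact (coord c ` K)"
    by (rule compact_continuous_image[OF continuous_on_subset[OF continuous_coord[OF c] K(2)] K(1)])
  have F0: "F x = 0" if "x \<notin> coord c ` K" for x
  proof (cases "x \<in> coord c ` dom c")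
    case True
    have "coord_inv c x \<notin> K"
      using that coord_coord_inv[OF c True] by (metis image_eqI)
    then show ?thesis by (simp add: F_def supp)
  qed (simp add: F_def)
  obtain R where R: "R > 0" "\<And>x. x \<in> coord c ` K \<Longrightarrow> norm x < R"
  proof -
    obtain R where "R > 0" "\<forall>x\<in>coord c ` K. norm x \<le> R"
      using compact_imp_bounded[OF cK] unfolding bounded_pos by blast
    then show thesis
      using that[of "R + 1"] by force
  qed
  show thesis
  proof (rule locally_lipschitz_bounded_support[of F R])
    show "F x = 0" if "norm x \<ge> R" for x
      using F0[of x] R(2)[of x] that by fastforce
    fix x
    show "\<exists>e>0. \<exists>B. \<forall>y\<in>ball x e. \<forall>z\<in>ball x e. \<bar>F y - F z\<bar> \<le> B * norm (y - z)"
    proof (cases "x \<in> coord c ` dom c")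
      case True
      obtain e B where e: "e > 0" "ball x e \<subseteq> coord c ` dom c"
        "\<And>y z. y \<in> ball x e \<Longrightarrow> z \<in> ball x e \<Longrightarrow> dist (coord_inv c y) (coord_inv c z) \<le> B * norm (y - z)"
        using dist_coord_inv_le[OF c True] by metis
      have "\<bar>F y - F z\<bar> \<le> (l * B) * norm (y - z)" if "y \<in> ball x e" "z \<in> ball x e" for y z
      proof -
        have "\<bar>F y - F z\<bar> = dist (f (coord_inv c y)) (f (coord_inv c z))"
          using e(2) that by (auto simp: F_def dist_real_def)
        also have "\<dots> \<le> l * dist (coord_inv c y) (coord_inv c z)"
          using lipschitz_onD[OF l] by simp
        also have "\<dots> \<le> l * (B * norm (y - z))"
          by (intro mult_left_mono e(3) that l0)
        finally show ?thesis by (simp add: mult.assoc)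
      qed
      then show ?thesis using e(1) by blast
    next
      case False
      then have "x \<in> - coord c ` K"
        using K(2) by auto
      moreover have "open (- coord c ` K)"
        using compact_imp_closed[OF cK] by blast
      ultimately obtain e where "e > 0" "ball x e \<subseteq> - coord c ` K"
        using open_contains_ball by blast
      then show ?thesis
        using F0 by (intro exI[of _ e] conjI exI[of _ 0]) (auto simp: subset_iff)
    qed
  qed (use R that in auto)
qed

end

lemma lipschitz_mult:
  fixes f g :: "'b::metric_space \<Rightarrow> real"
  assumes f: "lipschitz f" "\<And>x. \<bar>f x\<bar> \<le> F" and g: "lipschitz g" "\<And>x. \<bar>g x\<bar> \<le> G"
  shows "lipschitz (\<lambda>x. f x * g x)"
proof -
  obtain K L where K: "K-lipschitz_on UNIV f" and L: "L-lipschitz_on UNIV g"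
    using f(1) g(1) unfolding lipschitz_def by blast
  have F0: "F \<ge> 0" and G0: "G \<ge> 0"
    using f(2) g(2) abs_ge_zero order_trans by blast+
  have "(F * L + G * K)-lipschitz_on UNIV (\<lambda>x. f x * g x)"
  proof (rule lipschitz_onI)
    fix x y
    have "\<bar>f x * g x - f y * g y\<bar> = \<bar>f x * (g x - g y) + g y * (f x - f y)\<bar>"
      by (simp add: algebra_simps)
    also have "\<dots> \<le> \<bar>f x\<bar> * \<bar>g x - g y\<bar> + \<bar>g y\<bar> * \<bar>f x - f y\<bar>"
      using abs_triangle_ineq[of "f x * (g x - g y)" "g y * (f x - f y)"] by (simp add: abs_mult)
    also have "\<dots> \<le> F * (L * dist x y) + G * (K * dist x y)"
      using lipschitz_onD[OF K, of x y] lipschitz_onD[OF L, of x y] f(2) g(2) F0 G0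
      by (intro add_mono mult_mono) (auto simp: dist_real_def)
    finally show "dist (f x * g x) (f y * g y) \<le> (F * L + G * K) * dist x y"
      by (simp add: dist_real_def algebra_simps)
  qed (use F0 G0 lipschitz_on_nonneg[OF K] lipschitz_on_nonneg[OF L] in simp)
  then show ?thesis unfolding lipschitz_def by blast
qed

lemma lipschitz_continuous: "lipschitz f \<Longrightarrow> continuous_on UNIV f"
  unfolding lipschitz_def using lipschitz_on_continuous_on by blast

context riem_meas
begin

section \<open>Lipschitz functions as limits of test functions\<close>

text \<open>What dominated convergence will need: a common compact support, a common bound,
  convergence of values everywhere and of gradients almost everywhere. Mentioning no chart, the
  notion is additive, so contributions of different charts can be summed.\<close>

definition mollifiable :: "('a \<Rightarrow> real) \<Rightarrow> bool" where
  "mollifiable f \<longleftrightarrow> (\<exists>w K B. compact K \<and> (\<forall>n. w n \<in> test_functions A) \<and>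
     (\<forall>n p. \<bar>w n p\<bar> \<le> B \<and> grad_norm A (w n) p \<le> B) \<and> (\<forall>n p. p \<notin> K \<longrightarrow> w n p = 0) \<and>
     (\<forall>p. (\<lambda>n. w n p) \<longlonglongrightarrow> f p) \<and>
     (AE p in \<mu>. mdifferentiable f p \<and> (\<lambda>n. grad_norm A (\<lambda>x. w n x - f x) p) \<longlonglongrightarrow> 0))"

lemma grad_norm_diff:
  assumes "mdifferentiable f p" "mdifferentiable g p"
  shows "mdifferentiable (\<lambda>x. f x - g x) p" "grad_norm A (\<lambda>x. f x - g x) p \<le> grad_norm A f p + grad_norm A g p"
  using grad_norm_add[OF assms(1) grad_norm_scale(1)[OF assms(2), of "-1"]] grad_norm_scale(2)[OF assms(2), of "-1"]
  by simp_all

lemma mollifiable_zero: "mollifiable (\<lambda>_. 0)"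
proof -
  have "(\<lambda>_. 0) \<in> test_functions A"
    by (simp add: test_functions_def compactly_supported_def smooth_map_on_def o_def ck_on_const)
  then show ?thesis
    unfolding mollifiable_def
    by (intro exI[of _ "\<lambda>_ _. 0"] exI[of _ "{}"] exI[of _ 0]) (simp add: grad_norm_const)
qed

lemma mollifiable_add:
  assumes "mollifiable f" "mollifiable g"
  shows "mollifiable (\<lambda>x. f x + g x)"
proof -
  obtain v K B where v: "compact K" "\<forall>n. v n \<in> test_functions A"
    "\<forall>n p. \<bar>v n p\<bar> \<le> B \<and> grad_norm A (v n) p \<le> B" "\<forall>n p. p \<notin> K \<longrightarrow> v n p = 0"
    "\<forall>p. (\<lambda>n. v n p) \<longlonglongrightarrow> f p"
    "AE p in \<mu>. mdifferentiable f p \<and> (\<lambda>n. grad_norm A (\<lambda>x. v n x - f x) p) \<longlonglongrightarrow> 0"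
    using assms(1) unfolding mollifiable_def by blast
  obtain w K' B' where w: "compact K'" "\<forall>n. w n \<in> test_functions A"
    "\<forall>n p. \<bar>w n p\<bar> \<le> B' \<and> grad_norm A (w n) p \<le> B'" "\<forall>n p. p \<notin> K' \<longrightarrow> w n p = 0"
    "\<forall>p. (\<lambda>n. w n p) \<longlonglongrightarrow> g p"
    "AE p in \<mu>. mdifferentiable g p \<and> (\<lambda>n. grad_norm A (\<lambda>x. w n x - g x) p) \<longlonglongrightarrow> 0"
    using assms(2) unfolding mollifiable_def by blast
  show ?thesis
    unfolding mollifiable_def
  proof (intro exI conjI)
    show "compact (K \<union> K')" using v w by blast
    show "\<forall>n. (\<lambda>x. v n x + w n x) \<in> test_functions A"
      using v(2) w(2) test_add by blast
    show "\<forall>n p. \<bar>v n p + w n p\<bar> \<le> B + B' \<and> grad_norm A (\<lambda>x. v n x + w n x) p \<le> B + B'"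
    proof (intro allI conjI)
      fix n p
      show "\<bar>v n p + w n p\<bar> \<le> B + B'"
        using v(3)[rule_format, of n p] w(3)[rule_format, of n p] by linarith
      show "grad_norm A (\<lambda>x. v n x + w n x) p \<le> B + B'"
        using grad_norm_add(2)[OF test_mdifferentiable test_mdifferentiable, of "v n" "w n" p]
          v(2,3) w(2,3) by (meson add_mono order_trans)
    qed
    show "\<forall>n p. p \<notin> K \<union> K' \<longrightarrow> v n p + w n p = 0"
      using v(4) w(4) by auto
    show "\<forall>p. (\<lambda>n. v n p + w n p) \<longlonglongrightarrow> f p + g p"
      using v(5) w(5) by (auto intro!: tendsto_add)
    show "AE p in \<mu>. mdifferentiable (\<lambda>x. f x + g x) p \<and>
        (\<lambda>n. grad_norm A (\<lambda>x. v n x + w n x - (f x + g x)) p) \<longlonglongrightarrow> 0"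
      using v(6) w(6)
    proof eventually_elim
      case (elim p)
      have "(\<lambda>n. grad_norm A (\<lambda>x. v n x + w n x - (f x + g x)) p) \<longlonglongrightarrow> 0"
      proof (rule tendsto_sandwich[OF always_eventually always_eventually tendsto_const])
        show "(\<lambda>n. grad_norm A (\<lambda>x. v n x - f x) p + grad_norm A (\<lambda>x. w n x - g x) p) \<longlonglongrightarrow> 0"
          using elim tendsto_add_zero by blast
        show "\<forall>n. grad_norm A (\<lambda>x. v n x + w n x - (f x + g x)) p
            \<le> grad_norm A (\<lambda>x. v n x - f x) p + grad_norm A (\<lambda>x. w n x - g x) p"
        proof
          fix n
          have "(\<lambda>x. v n x + w n x - (f x + g x)) = (\<lambda>x. (v n x - f x) + (w n x - g x))"
            by (simp add: fun_eq_iff)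
          then show "grad_norm A (\<lambda>x. v n x + w n x - (f x + g x)) p
            \<le> grad_norm A (\<lambda>x. v n x - f x) p + grad_norm A (\<lambda>x. w n x - g x) p"
            using grad_norm_add(2)[OF grad_norm_diff(1) grad_norm_diff(1), of "v n" p f "w n" g]
              elim v(2) w(2) test_mdifferentiable by simp
        qed
      qed (use grad_norm_nonneg in auto)
      then show ?case
        using elim grad_norm_add(1) by blast
    qed
  qed
qed

lemma mollifiable_sum:
  "finite I \<Longrightarrow> (\<And>i. i \<in> I \<Longrightarrow> mollifiable (f i)) \<Longrightarrow> mollifiable (\<lambda>x. \<Sum>i\<in>I. f i x)"
  by (induction I rule: finite_induct) (simp_all add: mollifiable_zero mollifiable_add)

text \<open>The coordinate expression, extended by 0, is mollified in Euclidean space and pulled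
  back. On the compact set \<open>Ks\<close> the metric is comparable with the Euclidean one, so the
  Euclidean gradient bounds carry over.\<close>

lemma mollifiable_in_chart:
  assumes c: "c \<in> A" and f: "lipschitz f" and K: "compact K" "K \<subseteq> dom c" and supp: "\<And>p. p \<notin> K \<Longrightarrow> f p = 0"
  shows "mollifiable f"
proof -
  define V where "V = coord c ` dom c"
  define F where "F = (\<lambda>x. if x \<in> V then f (coord_inv c x) else 0)"
  obtain L where L: "L-lipschitz_on UNIV F"
    using chart_extension_lipschitz[OF c f K supp] unfolding F_def V_def by blast
  note L0 = lipschitz_on_nonneg[OF L]
  obtain W :: "nat \<Rightarrow> real ^ 'n \<Rightarrow> real" where W: "\<And>n. smooth_map_on UNIV (W n)" "\<And>n. L-lipschitz_on UNIV (W n)"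
    "\<And>n x. \<bar>W n x - F x\<bar> \<le> L / Suc n"
    "\<And>n x. (\<And>y. y \<in> cball x (1 / Suc n) \<Longrightarrow> F y = 0) \<Longrightarrow> W n x = 0"
    "\<And>x v. F differentiable (at x) \<Longrightarrow>
       (\<lambda>n. frechet_derivative (W n) (at x) v) \<longlonglongrightarrow> frechet_derivative F (at x) v"
    using lipschitz_mollification[OF L] by blast
  have cK: "compact (coord c ` K)"
    by (rule compact_continuous_image[OF continuous_on_subset[OF continuous_coord[OF c] K(2)] K(1)])
  have oV: "open V" unfolding V_def by (rule open_coord[OF c])
  have KV: "coord c ` K \<subseteq> V" using K(2) by (auto simp: V_def)
  \<comment> \<open>Mollification enlarges the support; the margin \<delta> and the index shift
    \<open>N\<close> keep it within a compact part of the image of the chart.\<close>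
  obtain \<delta> where \<delta>: "\<delta> > 0" "(\<Union>x\<in>coord c ` K. cball x \<delta>) \<subseteq> V"
    using compact_subset_open_imp_cball_epsilon_subset[OF cK oV KV] by blast
  define K' where "K' = (\<Union>x\<in>coord c ` K. cball x \<delta>)"
  have K': "compact K'" "K' \<subseteq> coord c ` dom c"
    using compact_minkowski_sum_cball[OF cK] \<delta>(2) unfolding K'_def V_def by auto
  obtain N where N: "1 / Suc N < \<delta>"
    using nat_approx_posE[OF \<delta>(1)] .
  have F0: "F x = 0" if "x \<notin> coord c ` K" for x
  proof (cases "x \<in> V")
    case True
    then have "coord_inv c x \<notin> K"
      using that coord_coord_inv[OF c] unfolding V_def by (metis image_eqI)
    then show ?thesis by (simp add: F_def supp)
  qed (simp add: F_def)
  have W0: "W (n + N) x = 0" if x: "x \<notin> K'" for n x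
  proof (rule W(4))
    fix y assume y: "y \<in> cball x (1 / Suc (n + N))"
    have "1 / Suc (n + N) \<le> 1 / Suc N"
      by (intro divide_left_mono) auto
    then have "x \<in> cball y \<delta>"
      using y N by (simp add: dist_commute)
    then show "F y = 0"
      using x F0 unfolding K'_def by blast
  qed
  define w where "w = (\<lambda>n. pullback c (W (n + N)))"
  define Ks where "Ks = coord_inv c ` K'"
  have w: "w n \<in> test_functions A" "{p. w n p \<noteq> 0} \<subseteq> Ks" "compact Ks" for n
    unfolding w_def Ks_def using pullback_test[OF c W(1) K' W0] by auto
  have Ks: "Ks \<subseteq> dom c"
    using K'(2) coord_inv_in[OF c] by (auto simp: Ks_def)
  have closed_Ks: "closed Ks" using w(3) by (rule compact_imp_closed)
  have F_coord: "F (coord c p) = f p" if "p \<in> dom c" for p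
    using that by (simp add: F_def V_def coord_inv_coord c)
  have f_dom: "f p = 0" if "p \<notin> dom c" for p
    using that K(2) supp by blast
  obtain Bf where Bf: "\<And>p. \<bar>f p\<bar> \<le> Bf"
    using compact_supported_bounded[OF lipschitz_continuous[OF f] K(1) supp] by metis
  have Bf0: "Bf \<ge> 0" using Bf[of undefined] by linarith
  have close: "\<bar>w n p - f p\<bar> \<le> L / Suc (n + N)" for n p
    using W(3)[of "n + N" "coord c p"] F_coord[of p] f_dom[of p] L0
    by (cases "p \<in> dom c") (simp_all add: w_def pullback_def)
  obtain l where l: "l > 0" "\<And>p v. p \<in> Ks \<Longrightarrow> norm v \<le> l * gnorm c p v"
    using gnorm_comparable[OF c w(3) Ks] by metis
  have fd: "(W n has_derivative frechet_derivative (W n) (at x)) (at x)" for n x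
    using frechet_has_derivative[OF smooth_map_on_differentiable[OF W(1)]] by simp
  have cov_w: "mdiff c (w n) p" "covec c (w n) p = (\<chi> i. frechet_derivative (W (n + N)) (at (coord c p)) (axis i 1))"
    if "p \<in> dom c" for n p
    unfolding w_def using pullback_covec[OF c that fd] by auto
  have cov_bound: "norm (covec c (w n) p) \<le> real CARD('n) * L" if p: "p \<in> dom c" for n p
  proof -
    have "norm (covec c (w n) p) \<le> (\<Sum>i\<in>UNIV. \<bar>covec c (w n) p $ i\<bar>)"
      by (rule norm_le_l1_cart)
    also have "\<dots> \<le> (\<Sum>i\<in>(UNIV :: 'n set). L)"
    proof (rule sum_mono)
      fix i :: 'n
      show "\<bar>covec c (w n) p $ i\<bar> \<le> L"
        using lipschitz_derivative_bound[OF W(2) fd, of "n + N" "coord c p" "axis i 1"]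
        by (simp add: cov_w(2)[OF p])
    qed
    finally show ?thesis by simp
  qed
  have outside: "grad_norm A (w n) p = 0" if "p \<notin> Ks" for n p
  proof -
    have "closure {p. w n p \<noteq> 0} \<subseteq> Ks"
      using w(2) closed_Ks by (rule closure_minimal)
    then show ?thesis
      using grad_norm_zero_outside_support(1)[of p "w n"] that by blast
  qed
  have grad_bound: "grad_norm A (w n) p \<le> l * (real CARD('n) * L)" for n p
  proof (cases "p \<in> Ks")
    case True
    then have p: "p \<in> dom c" using Ks by blast
    have "grad_norm A (w n) p = dual_norm c p (covec c (w n) p)"
      using cov_w(1)[OF p] by (simp add: grad_norm_chart[OF c p])
    also have "\<dots> \<le> l * norm (covec c (w n) p)"
      by (rule dual_norm_le[OF c p l(2)[OF True]])
    also have "\<dots> \<le> l * (real CARD('n) * L)"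
      using l(1) cov_bound[OF p] by (intro mult_left_mono) auto
    finally show ?thesis .
  qed (use outside l(1) L0 in simp)
  define B where "B = Bf + L + l * (real CARD('n) * L)"
  show ?thesis
    unfolding mollifiable_def
  proof (intro exI[of _ w] exI[of _ Ks] exI[of _ B] conjI)
    show "compact Ks" by (rule w)
    show "\<forall>n. w n \<in> test_functions A" using w by blast
    show "\<forall>n p. \<bar>w n p\<bar> \<le> B \<and> grad_norm A (w n) p \<le> B"
    proof (intro allI conjI)
      fix n p
      have "L / Suc (n + N) \<le> L / 1"
        using L0 by (intro divide_left_mono) auto
      moreover have "0 \<le> l * (real CARD('n) * L)"
        using l(1) L0 by simp
      ultimately show "\<bar>w n p\<bar> \<le> B"
        using close[of n p] Bf[of p] unfolding B_def by linarith
      show "grad_norm A (w n) p \<le> B"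
        using grad_bound[of n p] Bf0 L0 unfolding B_def by linarith
    qed
    show "\<forall>n p. p \<notin> Ks \<longrightarrow> w n p = 0" using w(2) by blast
    show "\<forall>p. (\<lambda>n. w n p) \<longlonglongrightarrow> f p"
    proof
      fix p
      have "(\<lambda>n. w n p - f p) \<longlonglongrightarrow> 0"
      proof (rule Lim_null_comparison[OF always_eventually])
        show "\<forall>n. norm (w n p - f p) \<le> L / Suc (n + N)" using close by simp
        have "(\<lambda>n. L / Suc n) \<longlonglongrightarrow> 0"
          using tendsto_mult_right_zero[OF LIMSEQ_inverse_real_of_nat, of L] by (simp add: divide_inverse)
        then show "(\<lambda>n. L / Suc (n + N)) \<longlonglongrightarrow> 0"
          using LIMSEQ_ignore_initial_segment by blast
      qed
      then show "(\<lambda>n. w n p) \<longlonglongrightarrow> f p"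
        by (simp add: LIM_zero_iff)
    qed
    have "AE p in \<mu>. p \<in> dom c \<longrightarrow> F differentiable (at (coord c p))"
      by (rule AE_chart[OF c lipschitz_differentiable_AE[OF L]])
    then show "AE p in \<mu>. mdifferentiable f p \<and> (\<lambda>n. grad_norm A (\<lambda>x. w n x - f x) p) \<longlonglongrightarrow> 0"
    proof eventually_elim
      case (elim p)
      show ?case
      proof (cases "p \<in> dom c")
        case True
        have FD: "(F has_derivative frechet_derivative F (at (coord c p))) (at (coord c p))"
          using elim True by (intro frechet_has_derivative) simp
        have fFD: "((f \<circ> coord_inv c) has_derivative frechet_derivative F (at (coord c p))) (at (coord c p))"
          using FD by (rule has_derivative_transform_within_open[OF _ oV]) (use True in \<open>auto simp: V_def F_def\<close>)
        note cov_f = covec_eqI[OF fFD]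
        have "(\<lambda>n. covec c (w n) p) \<longlonglongrightarrow> covec c f p"
          unfolding cov_w(2)[OF True] cov_f(1)
        proof (rule tendsto_vec_lambda)
          fix i
          have "(\<lambda>n. frechet_derivative (W n) (at (coord c p)) (axis i 1)) \<longlonglongrightarrow> frechet_derivative F (at (coord c p)) (axis i 1)"
            using W(5) elim True by blast
          then show "(\<lambda>n. frechet_derivative (W (n + N)) (at (coord c p)) (axis i 1)) \<longlonglongrightarrow> frechet_derivative F (at (coord c p)) (axis i 1)"
            by (rule LIMSEQ_ignore_initial_segment)
        qed
        then have lim0: "(\<lambda>n. norm (covec c (w n) p - covec c f p)) \<longlonglongrightarrow> 0"
          by (simp add: tendsto_norm_zero_iff LIM_zero_iff)
        \<comment> \<open>Convergence of gradients is pointwise, so comparability of the norms at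
          the single point \<open>p\<close> suffices.\<close>
        obtain m where m: "\<And>v. norm v \<le> m * gnorm c p v"
          using gnorm_comparable[OF c, of "{p}"] True by (metis compact_sing empty_subsetI insert_subset singletonI)
        have "(\<lambda>n. grad_norm A (\<lambda>x. w n x - f x) p) \<longlonglongrightarrow> 0"
        proof (rule tendsto_sandwich[OF always_eventually always_eventually tendsto_const])
          show "(\<lambda>n. m * norm (covec c (w n) p - covec c f p)) \<longlonglongrightarrow> 0"
            using tendsto_mult_right_zero[OF lim0] .
          show "\<forall>n. grad_norm A (\<lambda>x. w n x - f x) p \<le> m * norm (covec c (w n) p - covec c f p)"
          proof
            fix n
            have "covec c (\<lambda>x. w n x - f x) p = covec c (w n) p - covec c f p"
              using covec_add(2)[OF cov_w(1)[OF True, of n] covec_scale(1)[OF cov_f(2), of "-1"]]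
                covec_scale(2)[OF cov_f(2), of "-1"] by simp
            then show "grad_norm A (\<lambda>x. w n x - f x) p \<le> m * norm (covec c (w n) p - covec c f p)"
              using dual_norm_le[OF c True m, of "covec c (w n) p - covec c f p"]
                dual_norm_nonneg[OF c True, of "covec c (w n) p - covec c f p"]
              by (auto simp: grad_norm_chart[OF c True])
          qed
        qed (use grad_norm_nonneg in auto)
        then show ?thesis
          using cov_f(2) mdifferentiable_chart[OF c True] by blast
      next
        case False
        \<comment> \<open>Outside the chart, \<open>f\<close> and all the \<open>w n\<close> vanish
          near \<open>p\<close>, since \<open>K\<close> and \<open>Ks\<close> are closed.\<close>
        define U where "U = - (K \<union> Ks)"
        have U: "open U" "p \<in> U"
          using False K Ks closed_Ks compact_imp_closed[OF K(1)] by (auto simp: U_def)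
        have "f x = 0" if "x \<in> U" for x using that supp by (simp add: U_def)
        from grad_norm_cong(2)[OF U this] have "mdifferentiable f p"
          by (simp add: grad_norm_const)
        moreover have "grad_norm A (\<lambda>x. w n x - f x) p = 0" for n
        proof -
          have "w n x - f x = 0" if "x \<in> U" for x
            using that supp w(2)[of n] by (auto simp: U_def)
          from grad_norm_cong(1)[OF U this] show ?thesis
            by (simp add: grad_norm_const)
        qed
        ultimately show ?thesis by simp
      qed
    qed
  qed
qed

text \<open>A Lipschitz partition of unity splits \<open>f\<close> into pieces each living in one
  chart. Smooth cutoffs would bring no gain, as \<open>f\<close> itself is only Lipschitz.\<close>

theorem lipschitz_mollifiable:
  assumes f: "lipschitz f" and supp: "compactly_supported f"
  shows "mollifiable f"
proof (cases "{x. f x \<noteq> 0} = {}")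
  case True
  then have "f = (\<lambda>_. 0)" by auto
  then show ?thesis by (simp add: mollifiable_zero)
next
  case False
  define K where "K = closure {x. f x \<noteq> 0}"
  have K: "compact K" "K \<noteq> {}"
    using supp False by (auto simp: K_def compactly_supported_def)
  have f0: "f x = 0" if "x \<notin> K" for x
    using that closure_subset[of "{x. f x \<noteq> 0}"] unfolding K_def by blast
  obtain F where F: "\<And>x. \<bar>f x\<bar> \<le> F"
    using compact_supported_bounded[OF lipschitz_continuous[OF f] K(1) f0] by metis
  have "\<exists>\<rho>>0. cball p \<rho> \<subseteq> dom (chart_at A p)" for p
    using open_contains_cball open_dom[OF chart_at(1)] chart_at(2) by blast
  then obtain \<rho> where \<rho>: "\<And>p. \<rho> p > 0" "\<And>p. cball p (\<rho> p) \<subseteq> dom (chart_at A p)"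
    by metis
  have "K \<subseteq> (\<Union>p\<in>K. ball p (\<rho> p))"
    using \<rho>(1) by auto
  then obtain P where P: "P \<subseteq> K" "finite P" "K \<subseteq> (\<Union>p\<in>P. ball p (\<rho> p))"
    using compactE_image[OF K(1), of K "\<lambda>p. ball p (\<rho> p)"] by (metis open_ball)
  \<comment> \<open>Tent functions, positive exactly on the balls of the cover. Their supports lie
    in closed balls inside charts, which are compact because the space is proper.\<close>
  define b where "b = (\<lambda>p x. max 0 (\<rho> p - dist p x))"
  have b_lip: "1-lipschitz_on UNIV (b p)" for p
  proof (rule lipschitz_onI)
    fix x y
    show "dist (b p x) (b p y) \<le> 1 * dist x y"
      using dist_triangle[of p x y] dist_triangle[of p y x] unfolding b_def dist_real_def
      by (auto simp: dist_commute max_def abs_if)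
  qed simp
  have b_le: "\<bar>b p x\<bar> \<le> \<rho> p" for p x
    using \<rho>(1)[of p] by (simp add: b_def)
  have b0: "b p x \<ge> 0" for p x by (simp add: b_def)
  define S where "S = (\<lambda>x. \<Sum>p\<in>P. b p x)"
  have S_lip: "(\<Sum>p\<in>P. 1)-lipschitz_on UNIV S"
    unfolding S_def using P(2)
  proof (induction P rule: finite_induct)
    case empty
    show ?case by (simp add: lipschitz_on_constant)
  next
    case (insert p P)
    then show ?case
      using lipschitz_on_add[OF b_lip[of p]] by simp
  qed
  have S_pos: "S x > 0" if x: "x \<in> K" for x
  proof -
    obtain p where p: "p \<in> P" "x \<in> ball p (\<rho> p)"
      using P(3) x by blast
    then have "b p x > 0" by (simp add: b_def)
    then show ?thesis
      unfolding S_def using p(1) P(2) b0 by (intro sum_pos2) auto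
  qed
  have "continuous_on K S"
    using lipschitz_on_continuous_on[OF S_lip] continuous_on_subset by blast
  then obtain z where z: "z \<in> K" "\<forall>x\<in>K. S z \<le> S x"
    using continuous_attains_inf[OF K] by blast
  define s where "s = S z"
  have s: "s > 0" unfolding s_def by (rule S_pos[OF z(1)])
  \<comment> \<open>\<open>1 / S\<close> need not be defined off \<open>K\<close>. Cutting
    \<open>S\<close> off at its minimum \<open>s\<close> over \<open>K\<close> changes nothing on
    \<open>K\<close> and makes the reciprocal Lipschitz everywhere.\<close>
  define T where "T = (\<lambda>x. 1 / max s (S x))"
  have T_le: "\<bar>T x\<bar> \<le> 1 / s" for x
    using s by (auto simp: T_def frac_le)
  have T_lip: "lipschitz T"
  proof -
    have "((\<Sum>p\<in>P. 1) / s\<^sup>2)-lipschitz_on UNIV T"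
    proof (rule lipschitz_onI)
      fix x y
      define u v where "u = max s (S x)" and "v = max s (S y)"
      have uv: "u \<ge> s" "v \<ge> s" by (simp_all add: u_def v_def)
      have "\<bar>1 / u - 1 / v\<bar> = \<bar>v - u\<bar> / (u * v)"
        using uv s by (simp add: field_simps abs_divide abs_mult)
      also have "\<dots> \<le> \<bar>v - u\<bar> / (s * s)"
        using uv s by (intro divide_left_mono mult_mono mult_pos_pos) auto
      also have "\<bar>v - u\<bar> \<le> \<bar>S x - S y\<bar>"
        unfolding u_def v_def by (simp add: max_def abs_if)
      also have "\<bar>S x - S y\<bar> \<le> (\<Sum>p\<in>P. 1) * dist x y"
        using lipschitz_onD[OF S_lip, of x y] by (simp add: dist_real_def)
      finally have "\<bar>1 / u - 1 / v\<bar> \<le> (\<Sum>p\<in>P. 1) * dist x y / (s * s)"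
        using s by (simp add: divide_right_mono)
      then show "dist (T x) (T y) \<le> (\<Sum>p\<in>P. 1) / s\<^sup>2 * dist x y"
        by (simp add: T_def u_def v_def dist_real_def power2_eq_square)
    qed simp
    then show ?thesis unfolding lipschitz_def by blast
  qed
  have "mollifiable (\<lambda>x. f x * (b p x * T x))" for p
  proof (rule mollifiable_in_chart[OF chart_at(1)[of p] _ compact_cball_proper \<rho>(2)])
    have bl: "lipschitz (b p)"
      unfolding lipschitz_def using b_lip by blast
    have "lipschitz (\<lambda>x. b p x * T x)"
      by (rule lipschitz_mult[OF bl b_le T_lip T_le])
    moreover have "\<bar>b p x * T x\<bar> \<le> \<rho> p * (1 / s)" for x
      unfolding abs_mult using b_le[of p x] T_le[of x] \<rho>(1)[of p] by (intro mult_mono) auto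
    ultimately show "lipschitz (\<lambda>x. f x * (b p x * T x))"
      by (rule lipschitz_mult[OF f F])
    show "f x * (b p x * T x) = 0" if "x \<notin> cball p (\<rho> p)" for x
      using that by (simp add: b_def)
  qed
  then have "mollifiable (\<lambda>x. \<Sum>p\<in>P. f x * (b p x * T x))"
    using mollifiable_sum[OF P(2)] by simp
  moreover have "(\<Sum>p\<in>P. f x * (b p x * T x)) = f x" for x
  proof (cases "x \<in> K")
    case True
    have "(\<Sum>p\<in>P. f x * (b p x * T x)) = f x * (S x * T x)"
      by (simp add: S_def sum_distrib_left sum_distrib_right)
    also have "S x * T x = 1"
      using z(2) True S_pos[OF True] by (simp add: T_def s_def max_def)
    finally show ?thesis by simp
  qed (simp add: f0)
  ultimately show ?thesis by simp
qed

end

section \<open>Lebesgue norms\<close>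

text \<open>For positive \<open>x\<close> and \<open>y\<close> this is convexity of the power; if
  one of them is 0 it reduces to \<open>a powr p \<le> a\<close> for 0 \<le> a \<le> 1.\<close>

lemma convex_powr_nonneg:
  fixes x y p :: real
  assumes "p \<ge> 1" "x \<ge> 0" "y \<ge> 0" "0 \<le> t" "t \<le> 1"
  shows "((1 - t) * x + t * y) powr p \<le> (1 - t) * x powr p + t * y powr p"
proof -
  have sc: "(a * z) powr p \<le> a * z powr p" if "0 \<le> a" "a \<le> 1" "z \<ge> 0" for a z :: real
  proof -
    have "a powr p \<le> a"
    proof (cases "a = 0")
      case False
      then show ?thesis
        using powr_mono_both[of 1 p a a] powr_mono'[of 1 p a] that assms(1) by simp
    qed simp
    then show ?thesis
      by (simp add: powr_mult mult_right_mono)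
  qed
  consider "x = 0" | "y = 0" | "x > 0" "y > 0" using assms by linarith
  then show ?thesis
  proof cases
    case 1
    then show ?thesis using sc[of t y] assms by simp
  next
    case 2
    then show ?thesis using sc[of "1 - t" x] assms by simp
  next
    case 3
    then show ?thesis
      using convex_onD[OF powr_convex[OF assms(1)], of t x y] assms by simp
  qed
qed

text \<open>Young's inequality with second factor 1. Integrated at the right scale it yields
  Holder's inequality against an indicator.\<close>

lemma powr_tangent:
  fixes s p :: real
  assumes "p > 1" "s \<ge> 0"
  shows "s \<le> (1 / p) * s powr p + (1 - 1 / p)"
proof (cases "s = 0")
  case False
  have "(s powr p) powr (1 / p) * 1 powr (1 - 1 / p) \<le> (1 / p) * s powr p + (1 - 1 / p) * 1"
    using assms False by (intro Youngs_inequality_0) auto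
  then show ?thesis
    using assms False by (simp add: powr_powr)
qed (use assms in simp)

lemma Lp_norm_nonneg [simp]: "Lp_norm M p f \<ge> 0"
  by (simp add: Lp_norm_def)

lemma Lp_spaceD:
  assumes "f \<in> Lp_space M p"
  shows "f \<in> borel_measurable M" "integrable M (\<lambda>x. \<bar>f x\<bar> powr p)"
  using assms by (auto simp: Lp_space_def)

lemma Lp_norm_powr:
  assumes "p > 0"
  shows "Lp_norm M p f powr p = (\<integral>x. \<bar>f x\<bar> powr p \<partial>M)"
  using assms Bochner_Integration.integral_nonneg[of M "\<lambda>x. \<bar>f x\<bar> powr p"]
  by (simp add: Lp_norm_def powr_powr)

lemma Lp_norm_le_iff:
  assumes "p > 0" "c \<ge> 0"
  shows "Lp_norm M p f \<le> c \<longleftrightarrow> (\<integral>x. \<bar>f x\<bar> powr p \<partial>M) \<le> c powr p"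
proof
  assume "Lp_norm M p f \<le> c"
  then have "Lp_norm M p f powr p \<le> c powr p"
    using assms by (intro powr_mono2) auto
  then show "(\<integral>x. \<bar>f x\<bar> powr p \<partial>M) \<le> c powr p"
    by (simp add: Lp_norm_powr[OF assms(1)])
next
  assume "(\<integral>x. \<bar>f x\<bar> powr p \<partial>M) \<le> c powr p"
  then have "(\<integral>x. \<bar>f x\<bar> powr p \<partial>M) powr (1 / p) \<le> (c powr p) powr (1 / p)"
    using assms Bochner_Integration.integral_nonneg[of M "\<lambda>x. \<bar>f x\<bar> powr p"] by (intro powr_mono2) auto
  then show "Lp_norm M p f \<le> c"
    using assms by (simp add: Lp_norm_def powr_powr)
qed

lemma Lp_mono:
  assumes "p > 0" and f: "f \<in> borel_measurable M" and g: "g \<in> Lp_space M p" and le: "AE x in M. \<bar>f x\<bar> \<le> \<bar>g x\<bar>"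
  shows "f \<in> Lp_space M p" "Lp_norm M p f \<le> Lp_norm M p g"
proof -
  have le': "AE x in M. \<bar>f x\<bar> powr p \<le> \<bar>g x\<bar> powr p"
    using le by eventually_elim (use assms(1) in \<open>auto intro: powr_mono2\<close>)
  have "integrable M (\<lambda>x. \<bar>f x\<bar> powr p)"
    by (rule Bochner_Integration.integrable_bound[OF Lp_spaceD(2)[OF g]])
      (use f le' in \<open>auto elim: eventually_mono\<close>)
  then show fL: "f \<in> Lp_space M p"
    using f by (simp add: Lp_space_def)
  have "(\<integral>x. \<bar>f x\<bar> powr p \<partial>M) \<le> (\<integral>x. \<bar>g x\<bar> powr p \<partial>M)"
    by (rule integral_mono_AE[OF Lp_spaceD(2)[OF fL] Lp_spaceD(2)[OF g] le'])
  then show "Lp_norm M p f \<le> Lp_norm M p g"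
    using assms(1) by (simp add: Lp_norm_le_iff Lp_norm_powr)
qed

lemma Lp_norm_cong_AE:
  assumes "f \<in> borel_measurable M" "g \<in> borel_measurable M" "AE x in M. f x = g x"
  shows "Lp_norm M p f = Lp_norm M p g"
proof -
  have "(\<integral>x. \<bar>f x\<bar> powr p \<partial>M) = (\<integral>x. \<bar>g x\<bar> powr p \<partial>M)"
    by (rule integral_cong_AE) (use assms in \<open>auto elim: eventually_mono\<close>)
  then show ?thesis by (simp add: Lp_norm_def)
qed

lemma Lp_scale:
  assumes "p > 0" "f \<in> Lp_space M p"
  shows "(\<lambda>x. k * f x) \<in> Lp_space M p" "Lp_norm M p (\<lambda>x. k * f x) = \<bar>k\<bar> * Lp_norm M p f"
proof -
  show "(\<lambda>x. k * f x) \<in> Lp_space M p"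
    using Lp_spaceD[OF assms(2)] by (simp add: Lp_space_def abs_mult powr_mult)
  show "Lp_norm M p (\<lambda>x. k * f x) = \<bar>k\<bar> * Lp_norm M p f"
    using assms(1) by (simp add: Lp_norm_def abs_mult powr_mult powr_powr)
qed

text \<open>Convexity of the \<open>p\<close>-th power is applied after normalising both functions.\<close>

lemma Lp_add:
  assumes p: "p \<ge> 1" and f: "f \<in> Lp_space M p" and g: "g \<in> Lp_space M p"
  shows "(\<lambda>x. f x + g x) \<in> Lp_space M p" "Lp_norm M p (\<lambda>x. f x + g x) \<le> Lp_norm M p f + Lp_norm M p g"
proof -
  have p0: "p > 0" using p by simp
  note fD = Lp_spaceD[OF f] and gD = Lp_spaceD[OF g]
  note [measurable] = fD(1) gD(1)
  have pointwise: "\<bar>f x + g x\<bar> powr p \<le> (a + b) powr p * (a / (a + b) * (\<bar>f x\<bar> powr p / a powr p) + b / (a + b) * (\<bar>g x\<bar> powr p / b powr p))"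
    if "a > 0" "b > 0" for a b x
  proof -
    define t where "t = b / (a + b)"
    have t: "1 - t = a / (a + b)" "0 \<le> t" "t \<le> 1"
      using that by (auto simp: t_def field_simps)
    have "\<bar>f x + g x\<bar> powr p \<le> (\<bar>f x\<bar> + \<bar>g x\<bar>) powr p"
      using p by (intro powr_mono2) auto
    also have "\<bar>f x\<bar> + \<bar>g x\<bar> = (a + b) * ((1 - t) * (\<bar>f x\<bar> / a) + t * (\<bar>g x\<bar> / b))"
    proof -
      have "(1 - t) * (\<bar>f x\<bar> / a) = \<bar>f x\<bar> / (a + b)" "t * (\<bar>g x\<bar> / b) = \<bar>g x\<bar> / (a + b)"
        using that unfolding t(1) by (simp_all add: t_def)
      then show ?thesis
        using that by (simp add: add_divide_distrib[symmetric])
    qed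
    also have "\<dots> powr p = (a + b) powr p * ((1 - t) * (\<bar>f x\<bar> / a) + t * (\<bar>g x\<bar> / b)) powr p"
      by (rule powr_mult)
    also have "\<dots> \<le> (a + b) powr p * ((1 - t) * (\<bar>f x\<bar> / a) powr p + t * (\<bar>g x\<bar> / b) powr p)"
      using that t by (intro mult_left_mono convex_powr_nonneg p) auto
    finally show ?thesis
      using that unfolding t(1) by (simp add: t_def powr_divide)
  qed
  have int: "integrable M (\<lambda>x. (a + b) powr p * (a / (a + b) * (\<bar>f x\<bar> powr p / a powr p) + b / (a + b) * (\<bar>g x\<bar> powr p / b powr p)))" for a b
    using fD(2) gD(2) by simp
  have "integrable M (\<lambda>x. \<bar>f x + g x\<bar> powr p)"
    by (rule Bochner_Integration.integrable_bound[OF int[of 1 1]])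
      (use pointwise[of 1 1] in \<open>auto simp del: powr_one_eq_one intro: order_trans[OF _ abs_ge_self]\<close>)
  then show fg: "(\<lambda>x. f x + g x) \<in> Lp_space M p"
    by (simp add: Lp_space_def)
  show "Lp_norm M p (\<lambda>x. f x + g x) \<le> Lp_norm M p f + Lp_norm M p g"
  proof (rule field_le_epsilon)
    fix e :: real assume e: "e > 0"
    \<comment> \<open>Exceeding the norms by \<open>e / 2\<close> makes \<open>a\<close> and
      \<open>b\<close> positive, so that they can be divided by even if a norm is 0.\<close>
    define a where "a = Lp_norm M p f + e / 2"
    define b where "b = Lp_norm M p g + e / 2"
    have ab: "a > 0" "b > 0"
      using e Lp_norm_nonneg[of M p f] Lp_norm_nonneg[of M p g] unfolding a_def b_def by linarith+
    have A: "(\<integral>x. \<bar>f x\<bar> powr p \<partial>M) \<le> a powr p"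
      using iffD1[OF Lp_norm_le_iff[OF p0, of a M f]] ab e by (simp add: a_def)
    have B: "(\<integral>x. \<bar>g x\<bar> powr p \<partial>M) \<le> b powr p"
      using iffD1[OF Lp_norm_le_iff[OF p0, of b M g]] ab e by (simp add: b_def)
    have "(\<integral>x. \<bar>f x + g x\<bar> powr p \<partial>M) \<le> (\<integral>x. (a + b) powr p * (a / (a + b) * (\<bar>f x\<bar> powr p / a powr p) + b / (a + b) * (\<bar>g x\<bar> powr p / b powr p)) \<partial>M)"
      by (rule integral_mono[OF Lp_spaceD(2)[OF fg] int pointwise[OF ab]])
    also have "\<dots> = (a + b) powr p * (a / (a + b) * ((\<integral>x. \<bar>f x\<bar> powr p \<partial>M) / a powr p) + b / (a + b) * ((\<integral>x. \<bar>g x\<bar> powr p \<partial>M) / b powr p))"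
      using fD(2) gD(2) by simp
    also have "\<dots> \<le> (a + b) powr p * (a / (a + b) * 1 + b / (a + b) * 1)"
      using ab A B by (intro mult_left_mono add_mono) (auto simp: divide_le_eq_1)
    also have "a / (a + b) * 1 + b / (a + b) * 1 = 1"
      using ab by (simp add: add_divide_distrib[symmetric])
    finally have "Lp_norm M p (\<lambda>x. f x + g x) \<le> a + b"
      using ab p0 by (simp add: Lp_norm_le_iff)
    then show "Lp_norm M p (\<lambda>x. f x + g x) \<le> Lp_norm M p f + Lp_norm M p g + e"
      by (simp add: a_def b_def)
  qed
qed

lemma Lp_diff:
  assumes p: "p \<ge> 1" and f: "f \<in> Lp_space M p" and g: "g \<in> Lp_space M p"
  shows "(\<lambda>x. f x - g x) \<in> Lp_space M p" "Lp_norm M p (\<lambda>x. f x - g x) \<le> Lp_norm M p f + Lp_norm M p g"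
proof -
  have p0: "p > 0" using p by simp
  show "(\<lambda>x. f x - g x) \<in> Lp_space M p" "Lp_norm M p (\<lambda>x. f x - g x) \<le> Lp_norm M p f + Lp_norm M p g"
    using Lp_add[OF p f Lp_scale(1)[OF p0 g, of "-1"]] Lp_scale(2)[OF p0 g, of "-1"] by simp_all
qed

lemma Lp_bounded:
  assumes p: "p > 0" and f: "f \<in> borel_measurable M" and K: "K \<in> sets M" "emeasure M K < \<infinity>"
    and le: "AE x in M. \<bar>f x\<bar> \<le> B * indicator K x" and B: "B \<ge> 0"
  shows "f \<in> Lp_space M p" "Lp_norm M p f \<le> B * measure M K powr (1 / p)"
proof -
  have eq: "\<bar>B * indicator K x\<bar> powr p = B powr p * indicator K x" for x :: 'a
    using B p by (simp add: indicator_def)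
  have g: "(\<lambda>x. B * indicator K x) \<in> Lp_space M p"
    unfolding Lp_space_def using K by (simp add: eq integrable_real_indicator)
  have "Lp_norm M p (\<lambda>x. B * indicator K x) = B * measure M K powr (1 / p)"
    unfolding Lp_norm_def eq using K(1) B p
    by (simp add: powr_mult powr_powr Int_absorb2 sets.sets_into_space)
  moreover have "AE x in M. \<bar>f x\<bar> \<le> \<bar>B * indicator K x\<bar>"
    using le by eventually_elim (use B in simp)
  ultimately show "f \<in> Lp_space M p" "Lp_norm M p f \<le> B * measure M K powr (1 / p)"
    using Lp_mono[OF p f g] by auto
qed

lemma Lp_norm_dominated_0:
  assumes p: "p > 0" and h: "\<And>n. h n \<in> borel_measurable M" and K: "K \<in> sets M" "emeasure M K < \<infinity>"
    and le: "\<And>n. AE x in M. \<bar>h n x\<bar> \<le> B * indicator K x" and B: "B \<ge> 0"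
    and lim: "AE x in M. (\<lambda>n. h n x) \<longlonglongrightarrow> 0"
  shows "(\<lambda>n. Lp_norm M p (h n)) \<longlonglongrightarrow> 0"
proof -
  have "(\<lambda>n. \<integral>x. \<bar>h n x\<bar> powr p \<partial>M) \<longlonglongrightarrow> (\<integral>x. 0 \<partial>M)"
  proof (rule integral_dominated_convergence[where w = "\<lambda>x. B powr p * indicator K x"])
    show "(\<lambda>x. \<bar>h n x\<bar> powr p) \<in> borel_measurable M" for n
      using h by measurable
    show "integrable M (\<lambda>x. B powr p * indicator K x)"
      using K by (simp add: integrable_real_indicator)
    show "AE x in M. norm (\<bar>h n x\<bar> powr p) \<le> B powr p * indicator K x" for n
      using le[of n] by eventually_elim (use p in \<open>auto simp: indicator_def intro: powr_mono2 split: if_splits\<close>)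
    show "AE x in M. (\<lambda>n. \<bar>h n x\<bar> powr p) \<longlonglongrightarrow> 0"
      using lim
    proof eventually_elim
      case (elim x)
      have "(\<lambda>n. \<bar>h n x\<bar> powr p) \<longlonglongrightarrow> 0 powr p"
        using elim p by (intro tendsto_powr' tendsto_rabs_zero tendsto_const) auto
      then show ?case by simp
    qed
  qed simp
  then have "(\<lambda>n. (\<integral>x. \<bar>h n x\<bar> powr p \<partial>M) powr (1 / p)) \<longlonglongrightarrow> 0 powr (1 / p)"
    using p by (intro tendsto_powr' tendsto_const) (auto intro!: always_eventually Bochner_Integration.integral_nonneg)
  then show ?thesis
    by (simp add: Lp_norm_def)
qed

text \<open>Holder's inequality against the indicator of \<open>K\<close>: the tangent inequality
  for \<open>\<bar>f\<bar> / t\<close> is integrated over \<open>K\<close> and \<open>t\<close> is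
  chosen optimally.\<close>

lemma Lp_integral_bound:
  assumes p: "p > 1" and f: "f \<in> Lp_space M p" and K: "K \<in> sets M" "emeasure M K < \<infinity>" "measure M K > 0"
  shows "integrable M (\<lambda>x. indicator K x * f x)"
    "\<bar>\<integral>x. indicator K x * f x \<partial>M\<bar> \<le> measure M K powr (1 - 1 / p) * Lp_norm M p f"
proof -
  note fD = Lp_spaceD[OF f]
  note [measurable] = fD(1)
  have K' [measurable]: "K \<in> sets M" by (rule K)
  have bound: "\<bar>indicator K x * f x\<bar> \<le> t * (1 / p) * (\<bar>f x\<bar> powr p / t powr p) + t * (1 - 1 / p) * indicator K x"
    if t: "t > 0" for t x
  proof (cases "x \<in> K")
    case True
    have "\<bar>f x\<bar> / t \<le> (1 / p) * (\<bar>f x\<bar> / t) powr p + (1 - 1 / p)"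
      using p t by (intro powr_tangent) auto
    then have "t * (\<bar>f x\<bar> / t) \<le> t * ((1 / p) * (\<bar>f x\<bar> / t) powr p + (1 - 1 / p))"
      using t by (intro mult_left_mono) auto
    then show ?thesis
      using True t by (simp add: powr_divide distrib_left mult.assoc)
  next
    case False
    then show ?thesis using t p by simp
  qed
  have int_r: "integrable M (\<lambda>x. t * (1 / p) * (\<bar>f x\<bar> powr p / t powr p) + t * (1 - 1 / p) * indicator K x)" for t
    using fD(2) K by (auto simp: integrable_real_indicator)
  show int: "integrable M (\<lambda>x. indicator K x * f x)"
    by (rule Bochner_Integration.integrable_bound[OF int_r[of 1]])
      (use bound[of 1] in \<open>auto simp del: powr_one_eq_one intro: order_trans[OF _ abs_ge_self]\<close>)
  show "\<bar>\<integral>x. indicator K x * f x \<partial>M\<bar> \<le> measure M K powr (1 - 1 / p) * Lp_norm M p f"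
  proof (rule field_le_epsilon)
    fix e :: real assume e: "e > 0"
    define m where "m = measure M K"
    have m: "m > 0" using K by (simp add: m_def)
    \<comment> \<open>A positive substitute for the norm; the added term turns into exactly
      \<open>e\<close> in the final estimate.\<close>
    define N where "N = Lp_norm M p f + e / m powr (1 - 1 / p)"
    have N: "N > 0" "Lp_norm M p f \<le> N"
      using e m Lp_norm_nonneg[of M p f] unfolding N_def by (auto intro: add_nonneg_pos)
    \<comment> \<open>For this \<open>t\<close> the integral of
      \<open>(\<bar>f\<bar> / t) powr p\<close> is at most \<open>m\<close>, so the two terms of the
      tangent inequality add up to at most \<open>t * m\<close>.\<close>
    define t where "t = N * m powr (- 1 / p)"
    have t: "t > 0" using N m by (simp add: t_def)
    have tp: "t powr p = N powr p / m"
    proof -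
      have "(m powr (- 1 / p)) powr p = 1 / m"
        using m p by (simp only: powr_powr) (simp add: powr_minus divide_inverse)
      then show ?thesis
        unfolding t_def powr_mult by simp
    qed
    have I: "(\<integral>x. \<bar>f x\<bar> powr p \<partial>M) \<le> N powr p"
      using iffD1[OF Lp_norm_le_iff[of p N M f]] N p by simp
    have "\<bar>\<integral>x. indicator K x * f x \<partial>M\<bar> \<le> (\<integral>x. \<bar>indicator K x * f x\<bar> \<partial>M)"
      by (rule integral_abs_bound)
    also have "\<dots> \<le> (\<integral>x. t * (1 / p) * (\<bar>f x\<bar> powr p / t powr p) + t * (1 - 1 / p) * indicator K x \<partial>M)"
      by (rule integral_mono[OF integrable_abs[OF int] int_r bound[OF t]])
    also have "\<dots> = t * (1 / p) * ((\<integral>x. \<bar>f x\<bar> powr p \<partial>M) / t powr p) + t * (1 - 1 / p) * m"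
      using fD(2) K by (simp add: integrable_real_indicator m_def Int_absorb2 sets.sets_into_space)
    also have "\<dots> \<le> t * (1 / p) * (N powr p / t powr p) + t * (1 - 1 / p) * m"
      using I t p by (intro add_right_mono mult_left_mono divide_right_mono) auto
    also have "\<dots> = t * m"
      using N m p by (simp add: tp field_simps)
    also have "\<dots> = N * m powr (1 - 1 / p)"
      using m by (simp add: t_def powr_diff powr_minus divide_inverse mult_ac)
    also have "\<dots> = m powr (1 - 1 / p) * Lp_norm M p f + e"
      using m by (simp add: N_def field_simps)
    finally show "\<bar>\<integral>x. indicator K x * f x \<partial>M\<bar> \<le> measure M K powr (1 - 1 / p) * Lp_norm M p f + e"
      by (simp add: m_def)
  qed
qed

section \<open>The Sobolev norm\<close>

locale riem_sobolev = riem_meas A \<mu>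
  for A :: "('a::{metric_space, second_countable_topology}, 'n::finite) riem_chart set" and \<mu> +
  fixes \<beta> :: real
  assumes beta: "1 < \<beta>"
begin

definition full_norm :: "('a \<Rightarrow> real) \<Rightarrow> 'a \<Rightarrow> real" where
  "full_norm u = (\<lambda>x. \<bar>u x\<bar> + grad_norm A u x)"

lemma full_norm_nonneg: "full_norm u x \<ge> 0"
  by (simp add: full_norm_def grad_norm_nonneg)

lemma test_norm_full: "test_norm A \<mu> \<beta> u = Lp_norm \<mu> \<beta> (full_norm u)"
  by (simp add: test_norm_def full_norm_def)

lemma test_norm_nonneg [simp]: "test_norm A \<mu> \<beta> u \<ge> 0"
  by (simp add: test_norm_def)

lemma measurable_continuous: "continuous_on UNIV (f :: 'a \<Rightarrow> real) \<Longrightarrow> f \<in> borel_measurable \<mu>"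
  using borel_measurable_continuous_onI measurable_cong_sets[OF sets_\<mu> refl] by blast

lemma compact_emeasure: "compact K \<Longrightarrow> emeasure \<mu> K < \<infinity>"
  by (intro emeasure_bounded_set_finite compact_imp_bounded borel_compact)

lemma full_norm_continuous: "u \<in> test_functions A \<Longrightarrow> continuous_on UNIV (full_norm u)"
  unfolding full_norm_def by (intro continuous_intros test_continuous test_grad_continuous)

lemma full_norm_outside:
  assumes "closed K" "\<And>x. x \<notin> K \<Longrightarrow> u x = 0" "p \<notin> K"
  shows "full_norm u p = 0"
proof -
  have "{x. u x \<noteq> 0} \<subseteq> K" using assms(2) by blast
  then have "closure {x. u x \<noteq> 0} \<subseteq> K"
    using assms(1) by (rule closure_minimal)
  then show ?thesis
    using grad_norm_zero_outside_support(1)[of p u] assms by (auto simp: full_norm_def)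
qed

lemma full_norm_Lp:
  assumes u: "u \<in> test_functions A"
  shows "full_norm u \<in> Lp_space \<mu> \<beta>"
proof -
  define K where "K = closure {x. u x \<noteq> 0}"
  have K: "compact K"
    using u by (simp add: K_def test_functions_def compactly_supported_def)
  have u0: "u x = 0" if "x \<notin> K" for x
    using that closure_subset[of "{x. u x \<noteq> 0}"] unfolding K_def by blast
  have z: "full_norm u x = 0" if "x \<notin> K" for x
    using full_norm_outside[OF compact_imp_closed[OF K] u0 that] .
  obtain B where B: "B > 0" "\<And>x. \<bar>full_norm u x\<bar> \<le> B"
    using compact_supported_bounded[OF full_norm_continuous[OF u] K z] by blast
  show ?thesis
  proof (rule Lp_bounded(1))
    show "AE x in \<mu>. \<bar>full_norm u x\<bar> \<le> B * indicator K x"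
      using B z by (auto simp: indicator_def)
  qed (use beta B K compact_emeasure measurable_continuous[OF full_norm_continuous[OF u]] borel_compact in auto)
qed

lemma test_Lp:
  assumes u: "u \<in> test_functions A"
  shows "u \<in> Lp_space \<mu> \<beta>" "Lp_norm \<mu> \<beta> u \<le> test_norm A \<mu> \<beta> u"
  unfolding test_norm_full
  by (rule Lp_mono[OF _ measurable_continuous[OF test_continuous[OF u]] full_norm_Lp[OF u]];
      use beta grad_norm_nonneg in \<open>simp add: full_norm_def\<close>)+

lemma test_norm_add:
  assumes "u \<in> test_functions A" "v \<in> test_functions A"
  shows "test_norm A \<mu> \<beta> (\<lambda>x. u x + v x) \<le> test_norm A \<mu> \<beta> u + test_norm A \<mu> \<beta> v"
proof -
  have "test_norm A \<mu> \<beta> (\<lambda>x. u x + v x) \<le> Lp_norm \<mu> \<beta> (\<lambda>x. full_norm u x + full_norm v x)"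
    unfolding test_norm_full
  proof (rule Lp_mono(2))
    have "full_norm (\<lambda>x. u x + v x) x \<le> full_norm u x + full_norm v x" for x
      using grad_norm_add(2)[OF test_mdifferentiable test_mdifferentiable, OF assms, of x]
        abs_triangle_ineq[of "u x" "v x"] unfolding full_norm_def by linarith
    then show "AE x in \<mu>. \<bar>full_norm (\<lambda>x. u x + v x) x\<bar> \<le> \<bar>full_norm u x + full_norm v x\<bar>"
      using full_norm_nonneg by (auto simp: abs_of_nonneg)
    show "full_norm (\<lambda>x. u x + v x) \<in> borel_measurable \<mu>"
      by (intro measurable_continuous full_norm_continuous test_add assms)
    show "(\<lambda>x. full_norm u x + full_norm v x) \<in> Lp_space \<mu> \<beta>"
      using beta by (intro Lp_add(1) full_norm_Lp assms) simp
  qed (use beta in simp)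
  also have "\<dots> \<le> test_norm A \<mu> \<beta> u + test_norm A \<mu> \<beta> v"
    unfolding test_norm_full using beta by (intro Lp_add(2) full_norm_Lp assms) auto
  finally show ?thesis .
qed

lemma test_norm_scale:
  assumes "u \<in> test_functions A"
  shows "test_norm A \<mu> \<beta> (\<lambda>x. k * u x) = \<bar>k\<bar> * test_norm A \<mu> \<beta> u"
proof -
  have "full_norm (\<lambda>x. k * u x) = (\<lambda>x. \<bar>k\<bar> * full_norm u x)"
    using grad_norm_scale(2)[OF test_mdifferentiable[OF assms]]
    by (auto simp: full_norm_def fun_eq_iff abs_mult distrib_left)
  then show ?thesis
    using Lp_scale(2)[OF _ full_norm_Lp[OF assms], of "\<bar>k\<bar>"] beta by (simp add: test_norm_full)
qed

lemma test_norm_diff_le: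
  assumes "u \<in> test_functions A" "v \<in> test_functions A"
  shows "\<bar>test_norm A \<mu> \<beta> u - test_norm A \<mu> \<beta> v\<bar> \<le> test_norm A \<mu> \<beta> (\<lambda>x. u x - v x)"
proof -
  have 1: "test_norm A \<mu> \<beta> u \<le> test_norm A \<mu> \<beta> (\<lambda>x. u x - v x) + test_norm A \<mu> \<beta> v"
    using test_norm_add[OF test_diff[OF assms] assms(2)] by simp
  have "test_norm A \<mu> \<beta> (\<lambda>x. v x - u x) = test_norm A \<mu> \<beta> (\<lambda>x. u x - v x)"
    using test_norm_scale[OF test_diff[OF assms], of "-1"] by simp
  then have "test_norm A \<mu> \<beta> v \<le> test_norm A \<mu> \<beta> (\<lambda>x. u x - v x) + test_norm A \<mu> \<beta> u"
    using test_norm_add[OF test_diff[OF assms(2,1)] assms(1)] by simp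
  with 1 show ?thesis by linarith
qed

section \<open>Approximating sequences\<close>

lemma approx_test: "sobolev_approx A \<mu> \<beta> f u \<Longrightarrow> u n \<in> test_functions A"
  by (simp add: sobolev_approx_def)

text \<open>The norms along an approximating sequence form a Cauchy sequence of reals, so
  \<open>lim\<close> is a genuine limit and not an unspecified value.\<close>

lemma approx_limit:
  assumes "sobolev_approx A \<mu> \<beta> f u"
  shows "(\<lambda>n. test_norm A \<mu> \<beta> (u n)) \<longlonglongrightarrow> lim (\<lambda>n. test_norm A \<mu> \<beta> (u n))"
    "lim (\<lambda>n. test_norm A \<mu> \<beta> (u n)) \<ge> 0"
proof -
  have "Cauchy (\<lambda>n. test_norm A \<mu> \<beta> (u n))"
  proof (rule metric_CauchyI)
    fix e :: real assume "e > 0"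
    then obtain N where N: "\<forall>m\<ge>N. \<forall>n\<ge>N. test_norm A \<mu> \<beta> (\<lambda>x. u m x - u n x) < e"
      using assms unfolding sobolev_approx_def by blast
    have "dist (test_norm A \<mu> \<beta> (u m)) (test_norm A \<mu> \<beta> (u n)) < e" if "m \<ge> N" "n \<ge> N" for m n
      using N that test_norm_diff_le[OF approx_test[OF assms, of m] approx_test[OF assms, of n]]
      unfolding dist_real_def by (meson le_less_trans)
    then show "\<exists>N. \<forall>m\<ge>N. \<forall>n\<ge>N. dist (test_norm A \<mu> \<beta> (u m)) (test_norm A \<mu> \<beta> (u n)) < e"
      by blast
  qed
  then show *: "(\<lambda>n. test_norm A \<mu> \<beta> (u n)) \<longlonglongrightarrow> lim (\<lambda>n. test_norm A \<mu> \<beta> (u n))"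
    using Cauchy_convergent_iff convergent_LIMSEQ_iff by blast
  show "lim (\<lambda>n. test_norm A \<mu> \<beta> (u n)) \<ge> 0"
    by (rule LIMSEQ_le_const[OF *]) simp
qed

lemma sobolev_norm_le:
  assumes "sobolev_approx A \<mu> \<beta> f u"
  shows "sobolev_norm A \<mu> \<beta> f \<le> lim (\<lambda>n. test_norm A \<mu> \<beta> (u n))"
  unfolding sobolev_norm_def
proof (rule cInf_lower)
  show "bdd_below {lim (\<lambda>n. test_norm A \<mu> \<beta> (u n)) |u. sobolev_approx A \<mu> \<beta> f u}"
    using approx_limit(2) by (intro bdd_belowI[of _ 0]) blast
qed (use assms in blast)

text \<open>The way to pass to the norm of \<open>f\<close>: an estimate is proved along each
  approximating sequence and the infimum is taken at the end. Membership in the space makes the set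
  of limits nonempty, without which its \<open>Inf\<close> would be unspecified.\<close>

lemma sobolev_norm_ge:
  assumes "f \<in> sobolev_space A \<mu> \<beta>" "k \<ge> 0"
    "\<And>u. sobolev_approx A \<mu> \<beta> f u \<Longrightarrow> X \<le> k * lim (\<lambda>n. test_norm A \<mu> \<beta> (u n))"
  shows "X \<le> k * sobolev_norm A \<mu> \<beta> f"
proof -
  obtain u where u: "sobolev_approx A \<mu> \<beta> f u"
    using assms(1) unfolding sobolev_space_def by blast
  show ?thesis
  proof (cases "k = 0")
    case False
    then have k: "k > 0" using assms(2) by simp
    have "X / k \<le> sobolev_norm A \<mu> \<beta> f"
      unfolding sobolev_norm_def
    proof (rule cInf_greatest)
      fix y assume "y \<in> {lim (\<lambda>n. test_norm A \<mu> \<beta> (u n)) |u. sobolev_approx A \<mu> \<beta> f u}"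
      then obtain u where "sobolev_approx A \<mu> \<beta> f u" "y = lim (\<lambda>n. test_norm A \<mu> \<beta> (u n))" by blast
      then show "X / k \<le> y"
        using assms(3)[of u] k by (simp add: field_simps)
    qed (use u in blast)
    then show ?thesis using k by (simp add: field_simps)
  qed (use assms(3)[OF u] in simp)
qed

lemma approx_combination:
  assumes f: "f \<in> Lp_space \<mu> \<beta>" "sobolev_approx A \<mu> \<beta> f u"
    and g: "g \<in> Lp_space \<mu> \<beta>" "sobolev_approx A \<mu> \<beta> g v"
  shows "sobolev_approx A \<mu> \<beta> (\<lambda>x. a * f x + b * g x) (\<lambda>n x. a * u n x + b * v n x)"
    "lim (\<lambda>n. test_norm A \<mu> \<beta> (\<lambda>x. a * u n x + b * v n x))
      \<le> \<bar>a\<bar> * lim (\<lambda>n. test_norm A \<mu> \<beta> (u n)) + \<bar>b\<bar> * lim (\<lambda>n. test_norm A \<mu> \<beta> (v n))"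
proof -
  note U = approx_test[OF f(2)] and V = approx_test[OF g(2)]
  have p: "\<beta> \<ge> 1" "\<beta> > 0" using beta by auto
  have le: "test_norm A \<mu> \<beta> (\<lambda>x. a * s x + b * t x) \<le> \<bar>a\<bar> * test_norm A \<mu> \<beta> s + \<bar>b\<bar> * test_norm A \<mu> \<beta> t"
    if "s \<in> test_functions A" "t \<in> test_functions A" for s t
    using test_norm_add[OF test_scale[OF that(1), of a] test_scale[OF that(2), of b]]
    by (simp add: test_norm_scale that)
  show approx: "sobolev_approx A \<mu> \<beta> (\<lambda>x. a * f x + b * g x) (\<lambda>n x. a * u n x + b * v n x)"
    unfolding sobolev_approx_def
  proof (intro conjI allI impI)
    show "(\<lambda>x. a * u n x + b * v n x) \<in> test_functions A" for n
      by (intro test_add test_scale U V)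
    fix e :: real assume e: "e > 0"
    define e' where "e' = e / (\<bar>a\<bar> + \<bar>b\<bar> + 1)"
    have den: "\<bar>a\<bar> + \<bar>b\<bar> + 1 > 0" by linarith
    have e': "e' > 0" "(\<bar>a\<bar> + \<bar>b\<bar>) * e' < e"
      using e den by (simp_all add: e'_def field_simps)
    obtain N1 where N1: "\<forall>m\<ge>N1. \<forall>n\<ge>N1. test_norm A \<mu> \<beta> (\<lambda>x. u m x - u n x) < e'"
      using f(2) e'(1) unfolding sobolev_approx_def by blast
    obtain N2 where N2: "\<forall>m\<ge>N2. \<forall>n\<ge>N2. test_norm A \<mu> \<beta> (\<lambda>x. v m x - v n x) < e'"
      using g(2) e'(1) unfolding sobolev_approx_def by blast
    have "test_norm A \<mu> \<beta> (\<lambda>x. a * u m x + b * v m x - (a * u n x + b * v n x)) < e"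
      if "m \<ge> max N1 N2" "n \<ge> max N1 N2" for m n
    proof -
      have "(\<lambda>x. a * u m x + b * v m x - (a * u n x + b * v n x)) = (\<lambda>x. a * (u m x - u n x) + b * (v m x - v n x))"
        by (simp add: algebra_simps)
      then have "test_norm A \<mu> \<beta> (\<lambda>x. a * u m x + b * v m x - (a * u n x + b * v n x))
          \<le> \<bar>a\<bar> * test_norm A \<mu> \<beta> (\<lambda>x. u m x - u n x) + \<bar>b\<bar> * test_norm A \<mu> \<beta> (\<lambda>x. v m x - v n x)"
        using le[OF test_diff[OF U U] test_diff[OF V V], of m n m n] by simp
      also have "\<dots> \<le> \<bar>a\<bar> * e' + \<bar>b\<bar> * e'"
      proof (intro add_mono mult_left_mono)
        show "test_norm A \<mu> \<beta> (\<lambda>x. u m x - u n x) \<le> e'" "test_norm A \<mu> \<beta> (\<lambda>x. v m x - v n x) \<le> e'"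
          using N1 N2 that by (simp_all add: less_imp_le)
      qed auto
      also have "\<dots> < e"
        using e'(2) by (simp add: distrib_right)
      finally show ?thesis .
    qed
    then show "\<exists>N. \<forall>m\<ge>N. \<forall>n\<ge>N. test_norm A \<mu> \<beta> (\<lambda>x. a * u m x + b * v m x - (a * u n x + b * v n x)) < e"
      by blast
  next
    have F: "(\<lambda>n. Lp_norm \<mu> \<beta> (\<lambda>x. u n x - f x)) \<longlonglongrightarrow> 0" and G: "(\<lambda>n. Lp_norm \<mu> \<beta> (\<lambda>x. v n x - g x)) \<longlonglongrightarrow> 0"
      using f(2) g(2) unfolding sobolev_approx_def by auto
    show "(\<lambda>n. Lp_norm \<mu> \<beta> (\<lambda>x. a * u n x + b * v n x - (a * f x + b * g x))) \<longlonglongrightarrow> 0"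
    proof (rule tendsto_sandwich[OF always_eventually always_eventually tendsto_const])
      show "(\<lambda>n. \<bar>a\<bar> * Lp_norm \<mu> \<beta> (\<lambda>x. u n x - f x) + \<bar>b\<bar> * Lp_norm \<mu> \<beta> (\<lambda>x. v n x - g x)) \<longlonglongrightarrow> 0"
        using tendsto_add_zero[OF tendsto_mult_right_zero[OF F] tendsto_mult_right_zero[OF G]] .
      show "\<forall>n. Lp_norm \<mu> \<beta> (\<lambda>x. a * u n x + b * v n x - (a * f x + b * g x))
          \<le> \<bar>a\<bar> * Lp_norm \<mu> \<beta> (\<lambda>x. u n x - f x) + \<bar>b\<bar> * Lp_norm \<mu> \<beta> (\<lambda>x. v n x - g x)"
      proof
        fix n
        have 1: "(\<lambda>x. u n x - f x) \<in> Lp_space \<mu> \<beta>" "(\<lambda>x. v n x - g x) \<in> Lp_space \<mu> \<beta>"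
          by (intro Lp_diff(1)[OF p(1)] test_Lp U V f g)+
        have "(\<lambda>x. a * u n x + b * v n x - (a * f x + b * g x)) = (\<lambda>x. a * (u n x - f x) + b * (v n x - g x))"
          by (simp add: algebra_simps)
        then show "Lp_norm \<mu> \<beta> (\<lambda>x. a * u n x + b * v n x - (a * f x + b * g x))
          \<le> \<bar>a\<bar> * Lp_norm \<mu> \<beta> (\<lambda>x. u n x - f x) + \<bar>b\<bar> * Lp_norm \<mu> \<beta> (\<lambda>x. v n x - g x)"
          using Lp_add(2)[OF p(1) Lp_scale(1)[OF p(2) 1(1), of a] Lp_scale(1)[OF p(2) 1(2), of b]]
          by (simp add: Lp_scale(2)[OF p(2)] 1)
      qed
    qed simp
  qed
  show "lim (\<lambda>n. test_norm A \<mu> \<beta> (\<lambda>x. a * u n x + b * v n x))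
      \<le> \<bar>a\<bar> * lim (\<lambda>n. test_norm A \<mu> \<beta> (u n)) + \<bar>b\<bar> * lim (\<lambda>n. test_norm A \<mu> \<beta> (v n))"
  proof (rule LIMSEQ_le[OF approx_limit(1)[OF approx]])
    show "(\<lambda>n. \<bar>a\<bar> * test_norm A \<mu> \<beta> (u n) + \<bar>b\<bar> * test_norm A \<mu> \<beta> (v n))
      \<longlonglongrightarrow> \<bar>a\<bar> * lim (\<lambda>n. test_norm A \<mu> \<beta> (u n)) + \<bar>b\<bar> * lim (\<lambda>n. test_norm A \<mu> \<beta> (v n))"
      by (intro tendsto_intros approx_limit(1)[OF f(2)] approx_limit(1)[OF g(2)])
  qed (use le[OF U V] in blast)
qed

lemma approx_cong_AE:
  assumes "sobolev_approx A \<mu> \<beta> f u" "f \<in> borel_measurable \<mu>" "g \<in> borel_measurable \<mu>" "AE x in \<mu>. f x = g x"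
  shows "sobolev_approx A \<mu> \<beta> g u"
proof -
  have "Lp_norm \<mu> \<beta> (\<lambda>x. u n x - f x) = Lp_norm \<mu> \<beta> (\<lambda>x. u n x - g x)" for n
    using measurable_continuous[OF test_continuous[OF approx_test[OF assms(1)]]] assms(2-4)
    by (intro Lp_norm_cong_AE borel_measurable_diff) (auto elim: eventually_mono)
  then show ?thesis
    using assms(1) by (simp add: sobolev_approx_def)
qed

lemma approx_Lp_norm_le:
  assumes f: "f \<in> Lp_space \<mu> \<beta>" and u: "sobolev_approx A \<mu> \<beta> f u"
  shows "Lp_norm \<mu> \<beta> f \<le> lim (\<lambda>n. test_norm A \<mu> \<beta> (u n))"
proof -
  have p: "\<beta> \<ge> 1" using beta by simp
  have z: "(\<lambda>n. Lp_norm \<mu> \<beta> (\<lambda>x. u n x - f x)) \<longlonglongrightarrow> 0"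
    using u unfolding sobolev_approx_def by auto
  have "Lp_norm \<mu> \<beta> f \<le> test_norm A \<mu> \<beta> (u n) + Lp_norm \<mu> \<beta> (\<lambda>x. u n x - f x)" for n
  proof -
    note t = test_Lp[OF approx_test[OF u, of n]]
    show ?thesis
      using Lp_diff(2)[OF p t(1) Lp_diff(1)[OF p t(1) f]] t(2) by simp
  qed
  then have "Lp_norm \<mu> \<beta> f \<le> lim (\<lambda>n. test_norm A \<mu> \<beta> (u n)) + 0"
    by (intro LIMSEQ_le_const[OF tendsto_add[OF approx_limit(1)[OF u] z]]) blast
  then show ?thesis by simp
qed

subsection \<open>Lipschitz functions in the Sobolev space\<close>

text \<open>The bound must involve the pointwise constants \<open>C\<close> and \<open>D\<close>,
  not the uniform bound \<open>B\<close> of the mollifications, which depends on the charts. Hence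
  only the excess of \<open>full_norm (w n)\<close> over \<open>(C + D) * indicator Q\<close> is
  estimated, and this tends to 0.\<close>

lemma lipschitz_sobolev:
  assumes lip: "lipschitz f" and supp: "closure {y. f y \<noteq> 0} \<subseteq> ball x r" and C: "C \<ge> 0" "D \<ge> 0"
    and bd: "AE y in \<mu>. \<bar>f y\<bar> \<le> C" "AE y in \<mu>. grad_norm A f y \<le> D"
  obtains w where "sobolev_approx A \<mu> \<beta> f w"
    "lim (\<lambda>n. test_norm A \<mu> \<beta> (w n)) \<le> (C + D) * measure \<mu> (ball x r) powr (1 / \<beta>)" "f \<in> Lp_space \<mu> \<beta>"
proof -
  have p: "\<beta> \<ge> 1" "\<beta> > 0" using beta by auto
  let ?Q = "ball x r"
  have "compactly_supported f"
    unfolding compactly_supported_def using bounded_subset[OF bounded_ball supp]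
    by (intro compact_of_closed_bounded) auto
  then have "mollifiable f" using lipschitz_mollifiable[OF lip] by blast
  then obtain w K B where w: "compact K" "\<forall>n. w n \<in> test_functions A"
    "\<forall>n p. \<bar>w n p\<bar> \<le> B \<and> grad_norm A (w n) p \<le> B" "\<forall>n p. p \<notin> K \<longrightarrow> w n p = 0"
    "\<forall>p. (\<lambda>n. w n p) \<longlonglongrightarrow> f p"
    "AE p in \<mu>. mdifferentiable f p \<and> (\<lambda>n. grad_norm A (\<lambda>x. w n x - f x) p) \<longlonglongrightarrow> 0"
    unfolding mollifiable_def by blast
  have wt: "w n \<in> test_functions A" for n using w(2) by blast
  have B0: "B \<ge> 0" using w(3)[rule_format, of 0 x] by linarith
  have K: "K \<in> sets \<mu>" "emeasure \<mu> K < \<infinity>" "closed K"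
    using w(1) compact_emeasure borel_compact compact_imp_closed by auto
  have f0: "f p = 0" if "p \<notin> K" for p
  proof -
    have "(\<lambda>n. w n p) \<longlonglongrightarrow> 0" using w(4) that by simp
    then show ?thesis using w(5) LIMSEQ_unique by blast
  qed
  have fB: "\<bar>f p\<bar> \<le> B" for p
    by (rule LIMSEQ_le_const2[OF tendsto_rabs[OF w(5)[rule_format, of p]]]) (use w(3) in auto)
  have fm: "f \<in> borel_measurable \<mu>"
    by (rule measurable_continuous[OF lipschitz_continuous[OF lip]])
  have fLp: "f \<in> Lp_space \<mu> \<beta>"
    by (rule Lp_bounded(1)[OF p(2) fm K(1,2) _ B0]) (use f0 fB B0 in \<open>auto simp: indicator_def\<close>)
  have full0: "full_norm (w n) p = 0" if "p \<notin> K" for n p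
    by (rule full_norm_outside[OF K(3) _ that]) (use w(4) in auto)
  have fullB: "full_norm (w n) p \<le> 2 * B" for n p
    using w(3)[rule_format, of n p] by (simp add: full_norm_def)
  have diff0: "full_norm (\<lambda>y. w m y - w n y) p = 0" if "p \<notin> K" for m n p
    by (rule full_norm_outside[OF K(3) _ that]) (use w(4) in auto)
  have full_diff: "full_norm (\<lambda>y. w m y - w n y) p \<le> full_norm (w m) p + full_norm (w n) p" for m n p
    using grad_norm_diff(2)[of "w m" p "w n", OF test_mdifferentiable[OF wt] test_mdifferentiable[OF wt]]
      abs_triangle_ineq4[of "w m p" "w n p"] unfolding full_norm_def by linarith
  \<comment> \<open>Argued by contradiction, because dominated convergence applies to sequences: a
    failure selects one sequence of pairs \<open>(m N, n N)\<close> along which the norms stay at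
    least \<open>e\<close>.\<close>
  have cauchy: "\<exists>N. \<forall>m\<ge>N. \<forall>n\<ge>N. test_norm A \<mu> \<beta> (\<lambda>y. w m y - w n y) < e" if e: "e > 0" for e
  proof (rule ccontr)
    assume "\<not> ?thesis"
    then have "\<forall>N. \<exists>m n. m \<ge> N \<and> n \<ge> N \<and> test_norm A \<mu> \<beta> (\<lambda>y. w m y - w n y) \<ge> e"
      by (metis not_le)
    then obtain m n where mn: "\<And>N. m N \<ge> N" "\<And>N. n N \<ge> N"
      "\<And>N. test_norm A \<mu> \<beta> (\<lambda>y. w (m N) y - w (n N) y) \<ge> e"
      by metis
    have mt: "filterlim m at_top sequentially" "filterlim n at_top sequentially"
      using mn(1,2) by (auto intro: filterlim_at_top_mono[OF filterlim_ident])
    \<comment> \<open>Each of the two functions has \<open>full_norm\<close> at most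
      \<open>2 * B\<close>, whence the dominating constant \<open>4 * B\<close>.\<close>
    have "(\<lambda>N. Lp_norm \<mu> \<beta> (full_norm (\<lambda>y. w (m N) y - w (n N) y))) \<longlonglongrightarrow> 0"
    proof (rule Lp_norm_dominated_0[where B = "4 * B", OF p(2) _ K(1,2)])
      show "full_norm (\<lambda>y. w (m N) y - w (n N) y) \<in> borel_measurable \<mu>" for N
        by (intro measurable_continuous full_norm_continuous test_diff wt)
      show "AE y in \<mu>. \<bar>full_norm (\<lambda>y. w (m N) y - w (n N) y) y\<bar> \<le> 4 * B * indicator K y" for N
      proof (rule AE_I2)
        fix y
        show "\<bar>full_norm (\<lambda>y. w (m N) y - w (n N) y) y\<bar> \<le> 4 * B * indicator K y"
          using diff0[of y "m N" "n N"] full_diff[of "m N" "n N" y] fullB[of "m N" y] fullB[of "n N" y]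
            full_norm_nonneg[of "\<lambda>y. w (m N) y - w (n N) y" y] by (cases "y \<in> K") auto
      qed
      show "4 * B \<ge> 0" using B0 by simp
      show "AE y in \<mu>. (\<lambda>N. full_norm (\<lambda>y. w (m N) y - w (n N) y) y) \<longlonglongrightarrow> 0"
        using w(6)
      proof eventually_elim
        case (elim y)
        have "(\<lambda>N. w (m N) y - w (n N) y) \<longlonglongrightarrow> f y - f y"
          using w(5) filterlim_compose[OF _ mt(1)] filterlim_compose[OF _ mt(2)] by (intro tendsto_diff) blast+
        then have 1: "(\<lambda>N. \<bar>w (m N) y - w (n N) y\<bar>) \<longlonglongrightarrow> 0"
          by (simp add: tendsto_rabs_zero)
        have g: "(\<lambda>n. grad_norm A (\<lambda>x. w n x - f x) y) \<longlonglongrightarrow> 0" using elim by simp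
        have 2: "(\<lambda>N. grad_norm A (\<lambda>x. w (m N) x - f x) y + grad_norm A (\<lambda>x. w (n N) x - f x) y) \<longlonglongrightarrow> 0"
          using tendsto_add_zero[OF filterlim_compose[OF g mt(1)] filterlim_compose[OF g mt(2)]] .
        have "(\<lambda>N. grad_norm A (\<lambda>y. w (m N) y - w (n N) y) y) \<longlonglongrightarrow> 0"
        proof (rule tendsto_sandwich[OF always_eventually always_eventually tendsto_const 2])
          show "\<forall>N. grad_norm A (\<lambda>y. w (m N) y - w (n N) y) y
              \<le> grad_norm A (\<lambda>x. w (m N) x - f x) y + grad_norm A (\<lambda>x. w (n N) x - f x) y"
          proof
            fix N
            have "mdifferentiable (\<lambda>x. w k x - f x) y" for k
              using elim test_mdifferentiable[OF wt] by (intro grad_norm_diff(1)) auto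
            from grad_norm_diff(2)[OF this[of "m N"] this[of "n N"]]
            show "grad_norm A (\<lambda>y. w (m N) y - w (n N) y) y
              \<le> grad_norm A (\<lambda>x. w (m N) x - f x) y + grad_norm A (\<lambda>x. w (n N) x - f x) y"
              by simp
          qed
        qed (use grad_norm_nonneg in auto)
        with 1 show ?case
          unfolding full_norm_def by (rule tendsto_add_zero)
      qed
    qed
    then have "\<forall>\<^sub>F N in sequentially. Lp_norm \<mu> \<beta> (full_norm (\<lambda>y. w (m N) y - w (n N) y)) < e"
      using e by (rule order_tendstoD)
    then obtain N where "Lp_norm \<mu> \<beta> (full_norm (\<lambda>y. w (m N) y - w (n N) y)) < e"
      unfolding eventually_sequentially by blast
    then show False
      using mn(3)[of N] by (simp add: test_norm_full)
  qed
  have conv: "(\<lambda>n. Lp_norm \<mu> \<beta> (\<lambda>y. w n y - f y)) \<longlonglongrightarrow> 0"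
  proof (rule Lp_norm_dominated_0[where B = "2 * B", OF p(2) _ K(1,2)])
    show "(\<lambda>y. w n y - f y) \<in> borel_measurable \<mu>" for n
      by (intro borel_measurable_diff fm measurable_continuous test_continuous wt)
    show "AE y in \<mu>. \<bar>w n y - f y\<bar> \<le> 2 * B * indicator K y" for n
    proof (rule AE_I2)
      fix y
      show "\<bar>w n y - f y\<bar> \<le> 2 * B * indicator K y"
        using w(3)[rule_format, of n y] w(4) f0[of y] fB[of y] by (cases "y \<in> K") auto
    qed
    show "AE y in \<mu>. (\<lambda>n. w n y - f y) \<longlonglongrightarrow> 0"
      using w(5) by (simp add: LIM_zero_iff)
  qed (use B0 in simp)
  have approx: "sobolev_approx A \<mu> \<beta> f w"
    unfolding sobolev_approx_def using wt cauchy conv by blast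
  \<comment> \<open>The excess. It is supported in \<open>K\<close> and, as \<open>f\<close> itself
    satisfies the bound \<open>(C + D) * indicator ?Q\<close>, dominated by value and gradient of
    \<open>w n - f\<close>.\<close>
  define g where "g = (\<lambda>n y. max 0 (full_norm (w n) y - (C + D) * indicator ?Q y))"
  have g_m: "g n \<in> borel_measurable \<mu>" for n
  proof -
    have "?Q \<in> sets \<mu>" by simp
    then show ?thesis
      unfolding g_def
      by (intro borel_measurable_max borel_measurable_diff borel_measurable_times borel_measurable_const
          borel_measurable_indicator measurable_continuous full_norm_continuous wt)
  qed
  have g_le: "\<bar>g n y\<bar> \<le> 2 * B * indicator K y" for n y
    using full0[of y n] fullB[of n y] C B0 by (cases "y \<in> K") (auto simp: g_def indicator_def)
  have limit_le: "AE y in \<mu>. \<bar>f y\<bar> + grad_norm A f y \<le> (C + D) * indicator ?Q y"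
    using bd
  proof eventually_elim
    case (elim y)
    show ?case
    proof (cases "y \<in> ?Q")
      case False
      then have y: "y \<notin> closure {y. f y \<noteq> 0}" using supp by blast
      then have "f y = 0"
        using closure_subset[of "{y. f y \<noteq> 0}"] by blast
      moreover have "grad_norm A f y = 0"
        by (rule grad_norm_zero_outside_support(1)[OF y])
      ultimately have "f y = 0" "grad_norm A f y = 0" by auto
      then show ?thesis using False by simp
    qed (use elim in simp)
  qed
  have g_lim: "(\<lambda>n. Lp_norm \<mu> \<beta> (g n)) \<longlonglongrightarrow> 0"
  proof (rule Lp_norm_dominated_0[where B = "2 * B", OF p(2) g_m K(1,2)])
    show "AE y in \<mu>. (\<lambda>n. g n y) \<longlonglongrightarrow> 0"
      using w(6) limit_le
    proof eventually_elim
      case (elim y)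
      have gr: "(\<lambda>n. grad_norm A (\<lambda>x. w n x - f x) y) \<longlonglongrightarrow> 0" using elim by simp
      have "(\<lambda>n. w n y - f y) \<longlonglongrightarrow> 0"
        using w(5) by (simp add: LIM_zero_iff)
      then have lim: "(\<lambda>n. \<bar>w n y - f y\<bar> + grad_norm A (\<lambda>x. w n x - f x) y) \<longlonglongrightarrow> 0"
        using gr by (intro tendsto_add_zero tendsto_rabs_zero)
      show ?case
      proof (rule tendsto_sandwich[OF always_eventually always_eventually tendsto_const lim])
        show "\<forall>n. g n y \<le> \<bar>w n y - f y\<bar> + grad_norm A (\<lambda>x. w n x - f x) y"
        proof
          fix n
          have "mdifferentiable (\<lambda>x. w n x - f x) y"
            using elim test_mdifferentiable[OF wt] by (intro grad_norm_diff(1)) auto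
          from grad_norm_add(2)[OF this, of f]
          have "grad_norm A (w n) y \<le> grad_norm A (\<lambda>x. w n x - f x) y + grad_norm A f y"
            using elim by simp
          then have "full_norm (w n) y \<le> (\<bar>w n y - f y\<bar> + grad_norm A (\<lambda>x. w n x - f x) y) + (\<bar>f y\<bar> + grad_norm A f y)"
            unfolding full_norm_def by linarith
          then show "g n y \<le> \<bar>w n y - f y\<bar> + grad_norm A (\<lambda>x. w n x - f x) y"
            using elim(2) grad_norm_nonneg[of "\<lambda>x. w n x - f x" y] unfolding g_def by simp
        qed
      qed (simp add: g_def)
    qed
  qed (use g_le B0 in auto)
  have Q: "?Q \<in> sets \<mu>" "emeasure \<mu> ?Q < \<infinity>"
    using emeasure_ball_finite by auto
  have CD: "C + D \<ge> 0" using C by simp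
  have hQ: "(\<lambda>y. (C + D) * indicator ?Q y) \<in> Lp_space \<mu> \<beta>"
    "Lp_norm \<mu> \<beta> (\<lambda>y. (C + D) * indicator ?Q y) \<le> (C + D) * measure \<mu> ?Q powr (1 / \<beta>)"
  proof -
    have m: "(\<lambda>y. (C + D) * indicator ?Q y) \<in> borel_measurable \<mu>"
      by (intro borel_measurable_times borel_measurable_indicator Q(1)) simp
    have le: "AE y in \<mu>. \<bar>(C + D) * indicator ?Q y\<bar> \<le> (C + D) * indicator ?Q y"
      using CD by simp
    show "(\<lambda>y. (C + D) * indicator ?Q y) \<in> Lp_space \<mu> \<beta>"
      "Lp_norm \<mu> \<beta> (\<lambda>y. (C + D) * indicator ?Q y) \<le> (C + D) * measure \<mu> ?Q powr (1 / \<beta>)"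
      by (rule Lp_bounded[OF p(2) m Q le CD])+
  qed
  have gLp: "g n \<in> Lp_space \<mu> \<beta>" for n
    by (rule Lp_bounded(1)[where B = "2 * B", OF p(2) g_m K(1,2)]) (use g_le B0 in auto)
  have test_le: "test_norm A \<mu> \<beta> (w n) \<le> (C + D) * measure \<mu> ?Q powr (1 / \<beta>) + Lp_norm \<mu> \<beta> (g n)" for n
  proof -
    have "test_norm A \<mu> \<beta> (w n) \<le> Lp_norm \<mu> \<beta> (\<lambda>y. (C + D) * indicator ?Q y + g n y)"
      unfolding test_norm_full
    proof (rule Lp_mono(2)[OF p(2)])
      show "full_norm (w n) \<in> borel_measurable \<mu>"
        by (rule measurable_continuous[OF full_norm_continuous[OF wt]])
      show "(\<lambda>y. (C + D) * indicator ?Q y + g n y) \<in> Lp_space \<mu> \<beta>"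
        by (rule Lp_add(1)[OF p(1) hQ(1) gLp])
      have "full_norm (w n) y \<le> (C + D) * indicator ?Q y + g n y" for y
        unfolding g_def by linarith
      then show "AE y in \<mu>. \<bar>full_norm (w n) y\<bar> \<le> \<bar>(C + D) * indicator ?Q y + g n y\<bar>"
        using full_norm_nonneg by (auto intro: order_trans[OF _ abs_ge_self])
    qed
    also have "\<dots> \<le> Lp_norm \<mu> \<beta> (\<lambda>y. (C + D) * indicator ?Q y) + Lp_norm \<mu> \<beta> (g n)"
      by (rule Lp_add(2)[OF p(1) hQ(1) gLp])
    finally show ?thesis using hQ(2) by linarith
  qed
  have "(\<lambda>n. (C + D) * measure \<mu> ?Q powr (1 / \<beta>) + Lp_norm \<mu> \<beta> (g n)) \<longlonglongrightarrow> (C + D) * measure \<mu> ?Q powr (1 / \<beta>) + 0"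
    by (intro tendsto_add g_lim tendsto_const)
  then have "lim (\<lambda>n. test_norm A \<mu> \<beta> (w n)) \<le> (C + D) * measure \<mu> ?Q powr (1 / \<beta>) + 0"
    by (rule LIMSEQ_le[OF approx_limit(1)[OF approx]]) (use test_le in blast)
  then show thesis
    using that approx fLp by simp
qed

end

section \<open>Averages of functions supported in a ball\<close>

context riem_man
begin

text \<open>In \<open>ennreal\<close> the infimum of the empty set is \<open>top\<close>, so a
  finite distance provides a joining curve, along which the distance from \<open>x\<close> takes all
  intermediate values.\<close>

lemma exists_at_distance:
  fixes x y :: 'a
  assumes "0 \<le> s" "s \<le> dist x y"
  obtains z where "dist x z = s"
proof -
  have "riemannian_distance A x y \<noteq> top"
    using dist[of x y] by (metis ennreal_neq_top)
  then have "{\<gamma>. pw_C1_curve A \<gamma> \<and> pathstart \<gamma> = x \<and> pathfinish \<gamma> = y} \<noteq> {}"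
    unfolding riemannian_distance_def by (metis Inf_empty image_empty)
  then obtain \<gamma> where \<gamma>: "path \<gamma>" "\<gamma> 0 = x" "\<gamma> 1 = y"
    by (auto simp: pw_C1_curve_def pathstart_def pathfinish_def)
  have "continuous_on {0..1} (\<lambda>t. dist x (\<gamma> t))"
    using \<gamma>(1) unfolding path_def by (intro continuous_intros)
  then obtain t where "dist x (\<gamma> t) = s"
    using IVT'[of "\<lambda>t. dist x (\<gamma> t)" 0 s 1] assms \<gamma> by auto
  then show thesis using that by blast
qed

text \<open>The dimension is positive, so the open image of a chart contains a second point. The
  distance of the two points is the scale against which radii are measured in
  \<open>B_op_sobolev\<close>.\<close>

lemma two_points: obtains p q :: 'a where "p \<noteq> q"
proof -
  fix p0 :: 'a
  define c where "c = chart_at A p0"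
  note c = chart_at[of p0, folded c_def]
  have v: "coord c p0 \<in> coord c ` dom c" using c by blast
  obtain e where e: "e > 0" "cball (coord c p0) e \<subseteq> coord c ` dom c"
    using open_coord[OF c(1)] v open_contains_cball by blast
  obtain b :: "real ^ 'n" where b: "norm b = 1"
    using vector_choose_size[of 1] by auto
  define z where "z = coord c p0 + e *\<^sub>R b"
  have "z \<in> coord c ` dom c"
    using e b by (intro subsetD[OF e(2)]) (simp add: z_def dist_norm)
  moreover have "z \<noteq> coord c p0"
    using e b by (auto simp: z_def)
  ultimately obtain q where "coord c q \<noteq> coord c p0"
    by auto
  then show thesis
    using that[of p0 q] by auto
qed

end

context riem_sobolev
begin

section \<open>Averages over balls\<close>

lemma measure_ball_mono: "S \<subseteq> ball x r \<Longrightarrow> S \<in> sets borel \<Longrightarrow> measure \<mu> S \<le> measure \<mu> (ball x r)"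
  using emeasure_ball_finite by (intro measure_mono_fmeasurable fmeasurableI) auto

lemma average_eq: "average \<mu> S f = (\<integral>y. indicator S y * f y \<partial>\<mu>) / measure \<mu> S"
  by (simp add: average_def set_lebesgue_integral_def)

lemma average_bound:
  assumes "r > 0" "g \<in> Lp_space \<mu> \<beta>"
  shows "\<bar>average \<mu> (ball x r) g\<bar> * measure \<mu> (ball x r) powr (1 / \<beta>) \<le> Lp_norm \<mu> \<beta> g"
proof -
  let ?m = "measure \<mu> (ball x r)"
  have m: "?m > 0" by (rule measure_ball_pos[OF assms(1)])
  have "\<bar>\<integral>y. indicator (ball x r) y * g y \<partial>\<mu>\<bar> \<le> ?m powr (1 - 1 / \<beta>) * Lp_norm \<mu> \<beta> g"
    by (rule Lp_integral_bound(2)[OF beta assms(2) _ emeasure_ball_finite m]) simp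
  then have "\<bar>average \<mu> (ball x r) g\<bar> * ?m powr (1 / \<beta>) \<le> (?m powr (1 - 1 / \<beta>) * Lp_norm \<mu> \<beta> g) / ?m * ?m powr (1 / \<beta>)"
    using m by (intro mult_right_mono) (simp_all add: average_eq abs_divide divide_right_mono)
  also have "\<dots> = Lp_norm \<mu> \<beta> g"
    using m by (simp add: powr_diff)
  finally show ?thesis .
qed

lemma indicator_Lp:
  assumes "S \<in> sets borel" "f \<in> Lp_space \<mu> \<beta>"
  shows "(\<lambda>y. indicator S y * f y) \<in> Lp_space \<mu> \<beta>" "Lp_norm \<mu> \<beta> (\<lambda>y. indicator S y * f y) \<le> Lp_norm \<mu> \<beta> f"
proof -
  have m: "(\<lambda>y. indicator S y * f y) \<in> borel_measurable \<mu>"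
    using Lp_spaceD(1)[OF assms(2)] assms(1) by measurable
  have le: "AE y in \<mu>. \<bar>indicator S y * f y\<bar> \<le> \<bar>f y\<bar>"
    by (auto simp: indicator_def)
  show "(\<lambda>y. indicator S y * f y) \<in> Lp_space \<mu> \<beta>" "Lp_norm \<mu> \<beta> (\<lambda>y. indicator S y * f y) \<le> Lp_norm \<mu> \<beta> f"
    using Lp_mono[OF _ m assms(2) le] beta by auto
qed

lemma const_indicator_Lp_norm: "Lp_norm \<mu> \<beta> (\<lambda>y. indicator (ball x r) y * a) = \<bar>a\<bar> * measure \<mu> (ball x r) powr (1 / \<beta>)"
proof -
  have "\<bar>indicator (ball x r) y * a\<bar> powr \<beta> = \<bar>a\<bar> powr \<beta> * indicator (ball x r) y" for y
    using beta by (simp add: indicator_def)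
  then show ?thesis
    using beta by (simp add: Lp_norm_def powr_mult powr_powr)
qed

lemma const_indicator_Lp: "(\<lambda>y. indicator (ball x r) y * a) \<in> Lp_space \<mu> \<beta>"
proof (rule Lp_bounded(1))
  show "(\<lambda>y. indicator (ball x r) y * a) \<in> borel_measurable \<mu>"
    by (intro borel_measurable_times borel_measurable_indicator borel_measurable_const) simp
  show "AE y in \<mu>. \<bar>indicator (ball x r) y * a\<bar> \<le> \<bar>a\<bar> * indicator (ball x r) y"
    by (intro AE_I2) (simp add: indicator_def)
qed (use beta emeasure_ball_finite in auto)

text \<open>Turns both sides of the Poincare inequality into norms of truncated functions over the
  same factor \<open>measure \<mu> S powr (1 / \<beta>)\<close>, which then cancels.\<close>

lemma average_powr: "average \<mu> S (\<lambda>y. \<bar>h y\<bar> powr \<beta>) powr (1 / \<beta>)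
    = Lp_norm \<mu> \<beta> (\<lambda>y. indicator S y * h y) / measure \<mu> S powr (1 / \<beta>)"
proof -
  have "(\<integral>y. indicator S y * \<bar>h y\<bar> powr \<beta> \<partial>\<mu>) = (\<integral>y. \<bar>indicator S y * h y\<bar> powr \<beta> \<partial>\<mu>)"
    using beta by (intro Bochner_Integration.integral_cong) (auto simp: indicator_def)
  then show ?thesis
    by (simp add: average_eq Lp_norm_def powr_divide)
qed

text \<open>If the space is not exhausted by \<open>2Q\<close>, then \<open>2Q\<close> contains a ball \<open>E\<close> of comparable measure
  outside \<open>Q\<close>, on which a function supported in \<open>Q\<close> vanishes; so the Poincare inequality on \<open>2Q\<close>
  bounds the average itself.\<close>

lemma average_bound_poincare:
  assumes "poincare A \<mu> \<beta>"
  obtains K where "K \<ge> 0" "\<forall>x r y g u. r > 0 \<longrightarrow> 2 * r \<le> dist x y \<longrightarrow> g \<in> Lp_space \<mu> \<beta> \<longrightarrow>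
      (AE z in \<mu>. z \<notin> ball x r \<longrightarrow> g z = 0) \<longrightarrow> sobolev_approx A \<mu> \<beta> g u \<longrightarrow>
      \<bar>average \<mu> (ball x r) g\<bar> * measure \<mu> (ball x r) powr (1 / \<beta>) \<le> K * r * lim (\<lambda>n. test_norm A \<mu> \<beta> (u n))"
proof -
  obtain C where C: "C > 0" "\<And>f x r. compactly_supported f \<Longrightarrow> lipschitz f \<Longrightarrow> r > 0 \<Longrightarrow>
      average \<mu> (ball x r) (\<lambda>y. \<bar>f y - average \<mu> (ball x r) f\<bar> powr \<beta>) powr (1 / \<beta>)
        \<le> C * r * average \<mu> (ball x r) (\<lambda>y. grad_norm A f y powr \<beta>) powr (1 / \<beta>)"
    using assms unfolding poincare_def Let_def by blast
  obtain D where D: "D \<ge> 1" "\<forall>x r n. r > 0 \<longrightarrow> measure \<mu> (ball x (2 ^ n * r)) \<le> D ^ n * measure \<mu> (ball x r)"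
    using measure_doubling by blast
  \<comment> \<open>\<open>D\<close> compares \<open>Q2\<close> with \<open>Q\<close>,
    \<open>D ^ 3\<close> compares \<open>Q\<close> with \<open>E\<close>, and \<open>2 * C\<close>
    is the Poincare constant for the radius \<open>2 * r\<close> with \<open>r\<close> taken
    out.\<close>
  define K where "K = D * (D ^ 3) powr (1 / \<beta>) * (2 * C)"
  have K0: "K \<ge> 0" using D(1) C(1) by (simp add: K_def)
  have "\<bar>average \<mu> (ball x r) g\<bar> * measure \<mu> (ball x r) powr (1 / \<beta>) \<le> K * r * lim (\<lambda>n. test_norm A \<mu> \<beta> (u n))"
    if r: "r > 0" and y: "2 * r \<le> dist x y" and g: "g \<in> Lp_space \<mu> \<beta>"
      and gz: "AE z in \<mu>. z \<notin> ball x r \<longrightarrow> g z = 0" and u: "sobolev_approx A \<mu> \<beta> g u" for x r y g u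
  proof -
    have p: "\<beta> \<ge> 1" "\<beta> > 0" using beta by auto
    define L where "L = lim (\<lambda>n. test_norm A \<mu> \<beta> (u n))"
    \<comment> \<open>Halfway between \<open>r\<close> and \<open>2 * r\<close>, so that the ball of
      radius \<open>r / 2\<close> around \<open>z\<close> lies in \<open>Q2\<close> and misses
      \<open>Q\<close>.\<close>
    obtain z where z: "dist x z = 3 * r / 2"
      using exists_at_distance[of "3 * r / 2" x y] r y by auto
    define Q where "Q = ball x r"
    define Q2 where "Q2 = ball x (2 * r)"
    define E where "E = ball z (r / 2)"
    have EQ2: "E \<subseteq> Q2"
    proof
      fix w assume "w \<in> E"
      then show "w \<in> Q2"
        using dist_triangle[of x w z] z by (simp add: E_def Q2_def)
    qed
    have EQ: "w \<notin> Q" if "w \<in> E" for w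
      using that dist_triangle[of x z w] z r by (simp add: E_def Q_def dist_commute)
    have QQ2: "Q \<subseteq> Q2" using r by (auto simp: Q_def Q2_def)
    have mQ: "measure \<mu> Q > 0" and mE: "measure \<mu> E > 0" and mQ2: "measure \<mu> Q2 > 0"
      using r by (simp_all add: Q_def Q2_def E_def measure_ball_pos)
    have Q2Q: "measure \<mu> Q2 \<le> D * measure \<mu> Q"
      using D(2)[rule_format, of r x 1] r by (simp add: Q_def Q2_def)
    \<comment> \<open>Points of \<open>Q\<close> are within \<open>5 * r / 2\<close> of
      \<open>z\<close>, so three doublings of \<open>r / 2\<close>, giving \<open>4 * r\<close>, are
      enough.\<close>
    have "Q \<subseteq> ball z (2 ^ 3 * (r / 2))"
    proof
      fix w assume "w \<in> Q"
      then show "w \<in> ball z (2 ^ 3 * (r / 2))"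
        using dist_triangle[of z w x] z r by (simp add: Q_def dist_commute)
    qed
    then have "measure \<mu> Q \<le> measure \<mu> (ball z (2 ^ 3 * (r / 2)))"
      by (rule measure_ball_mono) (simp add: Q_def)
    also have "\<dots> \<le> D ^ 3 * measure \<mu> E"
      using D(2)[rule_format, of "r / 2" z 3] r by (simp add: E_def)
    finally have QE: "measure \<mu> Q \<le> D ^ 3 * measure \<mu> E" .
    \<comment> \<open>The Poincare inequality is applied to the test functions \<open>u n\<close>
      instead of \<open>g\<close>; \<delta> records the error, which disappears in the
      limit.\<close>
    define \<delta> where "\<delta> = (\<lambda>n. Lp_norm \<mu> \<beta> (\<lambda>x. u n x - g x))"
    have \<delta>: "\<delta> \<longlonglongrightarrow> 0"
      using u unfolding sobolev_approx_def \<delta>_def by blast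
    define a where "a = (\<lambda>n. average \<mu> Q2 (u n))"
    have ut: "u n \<in> test_functions A" for n by (rule approx_test[OF u])
    have uL: "u n \<in> Lp_space \<mu> \<beta>" for n by (rule test_Lp(1)[OF ut])
    have dL: "(\<lambda>x. u n x - g x) \<in> Lp_space \<mu> \<beta>" for n by (rule Lp_diff(1)[OF p(1) uL g])
    have aL: "(\<lambda>w. indicator S w * a n) \<in> Lp_space \<mu> \<beta>" if "S = E \<or> S = Q2" for S n
      using that const_indicator_Lp by (auto simp: E_def Q2_def)
    have P: "Lp_norm \<mu> \<beta> (\<lambda>w. indicator Q2 w * (u n w - a n)) \<le> 2 * C * r * test_norm A \<mu> \<beta> (u n)" for n
    proof -
      have "compactly_supported (u n)" using ut by (simp add: test_functions_def)
      from C(2)[OF this test_lipschitz[OF ut], of "2 * r" x] r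
      have "average \<mu> Q2 (\<lambda>w. \<bar>u n w - a n\<bar> powr \<beta>) powr (1 / \<beta>)
          \<le> C * (2 * r) * average \<mu> Q2 (\<lambda>w. \<bar>grad_norm A (u n) w\<bar> powr \<beta>) powr (1 / \<beta>)"
        by (simp add: Q2_def a_def grad_norm_nonneg)
      then have "Lp_norm \<mu> \<beta> (\<lambda>w. indicator Q2 w * (u n w - a n))
          \<le> C * (2 * r) * Lp_norm \<mu> \<beta> (\<lambda>w. indicator Q2 w * grad_norm A (u n) w)"
        using mQ2 unfolding average_powr by (simp add: divide_le_cancel)
      also have "\<dots> \<le> C * (2 * r) * test_norm A \<mu> \<beta> (u n)"
      proof (rule mult_left_mono)
        show "Lp_norm \<mu> \<beta> (\<lambda>w. indicator Q2 w * grad_norm A (u n) w) \<le> test_norm A \<mu> \<beta> (u n)"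
          unfolding test_norm_full
        proof (rule Lp_mono(2)[OF p(2) _ full_norm_Lp[OF ut]])
          show "(\<lambda>w. indicator Q2 w * grad_norm A (u n) w) \<in> borel_measurable \<mu>"
            by (intro borel_measurable_times borel_measurable_indicator measurable_continuous test_grad_continuous ut)
            (simp add: Q2_def)
        qed (auto simp: indicator_def full_norm_def grad_norm_nonneg)
      qed (use C r in simp)
      finally show ?thesis by (simp add: mult_ac)
    qed
    have E_bound: "\<bar>a n\<bar> * measure \<mu> E powr (1 / \<beta>) \<le> \<delta> n + 2 * C * r * test_norm A \<mu> \<beta> (u n)" for n
    proof -
      \<comment> \<open>On \<open>E\<close> the constant \<open>a n\<close> is \<open>u n\<close>
        minus the oscillation \<open>u n - a n\<close>. The former is small because \<open>g\<close>
        vanishes there, the latter is controlled by Poincare on \<open>Q2\<close>.\<close>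
      have "(\<lambda>w. indicator E w * a n) = (\<lambda>w. indicator E w * u n w - indicator E w * (indicator Q2 w * (u n w - a n)))"
        using EQ2 by (auto simp: fun_eq_iff indicator_def)
      then have "\<bar>a n\<bar> * measure \<mu> E powr (1 / \<beta>) = Lp_norm \<mu> \<beta> (\<lambda>w. indicator E w * u n w - indicator E w * (indicator Q2 w * (u n w - a n)))"
        using const_indicator_Lp_norm[of z "r / 2" "a n"] by (simp add: E_def)
      also have "\<dots> \<le> Lp_norm \<mu> \<beta> (\<lambda>w. indicator E w * u n w) + Lp_norm \<mu> \<beta> (\<lambda>w. indicator E w * (indicator Q2 w * (u n w - a n)))"
      proof (rule Lp_diff(2)[OF p(1)])
        show "(\<lambda>w. indicator E w * u n w) \<in> Lp_space \<mu> \<beta>"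
          by (rule indicator_Lp(1)[OF _ uL]) (simp add: E_def)
        have "(\<lambda>w. indicator Q2 w * u n w - indicator Q2 w * a n) \<in> Lp_space \<mu> \<beta>"
          by (rule Lp_diff(1)[OF p(1) indicator_Lp(1)[OF _ uL] aL]) (auto simp: Q2_def)
        then have q: "(\<lambda>w. indicator Q2 w * (u n w - a n)) \<in> Lp_space \<mu> \<beta>"
          by (simp add: right_diff_distrib)
        show "(\<lambda>w. indicator E w * (indicator Q2 w * (u n w - a n))) \<in> Lp_space \<mu> \<beta>"
          by (rule indicator_Lp(1)[OF _ q]) (simp add: E_def)
      qed
      also have "Lp_norm \<mu> \<beta> (\<lambda>w. indicator E w * u n w) \<le> \<delta> n"
        unfolding \<delta>_def
      proof (rule Lp_mono(2)[OF p(2) _ dL])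
        show "(\<lambda>w. indicator E w * u n w) \<in> borel_measurable \<mu>"
          by (intro borel_measurable_times borel_measurable_indicator Lp_spaceD(1)[OF uL]) (simp add: E_def)
        show "AE w in \<mu>. \<bar>indicator E w * u n w\<bar> \<le> \<bar>u n w - g w\<bar>"
          using gz by eventually_elim (use EQ in \<open>auto simp: indicator_def Q_def\<close>)
      qed
      also have "Lp_norm \<mu> \<beta> (\<lambda>w. indicator E w * (indicator Q2 w * (u n w - a n))) \<le> 2 * C * r * test_norm A \<mu> \<beta> (u n)"
      proof -
        have "(\<lambda>w. indicator Q2 w * u n w - indicator Q2 w * a n) \<in> Lp_space \<mu> \<beta>"
          by (rule Lp_diff(1)[OF p(1) indicator_Lp(1)[OF _ uL] aL]) (auto simp: Q2_def)
        then have q: "(\<lambda>w. indicator Q2 w * (u n w - a n)) \<in> Lp_space \<mu> \<beta>"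
          by (simp add: right_diff_distrib)
        show ?thesis
          using indicator_Lp(2)[OF _ q, of E] P[of n] by (simp add: E_def)
      qed
      finally show ?thesis by simp
    qed
    \<comment> \<open>As \<open>g\<close> vanishes outside \<open>Q\<close>, its integrals over
      \<open>Q\<close> and \<open>Q2\<close> agree; this transfers the bound on \<open>a n\<close>,
      an average over \<open>Q2\<close>, to the average over \<open>Q\<close>.\<close>
    have g_int: "(\<integral>w. indicator Q2 w * g w \<partial>\<mu>) = average \<mu> Q g * measure \<mu> Q"
    proof -
      have "(\<integral>w. indicator Q2 w * g w \<partial>\<mu>) = (\<integral>w. indicator Q w * g w \<partial>\<mu>)"
      proof (rule integral_cong_AE)
        show "(\<lambda>w. indicator Q2 w * g w) \<in> borel_measurable \<mu>" "(\<lambda>w. indicator Q w * g w) \<in> borel_measurable \<mu>"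
          by (intro borel_measurable_times borel_measurable_indicator Lp_spaceD(1)[OF g]; simp add: Q2_def Q_def)+
        show "AE w in \<mu>. indicator Q2 w * g w = indicator Q w * g w"
          using gz by eventually_elim (use QQ2 in \<open>auto simp: indicator_def Q_def\<close>)
      qed
      then show ?thesis
        using mQ by (simp add: average_eq)
    qed
    have Q2_bound: "\<bar>average \<mu> Q g\<bar> * measure \<mu> Q \<le> measure \<mu> Q2 * \<bar>a n\<bar> + measure \<mu> Q2 powr (1 - 1 / \<beta>) * \<delta> n" for n
    proof -
      have Q2': "Q2 \<in> sets \<mu>" "emeasure \<mu> Q2 < \<infinity>" using emeasure_ball_finite by (simp_all add: Q2_def)
      have iu: "integrable \<mu> (\<lambda>w. indicator Q2 w * u n w)" "integrable \<mu> (\<lambda>w. indicator Q2 w * g w)"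
        by (rule Lp_integral_bound(1)[OF beta uL Q2' mQ2], rule Lp_integral_bound(1)[OF beta g Q2' mQ2])
      have "(\<integral>w. indicator Q2 w * (u n w - g w) \<partial>\<mu>) = measure \<mu> Q2 * a n - average \<mu> Q g * measure \<mu> Q"
        using iu mQ2 by (simp add: right_diff_distrib g_int a_def average_eq[of Q2])
      then have "\<bar>measure \<mu> Q2 * a n - average \<mu> Q g * measure \<mu> Q\<bar> \<le> measure \<mu> Q2 powr (1 - 1 / \<beta>) * \<delta> n"
        using Lp_integral_bound(2)[OF beta dL Q2' mQ2, of n] by (simp add: \<delta>_def)
      moreover have "\<bar>average \<mu> Q g * measure \<mu> Q\<bar> = \<bar>average \<mu> Q g\<bar> * measure \<mu> Q" "\<bar>measure \<mu> Q2 * a n\<bar> = measure \<mu> Q2 * \<bar>a n\<bar>"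
        using mQ mQ2 by (simp_all add: abs_mult)
      ultimately show ?thesis by linarith
    qed
    define e where "e = measure \<mu> E powr (1 / \<beta>)"
    have e: "e > 0" using mE by (simp add: e_def)
    have "\<bar>average \<mu> Q g\<bar> * measure \<mu> Q \<le> measure \<mu> Q2 * ((\<delta> n + 2 * C * r * test_norm A \<mu> \<beta> (u n)) / e) + measure \<mu> Q2 powr (1 - 1 / \<beta>) * \<delta> n" for n
    proof -
      have "\<bar>a n\<bar> \<le> (\<delta> n + 2 * C * r * test_norm A \<mu> \<beta> (u n)) / e"
        using E_bound[of n] e by (simp add: pos_le_divide_eq e_def)
      then have "measure \<mu> Q2 * \<bar>a n\<bar> \<le> measure \<mu> Q2 * ((\<delta> n + 2 * C * r * test_norm A \<mu> \<beta> (u n)) / e)"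
        using mQ2 by (intro mult_left_mono) auto
      then show ?thesis using Q2_bound[of n] by linarith
    qed
    moreover have "(\<lambda>n. measure \<mu> Q2 * ((\<delta> n + 2 * C * r * test_norm A \<mu> \<beta> (u n)) / e) + measure \<mu> Q2 powr (1 - 1 / \<beta>) * \<delta> n)
        \<longlonglongrightarrow> measure \<mu> Q2 * ((0 + 2 * C * r * L) / e) + measure \<mu> Q2 powr (1 - 1 / \<beta>) * 0"
      using e unfolding L_def by (intro tendsto_intros \<delta> approx_limit(1)[OF u]) auto
    ultimately have "\<bar>average \<mu> Q g\<bar> * measure \<mu> Q \<le> measure \<mu> Q2 * ((0 + 2 * C * r * L) / e) + measure \<mu> Q2 powr (1 - 1 / \<beta>) * 0"
      by (intro LIMSEQ_le_const[of _ _ "\<bar>average \<mu> Q g\<bar> * measure \<mu> Q"]) auto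
    also have "\<dots> \<le> (D * measure \<mu> Q) * ((0 + 2 * C * r * L) / e)"
    proof -
      have "(0 + 2 * C * r * L) / e \<ge> 0"
        using C(1) r e approx_limit(2)[OF u] by (simp add: L_def)
      from mult_right_mono[OF Q2Q this] show ?thesis by simp
    qed
    finally have "measure \<mu> Q * \<bar>average \<mu> Q g\<bar> \<le> measure \<mu> Q * (D * (2 * C * r * L / e))"
      by (simp add: mult_ac)
    then have "\<bar>average \<mu> Q g\<bar> \<le> D * (2 * C * r * L / e)"
      using mQ by (simp only: mult_le_cancel_left_pos)
    then have "\<bar>average \<mu> Q g\<bar> * measure \<mu> Q powr (1 / \<beta>) \<le> D * (2 * C * r * L / e) * ((D ^ 3) powr (1 / \<beta>) * e)"
    proof (rule mult_mono)
      have "measure \<mu> Q powr (1 / \<beta>) \<le> (D ^ 3 * measure \<mu> E) powr (1 / \<beta>)"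
        using QE mQ p by (intro powr_mono2) auto
      then show "measure \<mu> Q powr (1 / \<beta>) \<le> (D ^ 3) powr (1 / \<beta>) * e"
        by (simp add: powr_mult e_def)
    qed (use D(1) C(1) r e approx_limit(2)[OF u] in \<open>auto simp: L_def\<close>)
    also have "\<dots> = K * r * L"
      using e by (simp add: K_def)
    finally show ?thesis
      by (simp add: Q_def L_def)
  qed
  then have "\<forall>x r y g u. r > 0 \<longrightarrow> 2 * r \<le> dist x y \<longrightarrow> g \<in> Lp_space \<mu> \<beta> \<longrightarrow>
      (AE z in \<mu>. z \<notin> ball x r \<longrightarrow> g z = 0) \<longrightarrow> sobolev_approx A \<mu> \<beta> g u \<longrightarrow>
      \<bar>average \<mu> (ball x r) g\<bar> * measure \<mu> (ball x r) powr (1 / \<beta>) \<le> K * r * lim (\<lambda>n. test_norm A \<mu> \<beta> (u n))"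
    by blast
  then show thesis by (rule that[OF K0])
qed

text \<open>The norm of the subtracted multiple of \<open>\<phi> x r\<close> is at most
  \<open>\<bar>average\<bar> * (C + C / r) * s\<close>. The term with \<open>C\<close> is handled by
  Holder's inequality (\<open>A1\<close>), the term with \<open>C / r\<close> by the bound with the
  factor \<open>r\<close> (\<open>A2\<close>).\<close>

lemma B_op_sobolev:
  assumes P: "poincare A \<mu> \<beta>" and \<phi>: "adapted_family A \<mu> \<phi>"
  obtains K where "K > 0" "\<forall>x r g u. r > 0 \<longrightarrow> g \<in> Lp_space \<mu> \<beta> \<longrightarrow>
      (AE z in \<mu>. z \<notin> ball x r \<longrightarrow> g z = 0) \<longrightarrow> sobolev_approx A \<mu> \<beta> g u \<longrightarrow>
      B_op \<mu> \<phi> x r g \<in> Lp_space \<mu> \<beta> \<and>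
      (\<exists>v. sobolev_approx A \<mu> \<beta> (B_op \<mu> \<phi> x r g) v \<and>
         lim (\<lambda>n. test_norm A \<mu> \<beta> (v n)) \<le> K * lim (\<lambda>n. test_norm A \<mu> \<beta> (u n)))"
proof -
  obtain C0 where C0: "\<And>x r. r > 0 \<Longrightarrow> lipschitz (\<phi> x r)" "\<And>x r. r > 0 \<Longrightarrow> closure {y. \<phi> x r y \<noteq> 0} \<subseteq> ball x r"
    "\<And>x r. r > 0 \<Longrightarrow> AE y in \<mu>. \<bar>\<phi> x r y\<bar> \<le> C0" "\<And>x r. r > 0 \<Longrightarrow> AE y in \<mu>. grad_norm A (\<phi> x r) y \<le> C0 / r"
    using \<phi> unfolding adapted_family_def by blast
  define C where "C = max C0 0"
  have C: "C \<ge> 0" "C0 \<le> C" by (simp_all add: C_def)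
  obtain K1 where K1: "K1 \<ge> 0" "\<forall>x r y g u. r > 0 \<longrightarrow> 2 * r \<le> dist x y \<longrightarrow> g \<in> Lp_space \<mu> \<beta> \<longrightarrow>
      (AE z in \<mu>. z \<notin> ball x r \<longrightarrow> g z = 0) \<longrightarrow> sobolev_approx A \<mu> \<beta> g u \<longrightarrow>
      \<bar>average \<mu> (ball x r) g\<bar> * measure \<mu> (ball x r) powr (1 / \<beta>) \<le> K1 * r * lim (\<lambda>n. test_norm A \<mu> \<beta> (u n))"
    using average_bound_poincare[OF P] by blast
  obtain p q :: 'a where pq: "p \<noteq> q" using two_points .
  define d where "d = dist p q"
  have d: "d > 0" using pq by (simp add: d_def)
  \<comment> \<open>\<open>4 / d\<close> is for balls without a point at distance at least
    \<open>2 * r\<close> from the center: then \<open>d \<le> 4 * r\<close>, that is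
    \<open>1 \<le> 4 / d * r\<close>, and \<open>A1\<close> implies \<open>A2\<close>.\<close>
  define K2 where "K2 = K1 + 4 / d"
  define K where "K = 1 + C + C * K2"
  have K2: "K2 \<ge> 0" using K1(1) d by (simp add: K2_def)
  have K: "K > 0" using C K2 by (simp add: K_def add_pos_nonneg)
  have "B_op \<mu> \<phi> x r g \<in> Lp_space \<mu> \<beta> \<and> (\<exists>v. sobolev_approx A \<mu> \<beta> (B_op \<mu> \<phi> x r g) v \<and>
         lim (\<lambda>n. test_norm A \<mu> \<beta> (v n)) \<le> K * lim (\<lambda>n. test_norm A \<mu> \<beta> (u n)))"
    if r: "r > 0" and g: "g \<in> Lp_space \<mu> \<beta>" and gz: "AE z in \<mu>. z \<notin> ball x r \<longrightarrow> g z = 0"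
      and u: "sobolev_approx A \<mu> \<beta> g u" for x r g u
  proof -
    let ?a = "average \<mu> (ball x r) g"
    define s where "s = measure \<mu> (ball x r) powr (1 / \<beta>)"
    define L where "L = lim (\<lambda>n. test_norm A \<mu> \<beta> (u n))"
    have L: "L \<ge> 0" unfolding L_def by (rule approx_limit(2)[OF u])
    have b1: "AE y in \<mu>. \<bar>\<phi> x r y\<bar> \<le> C"
      using C0(3)[OF r, of x] by eventually_elim (use C in linarith)
    have b2: "AE y in \<mu>. grad_norm A (\<phi> x r) y \<le> C / r"
      using C0(4)[OF r, of x]
    proof eventually_elim
      case (elim y)
      then show ?case
        using divide_right_mono[OF C(2), of r] r by linarith
    qed
    have Cr: "C / r \<ge> 0" using C r by simp
    obtain w where w: "sobolev_approx A \<mu> \<beta> (\<phi> x r) w"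
      "lim (\<lambda>n. test_norm A \<mu> \<beta> (w n)) \<le> (C + C / r) * s" "\<phi> x r \<in> Lp_space \<mu> \<beta>"
      using lipschitz_sobolev[OF C0(1)[OF r] C0(2)[OF r] C(1) Cr b1 b2] unfolding s_def by blast
    have B_eq: "B_op \<mu> \<phi> x r g = (\<lambda>y. 1 * g y + (- ?a) * \<phi> x r y)"
      by (simp add: B_op_def)
    note v = approx_combination[OF g u w(3,1), of 1 "- ?a"]
    have p: "\<beta> \<ge> 1" "\<beta> > 0" using beta by auto
    have BL: "B_op \<mu> \<phi> x r g \<in> Lp_space \<mu> \<beta>"
      unfolding B_eq by (intro Lp_add(1)[OF p(1)] Lp_scale(1)[OF p(2)] g w(3))
    have A1: "\<bar>?a\<bar> * s \<le> L"
      using average_bound[OF r g, of x] approx_Lp_norm_le[OF g u] by (simp add: s_def L_def)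
    have A2: "\<bar>?a\<bar> * s \<le> K2 * r * L"
    proof (cases "\<exists>y. 2 * r \<le> dist x y")
      case True
      then have "\<bar>?a\<bar> * s \<le> K1 * r * L"
        using K1(2) r g gz u unfolding s_def L_def by blast
      also have "\<dots> \<le> K2 * r * L"
        using d r L by (intro mult_right_mono) (simp_all add: K2_def)
      finally show ?thesis .
    next
      case False
      then have "d \<le> 4 * r"
        using dist_triangle[of p q x] unfolding d_def by (smt (verit) dist_commute)
      then have "1 \<le> 4 / d * r"
        using d by (simp add: field_simps)
      also have "\<dots> \<le> K2 * r"
        using r K1(1) by (intro mult_right_mono) (simp_all add: K2_def)
      finally have "1 * L \<le> K2 * r * L"
        by (rule mult_right_mono[OF _ L])
      then show ?thesis using A1 by simp
    qed
    have "lim (\<lambda>n. test_norm A \<mu> \<beta> (\<lambda>x. 1 * u n x + (- ?a) * w n x)) \<le> L + \<bar>?a\<bar> * ((C + C / r) * s)"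
      using v(2) mult_left_mono[OF w(2) abs_ge_zero, of ?a] by (simp add: L_def)
    also have "\<bar>?a\<bar> * ((C + C / r) * s) = C * (\<bar>?a\<bar> * s) + C * ((\<bar>?a\<bar> * s) / r)"
      by (simp add: algebra_simps)
    also have "\<dots> \<le> C * L + C * (K2 * L)"
      using A1 A2 r by (intro add_mono mult_left_mono C) (simp_all add: field_simps)
    finally have "lim (\<lambda>n. test_norm A \<mu> \<beta> (\<lambda>x. 1 * u n x + (- ?a) * w n x)) \<le> K * L"
      by (simp add: K_def algebra_simps)
    then show ?thesis
      using BL v(1) unfolding B_eq L_def by blast
  qed
  then have "\<forall>x r g u. r > 0 \<longrightarrow> g \<in> Lp_space \<mu> \<beta> \<longrightarrow>
      (AE z in \<mu>. z \<notin> ball x r \<longrightarrow> g z = 0) \<longrightarrow> sobolev_approx A \<mu> \<beta> g u \<longrightarrow>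
      B_op \<mu> \<phi> x r g \<in> Lp_space \<mu> \<beta> \<and>
      (\<exists>v. sobolev_approx A \<mu> \<beta> (B_op \<mu> \<phi> x r g) v \<and>
         lim (\<lambda>n. test_norm A \<mu> \<beta> (v n)) \<le> K * lim (\<lambda>n. test_norm A \<mu> \<beta> (u n)))"
    by blast
  then show thesis by (rule that[OF K])
qed

end

section \<open>Atoms\<close>

text \<open>The complement of the essential support is a possibly uncountable union of open sets on
  which \<open>f\<close> vanishes almost everywhere; by Lindelof's theorem countably many of them
  suffice.\<close>

lemma AE_zero_outside_ess_support:
  fixes f :: "'a::second_countable_topology \<Rightarrow> real"
  shows "AE x in M. x \<notin> ess_support M f \<longrightarrow> f x = 0"
proof -
  define F where "F = {U. open U \<and> (AE x in M. x \<in> U \<longrightarrow> f x = 0)}"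
  obtain F' where F': "F' \<subseteq> F" "countable F'" "\<Union>F' = \<Union>F"
    using Lindelof[of F] unfolding F_def by blast
  have "AE x in M. \<forall>U\<in>F'. x \<in> U \<longrightarrow> f x = 0"
    using F'(1,2) by (subst AE_ball_countable) (auto simp: F_def)
  then show ?thesis
  proof eventually_elim
    case (elim x)
    have "x \<in> \<Union>F'" if "x \<notin> ess_support M f"
      using that unfolding F'(3) ess_support_def F_def by blast
    then show ?case using elim by blast
  qed
qed

lemma ess_support_subsetI:
  assumes "closed S" "AE x in M. x \<notin> S \<longrightarrow> f x = 0"
  shows "ess_support M f \<subseteq> S"
proof -
  have "- S \<in> {U. open U \<and> (AE x in M. x \<in> U \<longrightarrow> f x = 0)}"
    using assms by auto
  then show ?thesis
    unfolding ess_support_def by blast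
qed

lemma closed_ess_support: "closed (ess_support M f)"
  unfolding ess_support_def by (intro closed_Compl open_Union) auto

section \<open>Comparison of atomic spaces\<close>

lemma atomic_norm_nonneg:
  assumes "f \<in> atomic_space M T"
  shows "atomic_norm M T f \<ge> 0"
  unfolding atomic_norm_def
proof (rule cInf_greatest)
  show "{(\<Sum>i. \<bar>a i\<bar>) | a. \<exists>b. atomic_decomp M T f a b} \<noteq> {}"
    using assms by (auto simp: atomic_space_def)
  fix y assume "y \<in> {(\<Sum>i. \<bar>a i\<bar>) | a. \<exists>b. atomic_decomp M T f a b}"
  then show "0 \<le> y"
    unfolding atomic_decomp_def by (auto intro: suminf_nonneg)
qed

text \<open>Dividing the atoms by \<open>k\<close> is compensated by multiplying the coefficients by
  \<open>k\<close>, which leaves each term of a decomposition unchanged and multiplies the sum of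
  the absolute values by \<open>k\<close>.\<close>

lemma atomic_spaces_eq:
  assumes sub: "S \<subseteq> T" and k: "k > 0" and scale: "\<forall>m\<in>T. (\<lambda>y. m y / k) \<in> S"
  shows "finite_atomic_space M S = finite_atomic_space M T" "atomic_space M S = atomic_space M T"
    "\<And>f. f \<in> atomic_space M S \<Longrightarrow> atomic_norm M T f \<le> atomic_norm M S f"
    "\<And>f. f \<in> atomic_space M S \<Longrightarrow> atomic_norm M S f \<le> k * atomic_norm M T f"
proof -
  have dST: "atomic_decomp M T f a b" if "atomic_decomp M S f a b" for f a b
    using that sub unfolding atomic_decomp_def by blast
  have dTS: "atomic_decomp M S f (\<lambda>i. k * a i) (\<lambda>i y. b i y / k)" if "atomic_decomp M T f a b" for f a b
    using that scale k unfolding atomic_decomp_def by (simp add: abs_mult summable_mult)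
  show "finite_atomic_space M S = finite_atomic_space M T"
  proof (intro equalityI subsetI)
    fix f assume "f \<in> finite_atomic_space M S"
    then show "f \<in> finite_atomic_space M T"
      using sub unfolding finite_atomic_space_def by blast
  next
    fix f assume "f \<in> finite_atomic_space M T"
    then obtain N a b where f: "f \<in> borel_measurable M" "\<forall>i<N. b i \<in> T" "AE x in M. f x = (\<Sum>i<(N::nat). a i * b i x)"
      unfolding finite_atomic_space_def by blast
    have "\<forall>i<N. (\<lambda>y. b i y / k) \<in> S" using f(2) scale by blast
    moreover have "AE x in M. f x = (\<Sum>i<N. (k * a i) * (b i x / k))"
      using f(3) k by simp
    ultimately show "f \<in> finite_atomic_space M S"
      unfolding finite_atomic_space_def using f(1)
      by (intro CollectI conjI exI[of _ N] exI[of _ "\<lambda>i. k * a i"] exI[of _ "\<lambda>i y. b i y / k"])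
  qed
  show eq: "atomic_space M S = atomic_space M T"
    unfolding atomic_space_def using dST dTS by blast
  have nonneg: "(\<Sum>i. \<bar>a i\<bar>) \<ge> 0" if "atomic_decomp M T f a b" for f a b
    using that unfolding atomic_decomp_def by (intro suminf_nonneg) auto
  have bdd: "bdd_below {(\<Sum>i. \<bar>a i\<bar>) | a. \<exists>b. atomic_decomp M T f a b}"
    "bdd_below {(\<Sum>i. \<bar>a i\<bar>) | a. \<exists>b. atomic_decomp M S f a b}" for f
    using nonneg dST by (intro bdd_belowI[of _ 0], blast)+
  show "atomic_norm M T f \<le> atomic_norm M S f" if "f \<in> atomic_space M S" for f
    unfolding atomic_norm_def
  proof (rule cInf_superset_mono[OF _ bdd(1)])
    show "{(\<Sum>i. \<bar>a i\<bar>) | a. \<exists>b. atomic_decomp M S f a b} \<noteq> {}"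
      using that by (auto simp: atomic_space_def)
    show "{(\<Sum>i. \<bar>a i\<bar>) | a. \<exists>b. atomic_decomp M S f a b} \<subseteq> {(\<Sum>i. \<bar>a i\<bar>) | a. \<exists>b. atomic_decomp M T f a b}"
      using dST by blast
  qed
  show "atomic_norm M S f \<le> k * atomic_norm M T f" if "f \<in> atomic_space M S" for f
  proof -
    have ne: "{(\<Sum>i. \<bar>a i\<bar>) | a. \<exists>b. atomic_decomp M T f a b} \<noteq> {}"
      using that dST unfolding atomic_space_def by blast
    have "atomic_norm M S f / k \<le> atomic_norm M T f"
      unfolding atomic_norm_def[of M T]
    proof (rule cInf_greatest[OF ne])
      fix y assume "y \<in> {(\<Sum>i. \<bar>a i\<bar>) | a. \<exists>b. atomic_decomp M T f a b}"
      then obtain a b where ab: "y = (\<Sum>i. \<bar>a i\<bar>)" "atomic_decomp M T f a b" by blast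
      have "atomic_norm M S f \<le> (\<Sum>i. \<bar>k * a i\<bar>)"
        unfolding atomic_norm_def
        by (intro cInf_lower bdd(2) CollectI exI[of _ "\<lambda>i. k * a i"] conjI refl exI) (rule dTS[OF ab(2)])
      also have "\<dots> = k * y"
        using ab k unfolding atomic_decomp_def by (simp add: abs_mult suminf_mult)
      finally show "atomic_norm M S f / k \<le> y"
        using k by (simp add: field_simps)
    qed
    then show ?thesis using k by (simp add: field_simps)
  qed
qed

context riem_sobolev
begin

lemma Lp_locally_integrable:
  assumes "f \<in> Lp_space \<mu> \<beta>"
  shows "f \<in> L1_loc \<mu>"
proof -
  have "set_integrable \<mu> K f" if "compact K" for K
  proof -
    have K: "K \<in> sets \<mu>" "emeasure \<mu> K < \<infinity>"
      using that compact_emeasure borel_compact by auto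
    show ?thesis
    proof (cases "measure \<mu> K > 0")
      case True
      then show ?thesis
        using Lp_integral_bound(1)[OF beta assms K] by (simp add: set_integrable_def)
    next
      \<comment> \<open>\<open>Lp_integral_bound\<close> requires positive measure; on a null set
        the integrand is 0 almost everywhere.\<close>
      case False
      then have "measure \<mu> K = 0"
        using measure_nonneg[of \<mu> K] by linarith
      then have "K \<in> null_sets \<mu>"
        using K by (intro null_setsI) (simp_all add: emeasure_eq_ennreal_measure less_top)
      then have "AE x in \<mu>. 0 = indicator K x *\<^sub>R f x"
        by (intro eventually_mono[OF AE_not_in]) (auto simp: indicator_def)
      moreover have "(\<lambda>x. indicator K x *\<^sub>R f x) \<in> borel_measurable \<mu>"
        by (intro borel_measurable_scaleR borel_measurable_indicator K Lp_spaceD(1)[OF assms])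
      ultimately show ?thesis
        unfolding set_integrable_def by (intro integrable_cong_AE_imp[OF integrable_zero])
    qed
  qed
  then show ?thesis
    using Lp_spaceD(1)[OF assms] by (simp add: L1_loc_def)
qed

lemma integral_ball_support:
  fixes f :: "'a \<Rightarrow> real"
  assumes "f \<in> borel_measurable \<mu>" "AE z in \<mu>. z \<notin> ball x r \<longrightarrow> f z = 0"
  shows "(\<integral>z. indicator (ball x r) z * f z \<partial>\<mu>) = (\<integral>z. f z \<partial>\<mu>)"
proof (rule integral_cong_AE)
  show "(\<lambda>z. indicator (ball x r) z * f z) \<in> borel_measurable \<mu>"
    by (intro borel_measurable_times borel_measurable_indicator assms) simp
  show "AE z in \<mu>. indicator (ball x r) z * f z = f z"
    using assms(2) by eventually_elim (auto simp: indicator_def)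
qed (rule assms(1))

lemma AE_zero_outside_ball:
  assumes "ess_support \<mu> f \<subseteq> ball x r"
  shows "AE z in \<mu>. z \<notin> ball x r \<longrightarrow> f z = 0"
  using AE_zero_outside_ess_support[of \<mu> f] by eventually_elim (use assms in blast)

section \<open>The two notions of atom\<close>

lemma sobolev_atom_imp_B_atom:
  assumes m: "sobolev_atom A \<mu> \<beta> x r m"
  shows "B_atom A \<mu> \<beta> \<phi> x r m"
proof -
  have mS: "m \<in> sobolev_space A \<mu> \<beta>" and supp: "ess_support \<mu> m \<subseteq> ball x r"
    and int: "(LINT y|\<mu>. m y) = 0"
    using m by (auto simp: sobolev_atom_def)
  have mL: "m \<in> Lp_space \<mu> \<beta>"
    using mS by (simp add: sobolev_space_def)
  have "average \<mu> (ball x r) m = 0"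
    using integral_ball_support[OF Lp_spaceD(1)[OF mL] AE_zero_outside_ball[OF supp]] int
    by (simp add: average_eq)
  then have "B_op \<mu> \<phi> x r m = m"
    by (simp add: B_op_def)
  moreover have "compact (ess_support \<mu> m)"
    using bounded_subset[OF bounded_ball supp] by (intro compact_of_closed_bounded closed_ess_support)
  ultimately show ?thesis
    using m Lp_locally_integrable[OF mL] unfolding B_atom_def sobolev_atom_def
    by (intro conjI bexI[of _ m]) auto
qed

text \<open>The ball stays the same and only the norm grows, by at most the factor \<open>K\<close>
  of \<open>B_op_sobolev\<close>; dividing by \<open>K\<close> restores the normalisation.\<close>

lemma B_atom_imp_sobolev_atom:
  assumes P: "poincare A \<mu> \<beta>" and \<phi>: "adapted_family A \<mu> \<phi>"
  obtains K where "K > 0" "\<forall>x r m. r > 0 \<longrightarrow> B_atom A \<mu> \<beta> \<phi> x r m \<longrightarrow> sobolev_atom A \<mu> \<beta> x r (\<lambda>y. m y / K)"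
proof -
  obtain K where K: "K > 0" "\<forall>x r g u. r > 0 \<longrightarrow> g \<in> Lp_space \<mu> \<beta> \<longrightarrow>
      (AE z in \<mu>. z \<notin> ball x r \<longrightarrow> g z = 0) \<longrightarrow> sobolev_approx A \<mu> \<beta> g u \<longrightarrow>
      B_op \<mu> \<phi> x r g \<in> Lp_space \<mu> \<beta> \<and>
      (\<exists>v. sobolev_approx A \<mu> \<beta> (B_op \<mu> \<phi> x r g) v \<and>
         lim (\<lambda>n. test_norm A \<mu> \<beta> (v n)) \<le> K * lim (\<lambda>n. test_norm A \<mu> \<beta> (u n)))"
    using B_op_sobolev[OF P \<phi>] by blast
  have "sobolev_atom A \<mu> \<beta> x r (\<lambda>y. m y / K)" if r: "r > 0" and m: "B_atom A \<mu> \<beta> \<phi> x r m" for x r m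
  proof -
    obtain g where g: "g \<in> sobolev_space A \<mu> \<beta>" "ess_support \<mu> g \<subseteq> ball x r"
      "AE y in \<mu>. m y = B_op \<mu> \<phi> x r g y"
      "sobolev_norm A \<mu> \<beta> g \<le> measure \<mu> (ball x r) powr (- 1 / (\<beta> / (\<beta> - 1)))"
      and mm: "m \<in> borel_measurable \<mu>"
      using m unfolding B_atom_def L1_loc_def by blast
    have p: "\<beta> > 0" using beta by simp
    have gL: "g \<in> Lp_space \<mu> \<beta>" using g(1) by (simp add: sobolev_space_def)
    note gz = AE_zero_outside_ball[OF g(2)]
    have BK: "B_op \<mu> \<phi> x r g \<in> Lp_space \<mu> \<beta>"
      "\<exists>v. sobolev_approx A \<mu> \<beta> (B_op \<mu> \<phi> x r g) v \<and>
         lim (\<lambda>n. test_norm A \<mu> \<beta> (v n)) \<le> K * lim (\<lambda>n. test_norm A \<mu> \<beta> (u n))"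
      if "sobolev_approx A \<mu> \<beta> g u" for u
      using K(2) r gL gz that by blast+
    obtain u0 where u0: "sobolev_approx A \<mu> \<beta> g u0"
      using g(1) by (auto simp: sobolev_space_def)
    note BL = BK(1)[OF u0]
    define h where "h = (\<lambda>y. (1 / K) * B_op \<mu> \<phi> x r g y)"
    have hL: "h \<in> Lp_space \<mu> \<beta>"
      unfolding h_def by (rule Lp_scale(1)[OF p BL])
    have mh: "AE y in \<mu>. m y / K = h y"
      using g(3) by eventually_elim (simp add: h_def)
    have mKm: "(\<lambda>y. m y / K) \<in> borel_measurable \<mu>"
      using mm by simp
    have mKL: "(\<lambda>y. m y / K) \<in> Lp_space \<mu> \<beta>"
    proof (rule Lp_mono(1)[OF p mKm hL])
      show "AE y in \<mu>. \<bar>m y / K\<bar> \<le> \<bar>h y\<bar>"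
        using mh by eventually_elim simp
    qed
    have approx: "\<exists>v. sobolev_approx A \<mu> \<beta> (\<lambda>y. m y / K) v \<and>
        lim (\<lambda>n. test_norm A \<mu> \<beta> (v n)) \<le> lim (\<lambda>n. test_norm A \<mu> \<beta> (u n))"
      if u: "sobolev_approx A \<mu> \<beta> g u" for u
    proof -
      obtain v where v: "sobolev_approx A \<mu> \<beta> (B_op \<mu> \<phi> x r g) v"
        "lim (\<lambda>n. test_norm A \<mu> \<beta> (v n)) \<le> K * lim (\<lambda>n. test_norm A \<mu> \<beta> (u n))"
        using BK(2)[OF u] by blast
      \<comment> \<open>The coefficient 0 specialises the lemma on linear combinations to a scalar
        multiple.\<close>
      note c = approx_combination[OF BL v(1) BL v(1), of "1 / K" 0]
      have "sobolev_approx A \<mu> \<beta> h (\<lambda>n y. (1 / K) * v n y + 0 * v n y)"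
        using c(1) by (simp add: h_def)
      then have "sobolev_approx A \<mu> \<beta> (\<lambda>y. m y / K) (\<lambda>n y. (1 / K) * v n y + 0 * v n y)"
        by (rule approx_cong_AE[OF _ Lp_spaceD(1)[OF hL] mKm]) (use mh in \<open>auto elim: eventually_mono\<close>)
      moreover have "lim (\<lambda>n. test_norm A \<mu> \<beta> (\<lambda>y. (1 / K) * v n y + 0 * v n y)) \<le> lim (\<lambda>n. test_norm A \<mu> \<beta> (u n))"
      proof -
        have "lim (\<lambda>n. test_norm A \<mu> \<beta> (\<lambda>y. (1 / K) * v n y + 0 * v n y)) \<le> (1 / K) * lim (\<lambda>n. test_norm A \<mu> \<beta> (v n))"
          using c(2) K(1) by simp
        also have "\<dots> \<le> (1 / K) * (K * lim (\<lambda>n. test_norm A \<mu> \<beta> (u n)))"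
          using v(2) K(1) by (intro mult_left_mono) auto
        finally show ?thesis
          using K(1) by simp
      qed
      ultimately show ?thesis by blast
    qed
    have "sobolev_norm A \<mu> \<beta> (\<lambda>y. m y / K) \<le> 1 * sobolev_norm A \<mu> \<beta> g"
    proof (rule sobolev_norm_ge[OF g(1)])
      fix u assume "sobolev_approx A \<mu> \<beta> g u"
      then obtain v where "sobolev_approx A \<mu> \<beta> (\<lambda>y. m y / K) v"
        "lim (\<lambda>n. test_norm A \<mu> \<beta> (v n)) \<le> lim (\<lambda>n. test_norm A \<mu> \<beta> (u n))"
        using approx by blast
      then show "sobolev_norm A \<mu> \<beta> (\<lambda>y. m y / K) \<le> 1 * lim (\<lambda>n. test_norm A \<mu> \<beta> (u n))"
        using sobolev_norm_le by fastforce
    qed simp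
    then have norm: "sobolev_norm A \<mu> \<beta> (\<lambda>y. m y / K) \<le> measure \<mu> (ball x r) powr (- 1 / (\<beta> / (\<beta> - 1)))"
      using g(4) by simp
    have space: "(\<lambda>y. m y / K) \<in> sobolev_space A \<mu> \<beta>"
      using mKL approx[OF u0] by (auto simp: sobolev_space_def)
    have \<phi>r: "lipschitz (\<phi> x r)" "closure {y. \<phi> x r y \<noteq> 0} \<subseteq> ball x r" "(LINT y|\<mu>. \<phi> x r y) = measure \<mu> (ball x r)"
      using \<phi> r unfolding adapted_family_def by blast+
    \<comment> \<open>The covering set is closed and contained in the open ball, so no boundary
      points of the ball enter the essential support.\<close>
    have "ess_support \<mu> (\<lambda>y. m y / K) \<subseteq> ess_support \<mu> g \<union> closure {y. \<phi> x r y \<noteq> 0}"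
    proof (rule ess_support_subsetI)
      show "closed (ess_support \<mu> g \<union> closure {y. \<phi> x r y \<noteq> 0})"
        by (intro closed_Un closed_ess_support closed_closure)
      show "AE z in \<mu>. z \<notin> ess_support \<mu> g \<union> closure {y. \<phi> x r y \<noteq> 0} \<longrightarrow> m z / K = 0"
        using AE_zero_outside_ess_support[of \<mu> g] g(3)
      proof eventually_elim
        case (elim z)
        then show ?case
          using closure_subset[of "{y. \<phi> x r y \<noteq> 0}"] by (auto simp: B_op_def)
      qed
    qed
    then have supp: "ess_support \<mu> (\<lambda>y. m y / K) \<subseteq> ball x r"
      using g(2) \<phi>r(2) by blast
    have mb: "measure \<mu> (ball x r) > 0" by (rule measure_ball_pos[OF r])
    have gI: "integrable \<mu> g"
    proof -
      have i: "integrable \<mu> (\<lambda>z. indicator (ball x r) z * g z)"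
        by (rule Lp_integral_bound(1)[OF beta gL _ emeasure_ball_finite mb]) simp
      have "AE z in \<mu>. indicator (ball x r) z * g z = g z"
        using gz by eventually_elim (auto simp: indicator_def)
      then show ?thesis
        using integrable_cong_AE_imp[OF i Lp_spaceD(1)[OF gL]] by (auto elim: eventually_mono)
    qed
    \<comment> \<open>The integral of a non-integrable function is 0 by convention, so the nonzero
      value of this integral already implies integrability.\<close>
    have \<phi>I: "integrable \<mu> (\<phi> x r)"
      using \<phi>r(3) mb by (metis less_irrefl not_integrable_integral_eq)
    have "(LINT y|\<mu>. m y / K) = (LINT y|\<mu>. h y)"
      using mh mKm Lp_spaceD(1)[OF hL] by (intro integral_cong_AE) auto
    also have "\<dots> = (1 / K) * ((LINT y|\<mu>. g y) - average \<mu> (ball x r) g * measure \<mu> (ball x r))"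
      using gI \<phi>I by (simp add: h_def B_op_def \<phi>r(3))
    also have "average \<mu> (ball x r) g * measure \<mu> (ball x r) = (LINT y|\<mu>. g y)"
      using integral_ball_support[OF Lp_spaceD(1)[OF gL] gz] mb by (simp add: average_eq)
    finally have int: "(LINT y|\<mu>. m y / K) = 0" by simp
    show ?thesis
      unfolding sobolev_atom_def using space supp norm int by blast
  qed
  then show thesis
    by (intro that[OF K(1)]) blast
qed

end

theorem proposition2p7:
  fixes A :: "('a::{metric_space, second_countable_topology}, 'n::finite) riem_chart set"
    and \<mu> :: "'a measure"
    and \<beta> :: real
    and \<phi> :: "'a \<Rightarrow> real \<Rightarrow> 'a \<Rightarrow> real"
  assumes "riemannian_manifold A"
    and "complete (UNIV :: 'a set)"
    and "riemannian_measure A \<mu>"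
    and "doubling \<mu>"
    and "1 < \<beta>"
    and "poincare A \<mu> \<beta>"
    and "adapted_family A \<mu> \<phi>"
  shows "(\<exists>K>0. \<forall>x r m. r > 0 \<longrightarrow>
            (sobolev_atom A \<mu> \<beta> x r m \<longrightarrow> B_atom A \<mu> \<beta> \<phi> x r m) \<and>
            (B_atom A \<mu> \<beta> \<phi> x r m \<longrightarrow> sobolev_atom A \<mu> \<beta> x r (\<lambda>y. m y / K)))
       \<and> HS_fin A \<mu> \<beta> = HW_fin A \<mu> \<beta> \<phi>
       \<and> HS A \<mu> \<beta> = HW A \<mu> \<beta> \<phi>
       \<and> (\<exists>K>0. \<forall>f \<in> HS A \<mu> \<beta>.
            HW_norm A \<mu> \<beta> \<phi> f \<le> K * HS_norm A \<mu> \<beta> f \<and>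
            HS_norm A \<mu> \<beta> f \<le> K * HW_norm A \<mu> \<beta> \<phi> f)"
proof -
  interpret riem_sobolev A \<mu> \<beta>
    using assms by unfold_locales (auto simp: riemannian_manifold_def)
  obtain K0 where K0: "K0 > 0" "\<forall>x r m. r > 0 \<longrightarrow> B_atom A \<mu> \<beta> \<phi> x r m \<longrightarrow> sobolev_atom A \<mu> \<beta> x r (\<lambda>y. m y / K0)"
    using B_atom_imp_sobolev_atom[OF assms(6,7)] by blast
  have sub: "sobolev_atoms A \<mu> \<beta> \<subseteq> B_atoms A \<mu> \<beta> \<phi>"
    using sobolev_atom_imp_B_atom unfolding sobolev_atoms_def B_atoms_def by blast
  have scale: "\<forall>m\<in>B_atoms A \<mu> \<beta> \<phi>. (\<lambda>y. m y / K0) \<in> sobolev_atoms A \<mu> \<beta>"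
    using K0(2) unfolding sobolev_atoms_def B_atoms_def by blast
  note spaces = atomic_spaces_eq[OF sub K0(1) scale, where M = \<mu>]
  show ?thesis
  proof (intro conjI)
    show "\<exists>K>0. \<forall>x r m. r > 0 \<longrightarrow>
            (sobolev_atom A \<mu> \<beta> x r m \<longrightarrow> B_atom A \<mu> \<beta> \<phi> x r m) \<and>
            (B_atom A \<mu> \<beta> \<phi> x r m \<longrightarrow> sobolev_atom A \<mu> \<beta> x r (\<lambda>y. m y / K))"
      using K0 sobolev_atom_imp_B_atom by blast
    show "HS_fin A \<mu> \<beta> = HW_fin A \<mu> \<beta> \<phi>"
      unfolding HS_fin_def HW_fin_def by (rule spaces(1))
    show "HS A \<mu> \<beta> = HW A \<mu> \<beta> \<phi>"
      unfolding HS_def HW_def by (rule spaces(2))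
    show "\<exists>K>0. \<forall>f \<in> HS A \<mu> \<beta>.
            HW_norm A \<mu> \<beta> \<phi> f \<le> K * HS_norm A \<mu> \<beta> f \<and>
            HS_norm A \<mu> \<beta> f \<le> K * HW_norm A \<mu> \<beta> \<phi> f"
    \<comment> \<open>The inclusion of atoms costs the factor 1, the converse the factor
      \<open>K0\<close>; the maximum serves both inequalities.\<close>
    proof (intro exI[of _ "max 1 K0"] conjI ballI)
      fix f assume f: "f \<in> HS A \<mu> \<beta>"
      have n: "HW_norm A \<mu> \<beta> \<phi> f \<le> HS_norm A \<mu> \<beta> f" "HS_norm A \<mu> \<beta> f \<le> K0 * HW_norm A \<mu> \<beta> \<phi> f"
        using spaces(3,4)[of f] f unfolding HS_def HW_norm_def HS_norm_def by auto
      have n0: "HS_norm A \<mu> \<beta> f \<ge> 0" "HW_norm A \<mu> \<beta> \<phi> f \<ge> 0"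
        using f spaces(2) unfolding HS_def HW_norm_def HS_norm_def by (auto intro: atomic_norm_nonneg)
      show "HW_norm A \<mu> \<beta> \<phi> f \<le> max 1 K0 * HS_norm A \<mu> \<beta> f"
        using n(1) mult_right_mono[OF max.cobounded1 n0(1), of 1 K0] by simp
      show "HS_norm A \<mu> \<beta> f \<le> max 1 K0 * HW_norm A \<mu> \<beta> \<phi> f"
        using n(2) mult_right_mono[OF max.cobounded2 n0(2), of K0 1] by simp
    qed simp
  qed
qed

end
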